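(* Let $J$ be a nonempty open subset of $\mathcal I$ and let $k\ge2$. There exist $c_0>0$, $\mu_0\ge1$ and $\widehat s_0\ge1$ such that for all $\mu\ge\mu_0$ and all $\lambda\ge\mu$, for all $\alpha\ge0$, for all $T>0$ and for all $s\ge\widehat s_0(1+\alpha)(T^k+T^{k-1})$, the following inequality holds for all functions $\eta\in C^2([0,T];C^4(\mathcal I))$: $$ \begin{aligned} &\iint_{(0,T)\times\mathcal I}e^{2s\varphi_0}\Big(s^7\mu^8\xi_0^7|\eta|^2+s^5\mu^6\xi_0^5|\partial_{x_1}\eta|^2+s^3\mu^4\xi_0^3|\partial_{x_1}^2\eta|^2\\ &\qquad\qquad+(1+\alpha^2)s^3\mu^4\xi_0^3|\partial_t\eta|^2+s\mu^2\xi_0|\partial_{x_1}^3\eta|^2+(1+\alpha^2)s\mu^2\xi_0|\partial_t\partial_{x_1}\eta|^2\Big)\\ &\le c_0\Big(\iint_{(0,T)\times J}e^{2s\varphi_0}\Big(s^7\mu^8\xi_0^7|\eta|^2+(1+\alpha^2)s^3\mu^4\xi_0^3|\partial_t\eta|^2+s\mu^2\xi_0|\partial_{x_1}^3\eta|^2+(1+\alpha^2)s\mu^2\xi_0|\partial_t\partial_{x_1}\eta|^2\Big)\\ &\qquad+\alpha^2s^3\mu^4\iint_{(0,T)\times\mathcal I}\xi_0^3e^{2s\varphi_0}|\partial_t\eta|^2+\iint_{(0,T)\times\mathcal I}e^{2s\varphi_0}\left|\partial_t^2\eta-\alpha\partial_{x_1}^2\partial_t\eta+\partial_{x_1}^4\eta\right|^2\Big).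 \end{aligned} $$
   Context: $\mathcal I=\mathbb R/2\pi\mathbb Z$ is the one-dimensional torus and $\Omega=\mathcal I\times(0,1)$; $\omega$ is a fixed nonempty open subset of $\Omega$ and $\partial_n$ is the outward normal derivative on $\partial\Omega$. Weights: $\ell(t)=t(T-t)$ for $t\in(0,T)$. Fix nonempty open sets $\omega_0\Subset\omega$, $J_0\Subset J$, and smooth functions $\psi_\Omega$ (on $\overline\Omega$) and $\psi_{\mathcal I}$ (on $\mathcal I$) such that $\psi_\Omega>0$ in $\Omega$, $\psi_\Omega=0$ and $\partial_n\psi_\Omega=-1$ on $\partial\Omega$, $\nabla\psi_\Omega(x)=0\Rightarrow x\in\omega_0$; and $\psi_{\mathcal I}>0$ on $\mathcal I$, $\psi_{\mathcal I}'(x_1)=0\Rightarrow x_1\in J_0$ (such functions exist). These are fixed once and for all, independently of $\alpha,\lambda,\mu,s,T$. Let $\Psi=\|\psi_\Omega\|_{L^\infty(\Omega)}+\|\psi_{\mathcal I}\|_{L^\infty(\mathcal I)}$. For $\lambda\ge\mu>0$ set $$\varphi_0(t,x_1)=\frac{e^{\mu\psi_{\mathcal I}(x_1)+8\lambda\Psi}-e^{10\lambda\Psi}}{\ell(t)^{k/2}},\qquad \xi_0(t,x_1)=\frac{e^{\mu\psi_{\mathcal I}(x_1)+8\lambda\Psi}}{\ell(t)^{k/2}}.$$ *)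

theory Defs
  imports
    "HOL-Analysis.Analysis"
    "HOL-Library.Periodic_Fun"
    "HOL-Probability.Essential_Supremum"
begin

text \<open>
  The torus \<open>\<real>/2\<pi>\<int>\<close> is handled through lifts to the line: a function on it is a
  \<open>2\<pi>\<close>-periodic function on \<open>\<real>\<close>, a subset of it is a \<open>2\<pi>\<close>-periodic subset of \<open>\<real>\<close>, and
  integration over it is integration over the fundamental cell \<open>[0,2\<pi>)\<close>.  The domain
  \<open>\<Omega> = I \<times> (0,1)\<close> likewise lifts to the strip \<open>\<real> \<times> (0,1)\<close>, with periodicity in the
  first coordinate.  Openness and closure commute with lifting.
\<close>

definition open_in_torus :: "real set \<Rightarrow> bool" where
  "open_in_torus J \<longleftrightarrow> open J \<and> periodic_fun_simple (\<lambda>x. x \<in> J) (2 * pi)"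

definition Omega :: "(real \<times> real) set" where
  "Omega = UNIV \<times> {0<..<1}"

definition open_in_Omega :: "(real \<times> real) set \<Rightarrow> bool" where
  "open_in_Omega w \<longleftrightarrow>
     open w \<and> w \<subseteq> Omega \<and> (\<forall>y. periodic_fun_simple (\<lambda>x. (x, y) \<in> w) (2 * pi))"

text \<open>
  For a set \<open>S\<close> at each point of which derivatives within \<open>S\<close> are unique (below: the line and
  the closed strip), \<open>Ck_on n S f\<close> says that \<open>f\<close> is of class \<open>C\<^sup>n\<close> on \<open>S\<close>; at boundary
  points, the derivatives are one-sided.
\<close>

primrec Ck_on :: "nat \<Rightarrow> 'a::euclidean_space set \<Rightarrow> ('a \<Rightarrow> real) \<Rightarrow> bool" where
  "Ck_on 0 S f \<longleftrightarrow> continuous_on S f"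
| "Ck_on (Suc n) S f \<longleftrightarrow>
     (\<exists>f'. (\<forall>x\<in>S. (f has_derivative f' x) (at x within S)) \<and> (\<forall>h. Ck_on n S (\<lambda>x. f' x h)))"

definition smooth_on :: "'a::euclidean_space set \<Rightarrow> ('a \<Rightarrow> real) \<Rightarrow> bool" where
  "smooth_on S f \<longleftrightarrow> (\<forall>n. Ck_on n S f)"

text \<open>
  The two equations on the \<open>y\<close>-derivative express that the outward normal derivative is \<open>-1\<close>:
  the outward unit normal is \<open>(0,1)\<close> on \<open>y = 1\<close> and \<open>(0,-1)\<close> on \<open>y = 0\<close>.
\<close>

definition weight_fun_Omega :: "(real \<times> real) set \<Rightarrow> (real \<times> real \<Rightarrow> real) \<Rightarrow> bool" where
  "weight_fun_Omega w0 psi \<longleftrightarrow>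
     (\<forall>y. periodic_fun_simple (\<lambda>x. psi (x, y)) (2 * pi)) \<and>
     smooth_on (closure Omega) psi \<and>
     (\<forall>p\<in>Omega. psi p > 0) \<and>
     (\<forall>p\<in>frontier Omega. psi p = 0) \<and>
     (\<forall>x. ((\<lambda>y. psi (x, y)) has_real_derivative -1) (at 1 within {0..1})) \<and>
     (\<forall>x. ((\<lambda>y. psi (x, y)) has_real_derivative 1) (at 0 within {0..1})) \<and>
     (\<forall>p\<in>closure Omega.
        (psi has_derivative (\<lambda>_. 0)) (at p within closure Omega) \<longrightarrow> p \<in> w0)"

definition weight_fun_torus :: "real set \<Rightarrow> (real \<Rightarrow> real) \<Rightarrow> bool" where
  "weight_fun_torus J0 psi \<longleftrightarrow>
     periodic_fun_simple psi (2 * pi) \<and>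
     smooth_on UNIV psi \<and>
     (\<forall>x. psi x > 0) \<and>
     (\<forall>x. deriv psi x = 0 \<longrightarrow> x \<in> J0)"

definition Linf_norm :: "'a::euclidean_space set \<Rightarrow> ('a \<Rightarrow> real) \<Rightarrow> real" where
  "Linf_norm S f = real_of_ereal (esssup (restrict_space lborel S) (\<lambda>x. ereal \<bar>f x\<bar>))"

definition Psi_const :: "(real \<times> real \<Rightarrow> real) \<Rightarrow> (real \<Rightarrow> real) \<Rightarrow> real" where
  "Psi_const psiO psiI =
     Linf_norm ({0..<2 * pi} \<times> {0<..<1}) psiO + Linf_norm {0..<2 * pi} psiI"

text \<open>
  The weights are only meaningful for \<open>0 < t < T\<close>; \<open>Psi\<close> stands for \<open>Psi_const psiO psiI\<close>.
\<close>

definition ell :: "real \<Rightarrow> real \<Rightarrow> real" where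
  "ell T t = t * (T - t)"

definition phi0 ::
  "real \<Rightarrow> real \<Rightarrow> (real \<Rightarrow> real) \<Rightarrow> real \<Rightarrow> real \<Rightarrow> real \<Rightarrow> real \<Rightarrow> real \<Rightarrow> real" where
  "phi0 k Psi psiI T lam mu t x =
     (exp (mu * psiI x + 8 * lam * Psi) - exp (10 * lam * Psi)) / ell T t powr (k / 2)"

definition xi0 ::
  "real \<Rightarrow> real \<Rightarrow> (real \<Rightarrow> real) \<Rightarrow> real \<Rightarrow> real \<Rightarrow> real \<Rightarrow> real \<Rightarrow> real \<Rightarrow> real" where
  "xi0 k Psi psiI T lam mu t x =
     exp (mu * psiI x + 8 * lam * Psi) / ell T t powr (k / 2)"

definition C4_torus :: "(real \<Rightarrow> real) \<Rightarrow> bool" where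
  "C4_torus f \<longleftrightarrow> periodic_fun_simple f (2 * pi) \<and> Ck_on 4 UNIV f"

definition C4_norm :: "(real \<Rightarrow> real) \<Rightarrow> real" where
  "C4_norm f = (\<Sum>i\<le>4. SUP x. \<bar>(deriv ^^ i) f x\<bar>)"

text \<open>
  \<open>Cm_C4 m T eta\<close> is membership in \<open>C\<^sup>m([0,T]; C\<^sup>4)\<close>: the map \<open>t \<mapsto> eta t\<close> is \<open>m\<close> times
  continuously differentiable on \<open>[0,T]\<close> as a map into the space \<open>C\<^sup>4\<close> with its norm
  (one-sided at the end points).  The values of \<open>eta t\<close> for \<open>t\<close> outside \<open>[0,T]\<close> are irrelevant.
\<close>

primrec Cm_C4 :: "nat \<Rightarrow> real \<Rightarrow> (real \<Rightarrow> real \<Rightarrow> real) \<Rightarrow> bool" where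
  "Cm_C4 0 T eta \<longleftrightarrow>
     (\<forall>t\<in>{0..T}. C4_torus (eta t) \<and>
        ((\<lambda>r. C4_norm (\<lambda>x. eta r x - eta t x)) \<longlongrightarrow> 0) (at t within {0..T}))"
| "Cm_C4 (Suc m) T eta \<longleftrightarrow>
     (\<exists>eta'. Cm_C4 m T eta' \<and>
        (\<forall>t\<in>{0..T}. C4_torus (eta t) \<and>
           ((\<lambda>r. C4_norm (\<lambda>x. (eta r x - eta t x) / (r - t) - eta' t x)) \<longlongrightarrow> 0)
             (at t within {0..T})))"

definition dt :: "nat \<Rightarrow> (real \<Rightarrow> real \<Rightarrow> real) \<Rightarrow> real \<Rightarrow> real \<Rightarrow> real" where
  "dt n eta t x = (deriv ^^ n) (\<lambda>r. eta r x) t"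

definition dx :: "nat \<Rightarrow> (real \<Rightarrow> real \<Rightarrow> real) \<Rightarrow> real \<Rightarrow> real \<Rightarrow> real" where
  "dx n eta t x = (deriv ^^ n) (eta t) x"

definition integral_cyl :: "real \<Rightarrow> real set \<Rightarrow> (real \<Rightarrow> real \<Rightarrow> real) \<Rightarrow> real" where
  "integral_cyl T A f =
     set_lebesgue_integral lborel ({0<..<T} \<times> (A \<inter> {0..<2 * pi})) (\<lambda>(t, x). f t x)"

end

theory Submission
  imports Defs
begin

text \<open>
  Conjugation with \<open>e\<^sup>s\<^sup>\<phi>\<close> splits the beam operator into a formally symmetric and a formally skew part, up to
  lower order terms.  Their product is a divergence plus a quadratic form whose leading part carries the factor
  \<open>b = s \<partial>\<^sub>x\<^sup>2 \<phi>\<^sub>0\<close>; where \<open>\<psi>'\<close> does not vanish, \<open>\<mu>\<close> large makes \<open>b\<close> comparable to \<open>s \<mu>\<^sup>2 \<xi>\<^sub>0\<close>, and the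
  form controls \<open>\<eta>\<close> and its \<open>x\<close>-derivatives up to order three, and \<open>\<alpha> \<partial>\<^sub>t \<partial>\<^sub>x \<eta>\<close>, at the price of \<open>\<alpha>\<^sup>2 |\<partial>\<^sub>t \<eta>|\<^sup>2\<close>.
  The errors are smaller by \<open>1 / (s \<xi>\<^sub>0)\<close>, uniformly in \<open>\<alpha>\<close> because \<open>s\<close> dominates \<open>1 + \<alpha>\<close>.  Testing the
  equation with multiples of \<open>\<eta>\<close> and \<open>\<partial>\<^sub>x\<^sup>2 \<eta>\<close> recovers \<open>\<partial>\<^sub>t \<eta>\<close> and \<open>\<partial>\<^sub>t \<partial>\<^sub>x \<eta>\<close> without the factor \<open>\<alpha>\<close>.  Near the
  critical points of \<open>\<psi>\<close>, which lie in \<open>J\<close>, the local terms in \<open>\<partial>\<^sub>x \<eta>\<close> and \<open>\<partial>\<^sub>x\<^sup>2 \<eta>\<close> are interpolated between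
  \<open>\<eta>\<close> and \<open>\<partial>\<^sub>x\<^sup>3 \<eta>\<close> with a cutoff supported in \<open>J\<close>.
\<close>

text \<open>At a fixed point (t, x) the jets are treated as free real variables, and every
  inequality between weights becomes a comparison of quadratic forms. After scaling an x-derivative
  by \<open>rho\<close> and a t-derivative by \<open>rho^2 / (1 + al)\<close>, their coefficients
  are bounded, so the constants depend only on bounds for \<open>psiI\<close>, on \<open>k\<close>
  and on \<open>gam\<close>. Integration enters only through divergences with vanishing weighted
  integral. This fixes the order of choices. The constants of the pointwise estimates do not involve
  \<open>del\<close>, the upper bound for 1 / (s \<xi>); hence \<open>del\<close> can be taken small
  after them, and 1 / \<open>del\<close> becomes the threshold for s. Uniformity in \<lambda> is the
  delicate point of the weights: the time derivatives of the exponent involve \<phi>, which may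
  exceed \<xi> by a factor exp (2 \<lambda> \<Psi>). The factor exp (8 \<lambda> \<Psi>) inside
  \<xi> compensates for it.\<close>

section \<open>The conjugated operator and its commutator\<close>

text \<open>
  Notation: \<open>wij\<close> stands for \<open>e\<^sup>-\<^sup>\<kappa> \<partial>\<^sub>t\<^sup>i \<partial>\<^sub>x\<^sup>j (e\<^sup>\<kappa> \<eta>)\<close> with \<open>\<kappa> = s \<phi>\<^sub>0\<close>, and \<open>nij\<close> for \<open>\<partial>\<^sub>t\<^sup>i \<partial>\<^sub>x\<^sup>j \<eta>\<close>;
  \<open>a, b, b1, b2\<close> are the first four \<open>x\<close>-derivatives of \<open>\<kappa>\<close>, \<open>th = \<kappa>\<^sub>t\<close>, \<open>d = \<kappa>\<^sub>t\<^sub>t\<close>, and \<open>h = \<kappa>\<^sub>t / \<kappa>\<close>, so that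
  \<open>a\<^sub>t = th\<^sub>x = h a\<close>.  Because of the factor \<open>e\<^sup>-\<^sup>\<kappa>\<close>, the \<open>x\<close>-derivative of \<open>wij\<close> is \<open>wi(j+1) - a wij\<close>, and
  \<open>F\<^sub>x + 2 a F\<close> is \<open>e\<^sup>-\<^sup>2\<^sup>\<kappa>\<close> times an exact derivative.
\<close>

definition symm_part :: "real \<Rightarrow> real \<Rightarrow> real \<Rightarrow> real \<Rightarrow> real \<Rightarrow> real \<Rightarrow> real \<Rightarrow> real \<Rightarrow> real" where
  "symm_part al a th w00 w02 w04 w11 w20 =
    w20 + th^2 * w00 + w04 + 6 * a^2 * w02 + a^4 * w00 + 2 * al * a * w11 + al * th * (w02 + a^2 * w00)"

text \<open>The terms with \<open>b\<close> are half of what transposing \<open>4 * a * w03\<close>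
  and \<open>4 * a^3 * w01\<close> produces at the next order; they make these two operators skew up
  to terms with more derivatives on the weight.\<close>

definition anti_part :: "real \<Rightarrow> real \<Rightarrow> real \<Rightarrow> real \<Rightarrow> real \<Rightarrow> real \<Rightarrow> real \<Rightarrow> real \<Rightarrow> real \<Rightarrow> real \<Rightarrow> real" where
  "anti_part al a b th w00 w01 w02 w03 w10 w12 =
    - (2 * th * w10) - 4 * a * w03 - 6 * b * w02 - 4 * a^3 * w01 - 6 * a^2 * b * w00
     - al * (w12 + a^2 * w10) - 2 * al * th * a * w01"

text \<open>The fluxes were found by computer algebra: they absorb every term of \<open>symm_part * anti_part\<close> that can be integrated by parts.\<close>

definition flux_x :: "real \<Rightarrow> real \<Rightarrow> real \<Rightarrow> real \<Rightarrow> real \<Rightarrow> real \<Rightarrow> real \<Rightarrow> real \<Rightarrow> real \<Rightarrow> real \<Rightarrow> real \<Rightarrow> real \<Rightarrow> real" where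
  "flux_x al a b th w00 w01 w02 w03 w10 w11 w12 w20 =
    (- al) * w11 * w20
    + (- al) * w03 * w12
    + (- 2 * a) * w03^2
    + (- 2 * a - a * al^2) * w11^2
    + (4 * a) * w10 * w12
    + (- (a^2 * al) - 2 * th) * w03 * w10
    + (- 6 * b) * w02 * w03
    + (2 * th - 7 * a^2 * al) * w02 * w11
    + (2 * b) * w10 * w11
    + (- 2 * a * al * th - 4 * a^3) * w01 * w03
    + (- a * al * th - 10 * a^3) * w02^2
    + (2 * a^3 - a * al * th - a^3 * al^2) * w10^2
    + (2 * a * al * b) * w02 * w10
    + (- (a^2 * al^2 * th) - a^4 * al - al * th^2) * w00 * w11
    + (- (6 * a^2 * b)) * w00 * w03
    + (- (a^2 * al^2 * th) - 12 * a^2 * th - 6 * a^4 * al - 2 * al * th^2) * w01 * w10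
    + (- (14 * a^2 * b)) * w01 * w02
    + (- (4 * a * th^2) - 4 * a^3 * al * th - 4 * a^5) * w00 * w02
    + (2 * a * th^2 - a * al^2 * th^2 - 6 * a^3 * al * th - 10 * a^5) * w01^2
    + (- (8 * a^3 * al * b)) * w00 * w10
    + (- (22 * a^4 * b)) * w00 * w01
    + (- (a * al * th^3) - a^3 * al^2 * th^2 - 2 * a^3 * th^2 - 3 * a^5 * al * th - 2 * a^7) * w00^2"

definition flux_t :: "real \<Rightarrow> real \<Rightarrow> real \<Rightarrow> real \<Rightarrow> real \<Rightarrow> real \<Rightarrow> real \<Rightarrow> real \<Rightarrow> real \<Rightarrow> real \<Rightarrow> real" where
  "flux_t al a b th w00 w01 w02 w03 w10 w11 =
    ((1/2) * al) * w11^2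
    + ((1/2) * al) * w03^2
    + (- 4 * a) * w03 * w10
    + (- ((1/2) * a^2 * al) - th) * w10^2
    + (- 6 * b) * w02 * w10
    + ((1/2) * a^2 * al - (1/2) * al^2 * th - th) * w02^2
    + (- 2 * a * al * th - 4 * a^3) * w01 * w10
    + (- (6 * a^2 * b)) * w00 * w10
    + (6 * a^2 * th + (3/2) * al * th^2 - a^2 * al^2 * th - (1/2) * a^4 * al) * w01^2
    + (- ((3/2) * a^2 * al * th^2) - (1/2) * a^4 * al^2 * th - a^4 * th - (1/2) * a^6 * al - th^3) * w00^2"

text \<open>Named separately because it links two divergence identities: the one in x subtracts it,
  the one in t produces it.\<close>

definition flux_t_deriv :: "real \<Rightarrow> real \<Rightarrow> real \<Rightarrow> real \<Rightarrow> real \<Rightarrow> real \<Rightarrow> real \<Rightarrow> real \<Rightarrow> real \<Rightarrow> real \<Rightarrow> real \<Rightarrow> real \<Rightarrow> real \<Rightarrow> real \<Rightarrow> real \<Rightarrow> real \<Rightarrow> real" where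
  "flux_t_deriv al a b h th d w00 w01 w02 w03 w10 w11 w12 w13 w20 w21 =
    (al) * w11 * w21
    + (al) * w03 * w13
    + (- 4 * a * h) * w03 * w10
    + (- 4 * a) * w10 * w13
    + (- 4 * a) * w03 * w20
    + (- (a^2 * al * h) - 6 * a^2 * b - d) * w10^2
    + (- (a^2 * al) - 2 * th) * w10 * w20
    + (- 6 * b * h) * w02 * w10
    + (- 6 * b) * w10 * w12
    + (- 6 * b) * w02 * w20
    + (a^2 * al * h - (1/2) * al^2 * d - d) * w02^2
    + (a^2 * al - al^2 * th - 2 * th) * w02 * w12
    + (- 2 * a * al * d - 2 * a * al * h * th - 12 * a^3 * h) * w01 * w10
    + (- 2 * a * al * th - 4 * a^3) * w10 * w11
    + (- 2 * a * al * th - 4 * a^3) * w01 * w20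
    + (- (3 * a^2 * al * th^2) - 18 * a^2 * b * h - a^4 * al^2 * th - 2 * a^4 * th - a^6 * al - 2 * th^3) * w00 * w10
    + (- (6 * a^2 * b)) * w00 * w20
    + (6 * a^2 * d + 12 * a^2 * h * th + 3 * al * d * th - a^2 * al^2 * d - 2 * a^2 * al^2 * h * th - 2 * a^4 * al * h) * w01^2
    + (12 * a^2 * th + 3 * al * th^2 - 2 * a^2 * al^2 * th - a^4 * al) * w01 * w11
    + (- (3 * a^2 * al * d * th) - 3 * a^2 * al * h * th^2 - (1/2) * a^4 * al^2 * d - 2 * a^4 * al^2 * h * th - a^4 * d - 4 * a^4 * h * th - 3 * a^6 * al * h - 3 * d * th^2) * w00^2"

text \<open>
  The principal commutator, of size \<open>b\<close>, and the terms that are smaller by a factor \<open>1 / (s \<xi>\<^sub>0)\<close>.  The only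
  indefinite product in \<open>comm_main\<close> costs a multiple of \<open>al\<^sup>2 w10\<^sup>2\<close>, which the estimate allows on the right.
\<close>

definition comm_main :: "real \<Rightarrow> real \<Rightarrow> real \<Rightarrow> real \<Rightarrow> real \<Rightarrow> real \<Rightarrow> real \<Rightarrow> real \<Rightarrow> real \<Rightarrow> real" where
  "comm_main al a b w00 w01 w02 w03 w10 w11 =
    8 * b * ((w03 + 2 * a^2 * w01)^2 + a^2 * w02^2 + 5 * a^4 * w01^2 + a^6 * w00^2)
    + b * (al^2 * w11^2 + 3 * al^2 * a^2 * w10^2 + 32 * al * a^3 * w01 * w10)"

definition comm_err :: "real \<Rightarrow> real \<Rightarrow> real \<Rightarrow> real \<Rightarrow> real \<Rightarrow> real \<Rightarrow> real \<Rightarrow> real \<Rightarrow> real \<Rightarrow> real \<Rightarrow> real \<Rightarrow> real \<Rightarrow> real \<Rightarrow> real" where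
  "comm_err al a b b1 h th d w00 w01 w02 w03 w10 w11 =
    (6 * b1) * w02 * w03
    + (- 2 * b1) * w10 * w11
    + (- 2 * a * h) * w02 * w11
    + (6 * a * h) * w03 * w10
    + (6 * b * h - 2 * a * al * b1 - 2 * al * b^2) * w02 * w10
    + ((1/2) * al^2 * d + d - 5 * al * b * th) * w02^2
    + (2 * a^2 * al * h + al * b * th + d) * w10^2
    + (2 * a^2 * al * h + 2 * al * b * th) * w01 * w03
    + (12 * a * b^2 + 6 * a^2 * b1) * w00 * w03
    + (28 * a * b^2 + 14 * a^2 * b1) * w01 * w02
    + (2 * a * al * h * th + 2 * a * al^2 * b * th + a^3 * al^2 * h) * w00 * w11
    + (2 * a * al * d + 6 * a * al * h * th + 2 * a * al^2 * b * th + 24 * a * b * th + a^3 * al^2 * h + 24 * a^3 * h) * w01 * w10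
    + (24 * a^2 * al * b^2 + 18 * a^2 * b * h + 8 * a^3 * al * b1) * w00 * w10
    + (8 * a^2 * h * th + 4 * a^4 * al * h - 2 * b * th^2) * w00 * w02
    + (18 * a^2 * al * b * th + a^2 * al^2 * d + 4 * a^2 * al^2 * h * th + 8 * a^4 * al * h + al^2 * b * th^2 - 6 * a^2 * d - 16 * a^2 * h * th - 3 * al * d * th - 2 * b * th^2) * w01^2
    + (88 * a^3 * b^2 + 22 * a^4 * b1) * w00 * w01
    + (3 * a^2 * al * d * th + 6 * a^2 * al * h * th^2 + 3 * a^2 * al^2 * b * th^2 + 9 * a^4 * al * b * th + (1/2) * a^4 * al^2 * d + 4 * a^4 * al^2 * h * th + a^4 * d + 8 * a^4 * h * th + 6 * a^6 * al * h + al * b * th^3 + 3 * d * th^2) * w00^2"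

text \<open>A polynomial identity once the derivatives are substituted. The top order jets
  \<open>w13\<close> and \<open>w21\<close> arise from differentiating \<open>flux_x\<close> and are
  matched in \<open>flux_t_deriv\<close>; the arbitrary \<open>d\<close> cancels between
  \<open>comm_err\<close> and \<open>flux_t_deriv\<close>.\<close>

lemma flux_x_deriv:
  fixes a b th w00 w01 w02 w03 w10 w11 w12 w20 :: "real \<Rightarrow> real"
  assumes "(a has_real_derivative b x) (at x)"
    and "(b has_real_derivative b1) (at x)"
    and "(th has_real_derivative h * a x) (at x)"
    and "(w00 has_real_derivative w01 x - a x * w00 x) (at x)"
    and "(w01 has_real_derivative w02 x - a x * w01 x) (at x)"
    and "(w02 has_real_derivative w03 x - a x * w02 x) (at x)"
    and "(w03 has_real_derivative w04 - a x * w03 x) (at x)"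
    and "(w10 has_real_derivative w11 x - a x * w10 x) (at x)"
    and "(w11 has_real_derivative w12 x - a x * w11 x) (at x)"
    and "(w12 has_real_derivative w13 - a x * w12 x) (at x)"
    and "(w20 has_real_derivative w21 - a x * w20 x) (at x)"
  shows "((\<lambda>x. flux_x al (a x) (b x) (th x) (w00 x) (w01 x) (w02 x) (w03 x) (w10 x) (w11 x) (w12 x) (w20 x)) has_real_derivative
    symm_part al (a x) (th x) (w00 x) (w02 x) w04 (w11 x) (w20 x) * anti_part al (a x) (b x) (th x) (w00 x) (w01 x) (w02 x) (w03 x) (w10 x) (w12 x)
     - comm_main al (a x) (b x) (w00 x) (w01 x) (w02 x) (w03 x) (w10 x) (w11 x) - comm_err al (a x) (b x) b1 h (th x) d (w00 x) (w01 x) (w02 x) (w03 x) (w10 x) (w11 x)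
     - flux_t_deriv al (a x) (b x) h (th x) d (w00 x) (w01 x) (w02 x) (w03 x) (w10 x) (w11 x) (w12 x) w13 (w20 x) w21
     - 2 * a x * flux_x al (a x) (b x) (th x) (w00 x) (w01 x) (w02 x) (w03 x) (w10 x) (w11 x) (w12 x) (w20 x)) (at x)"
  unfolding flux_x_def
  apply (rule DERIV_cong)
   apply (rule derivative_eq_intros assms refl)+
  unfolding symm_part_def anti_part_def comm_main_def comm_err_def flux_t_deriv_def
  apply (simp add: algebra_simps power2_eq_square power3_eq_cube eval_nat_numeral)
  done

text \<open>The weights \<open>a\<close> and \<open>b\<close> depend on t only through the common
  factor \<ell>^(-k/2), hence the shared logarithmic derivative \<open>h\<close>.\<close>

lemma flux_t_has_deriv:
  fixes a b th w00 w01 w02 w03 w10 w11 :: "real \<Rightarrow> real"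
  assumes "(a has_real_derivative h * a x) (at x)"
    and "(b has_real_derivative h * b x) (at x)"
    and "(th has_real_derivative d) (at x)"
    and "(w00 has_real_derivative w10 x - th x * w00 x) (at x)"
    and "(w01 has_real_derivative w11 x - th x * w01 x) (at x)"
    and "(w02 has_real_derivative w12 - th x * w02 x) (at x)"
    and "(w03 has_real_derivative w13 - th x * w03 x) (at x)"
    and "(w10 has_real_derivative w20 - th x * w10 x) (at x)"
    and "(w11 has_real_derivative w21 - th x * w11 x) (at x)"
  shows "((\<lambda>x. flux_t al (a x) (b x) (th x) (w00 x) (w01 x) (w02 x) (w03 x) (w10 x) (w11 x)) has_real_derivative
    flux_t_deriv al (a x) (b x) h (th x) d (w00 x) (w01 x) (w02 x) (w03 x) (w10 x) (w11 x) w12 w13 w20 w21 - 2 * th x * flux_t al (a x) (b x) (th x) (w00 x) (w01 x) (w02 x) (w03 x) (w10 x) (w11 x)) (at x)"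
  unfolding flux_t_def
  apply (rule DERIV_cong)
   apply (rule derivative_eq_intros assms refl)+
  unfolding flux_t_deriv_def
  apply (simp add: field_simps power2_eq_square power3_eq_cube eval_nat_numeral)
  done

text \<open>
  Scaling turns all weights into bounded quantities.  Every remaining factor \<open>al\<close> appears as \<open>bt = al / (1 + al)\<close>,
  which is what makes the bounds uniform in \<open>al\<close>.
\<close>

definition comm_err_scaled :: "real \<Rightarrow> real \<Rightarrow> real \<Rightarrow> real \<Rightarrow> real \<Rightarrow> real \<Rightarrow> real \<Rightarrow> real \<Rightarrow> real \<Rightarrow> real \<Rightarrow> real \<Rightarrow> real
    \<Rightarrow> real \<Rightarrow> real \<Rightarrow> real \<Rightarrow> real \<Rightarrow> real" where
  "comm_err_scaled del r om bt A B B1 H Th D y0 y1 y2 y3 z0 z1 =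
    (6 * B1 * r) * y2 * y3
    + (- (2 * B1 * om^2 * r)) * z0 * z1
    + (- (2 * A * H * om^2)) * y2 * z1
    + (6 * A * H * om^2) * y3 * z0
    + (6 * B * H * del * om^2 * r - 2 * A * B1 * bt * r - 2 * B^2 * bt * r) * y2 * z0
    + ((1/2) * D * bt^2 + D * om^2 - 5 * B * Th * bt) * y2^2
    + (2 * A^2 * H * bt * om^2 + B * Th * bt * om^2 + D * om^4) * z0^2
    + (2 * A^2 * H * bt + 2 * B * Th * bt) * y1 * y3
    + (12 * A * B^2 * r + 6 * A^2 * B1 * r) * y0 * y3
    + (28 * A * B^2 * r + 14 * A^2 * B1 * r) * y1 * y2
    + (2 * A * B * Th * bt^2 + 2 * A * H * Th * bt * del * om^2 + A^3 * H * bt^2) * y0 * z1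
    + (2 * A * B * Th * bt^2 + 24 * A * B * Th * om^2 + 2 * A * D * bt * om^2 + 6 * A * H * Th * bt * del * om^2 + A^3 * H * bt^2 + 24 * A^3 * H * om^2) * y1 * z0
    + (18 * A^2 * B * H * del * om^2 * r + 24 * A^2 * B^2 * bt * r + 8 * A^3 * B1 * bt * r) * y0 * z0
    + (8 * A^2 * H * Th * del * om^2 + 4 * A^4 * H * bt - 2 * B * Th^2 * del * om^2) * y0 * y2
    + (18 * A^2 * B * Th * bt + A^2 * D * bt^2 + 4 * A^2 * H * Th * bt^2 * del + 8 * A^4 * H * bt + B * Th^2 * bt^2 * del - 6 * A^2 * D * om^2 - 16 * A^2 * H * Th * del * om^2 - 2 * B * Th^2 * del * om^2 - 3 * D * Th * bt * del * om^2) * y1^2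
    + (88 * A^3 * B^2 * r + 22 * A^4 * B1 * r) * y0 * y1
    + (3 * A^2 * B * Th^2 * bt^2 * del + 3 * A^2 * D * Th * bt * del * om^2 + 6 * A^2 * H * Th^2 * bt * del^2 * om^2 + 9 * A^4 * B * Th * bt + (1/2) * A^4 * D * bt^2 + A^4 * D * om^2 + 4 * A^4 * H * Th * bt^2 * del + 8 * A^4 * H * Th * del * om^2 + 6 * A^6 * H * bt + B * Th^3 * bt * del^2 * om^2 + 3 * D * Th^2 * del^2 * om^4) * y0^2"

text \<open>Against \<open>comm_main_scaling\<close> the prefactor has a second \<open>del\<close>.
  This is the whole gain of the lower order terms, and a small \<open>del\<close> makes them
  absorbable.\<close>

lemma comm_err_scaling:
  "comm_err al (rho * A) (del * r * rho^2 * B) (del^2 * r^2 * rho^3 * B1) (del^2 * r * om * rho^2 * H)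
     (del * om * rho^2 * Th) (del^2 * r * om^2 * rho^4 * D)
     y0 (rho * y1) (rho^2 * y2) (rho^3 * y3) (om * rho^2 * z0) (om * rho^3 * z1)
   = rho^8 * del^2 * r * comm_err_scaled del r om (al * om) A B B1 H Th D y0 y1 y2 y3 z0 z1"
  unfolding comm_err_def comm_err_scaled_def
  by (simp add: field_simps eval_nat_numeral)

section \<open>Bounds for quadratic forms with bounded coefficients\<close>

lemma bound_add: "\<bar>x\<bar> \<le> X \<Longrightarrow> \<bar>y\<bar> \<le> Y \<Longrightarrow> \<bar>x + y\<bar> \<le> X + Y" for x y :: real by linarith
lemma bound_diff: "\<bar>x\<bar> \<le> X \<Longrightarrow> \<bar>y\<bar> \<le> Y \<Longrightarrow> \<bar>x - y\<bar> \<le> X + Y" for x y :: real by linarith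
lemma bound_uminus: "\<bar>x\<bar> \<le> X \<Longrightarrow> \<bar>- x\<bar> \<le> X" for x :: real by linarith
lemma bound_mult: "\<bar>x\<bar> \<le> X \<Longrightarrow> \<bar>y\<bar> \<le> Y \<Longrightarrow> \<bar>x * y\<bar> \<le> X * Y" for x y :: real
  unfolding abs_mult by (rule mult_mono) auto
lemma bound_power: "\<bar>x\<bar> \<le> X \<Longrightarrow> \<bar>x ^ n\<bar> \<le> X ^ n" for x :: real
  unfolding power_abs by (rule power_mono) auto
lemma bound_numeral: "\<bar>numeral n\<bar> \<le> (numeral n :: real)" by simp
lemma bound_half: "\<bar>1/2\<bar> \<le> (1 :: real)" by simp
lemmas bound_coeff = bound_numeral bound_half bound_power bound_uminus bound_add bound_diff bound_mult

text \<open>Bounds are kept in the shape constant times \<open>n\<close>, so that unification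
  assembles the constant of a whole quadratic form summand by summand.\<close>

lemma qbound_add: "\<bar>x\<bar> \<le> K * n \<Longrightarrow> \<bar>y\<bar> \<le> L * n \<Longrightarrow> \<bar>x + y\<bar> \<le> (K + L) * n" for x y :: real
  by (simp add: algebra_simps)
lemma qbound_sq: "\<bar>c\<bar> \<le> K \<Longrightarrow> u^2 \<le> n \<Longrightarrow> \<bar>c * u^2\<bar> \<le> K * n" for c u :: real
  unfolding abs_mult by (rule mult_mono) auto
lemma qbound_prod:
  fixes c u v :: real
  assumes "\<bar>c\<bar> \<le> K" "u^2 \<le> n" "v^2 \<le> n"
  shows "\<bar>c * u * v\<bar> \<le> K * n"
proof -
  have "\<bar>u * v\<bar> \<le> n"
    using assms(2,3) sum_squares_bound[of "\<bar>u\<bar>" "\<bar>v\<bar>"] by (simp add: abs_mult)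
  then show ?thesis using assms(1) unfolding mult.assoc abs_mult[of c]
    by (intro mult_mono) auto
qed

lemma comm_err_scaled_bound:
  "\<exists>K. \<forall>del r om bt A B B1 H Th D y0 y1 y2 y3 z0 z1 n. \<bar>del\<bar> \<le> 1 \<longrightarrow> \<bar>r\<bar> \<le> 1 \<longrightarrow> \<bar>om\<bar> \<le> 1 \<longrightarrow> \<bar>bt\<bar> \<le> 1 \<longrightarrow>
    \<bar>A\<bar> \<le> M \<longrightarrow> \<bar>B\<bar> \<le> M \<longrightarrow> \<bar>B1\<bar> \<le> M \<longrightarrow> \<bar>H\<bar> \<le> M \<longrightarrow> \<bar>Th\<bar> \<le> M \<longrightarrow> \<bar>D\<bar> \<le> M \<longrightarrow>
    y0^2 \<le> n \<longrightarrow> y1^2 \<le> n \<longrightarrow> y2^2 \<le> n \<longrightarrow> y3^2 \<le> n \<longrightarrow> z0^2 \<le> n \<longrightarrow> z1^2 \<le> n \<longrightarrow>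
    \<bar>comm_err_scaled del r om bt A B B1 H Th D y0 y1 y2 y3 z0 z1\<bar> \<le> K * n"
  unfolding comm_err_scaled_def
  \<comment> \<open>The constant stays schematic and is built by the following rules from the bounds
    on the coefficients; introduced before the variables are fixed, it can depend on
    \<open>M\<close> alone.\<close>
  apply (rule exI)
  apply (intro allI impI)
  apply (rule qbound_add)+
  apply ((rule qbound_sq qbound_prod; (rule bound_coeff | assumption)+)+)
  done

text \<open>The family \<open>conj1\<close> to \<open>conj4\<close> gives the first four
  x-derivatives of e^\<kappa> u, divided by e^\<kappa>. Its coefficients are binomial coefficients
  times the complete Bell polynomials in the derivatives of \<kappa>.\<close>

definition conj1 :: "real \<Rightarrow> real \<Rightarrow> real \<Rightarrow> real" where
  "conj1 a u0 u1 = u1 + a * u0"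
definition conj2 :: "real \<Rightarrow> real \<Rightarrow> real \<Rightarrow> real \<Rightarrow> real \<Rightarrow> real" where
  "conj2 a b u0 u1 u2 = u2 + 2 * a * u1 + (a^2 + b) * u0"
definition conj3 :: "real \<Rightarrow> real \<Rightarrow> real \<Rightarrow> real \<Rightarrow> real \<Rightarrow> real \<Rightarrow> real \<Rightarrow> real" where
  "conj3 a b b1 u0 u1 u2 u3 = u3 + 3 * a * u2 + 3 * (a^2 + b) * u1 + (a^3 + 3 * a * b + b1) * u0"
definition conj4 :: "real \<Rightarrow> real \<Rightarrow> real \<Rightarrow> real \<Rightarrow> real \<Rightarrow> real \<Rightarrow> real \<Rightarrow> real \<Rightarrow> real \<Rightarrow> real" where
  "conj4 a b b1 b2 u0 u1 u2 u3 u4 = u4 + 4 * a * u3 + 6 * (a^2 + b) * u2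
     + 4 * (a^3 + 3 * a * b + b1) * u1 + (a^4 + 6 * a^2 * b + 3 * b^2 + 4 * a * b1 + b2) * u0"

text \<open>What the splitting leaves over. In each summand at least one derivative has fallen on
  \<open>a\<close> or \<open>th\<close>, which is why it is of lower order.\<close>

definition conj_rem :: "real \<Rightarrow> real \<Rightarrow> real \<Rightarrow> real \<Rightarrow> real \<Rightarrow> real \<Rightarrow> real \<Rightarrow> real \<Rightarrow> real \<Rightarrow> real \<Rightarrow> real \<Rightarrow> real" where
  "conj_rem al a b b1 b2 h th d w00 w01 w10 =
     (4 * a * b1 + al * b * h + 3 * b^2 - 2 * a^2 * al * h - al * b * th - b2 - d) * w00
     + (2 * a * al * h + 12 * a * b - 4 * b1) * w01 + al * b * w10"

text \<open>The operator in terms of \<eta> is rewritten by replacing \<partial>x with \<partial>x -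
  \<open>a\<close> and \<partial>t with \<partial>t - \<open>th\<close>. The terms
  \<open>h * a\<close> and \<open>h * b\<close> inside \<open>w11\<close> and \<open>w12\<close> are
  the x-derivatives of \<open>th\<close>.\<close>

lemma conj_decomposition:
  assumes "w10 = n10 + th * n00"
    and "w11 = conj1 a w10 (n11 + th * n01 + h * a * n00)"
    and "w12 = conj2 a b w10 (n11 + th * n01 + h * a * n00) (n12 + th * n02 + 2 * h * a * n01 + h * b * n00)"
    and "w20 = n20 + 2 * th * n10 + (d + th^2) * n00"
    and "w01 = conj1 a n00 n01" "w02 = conj2 a b n00 n01 n02" "w03 = conj3 a b b1 n00 n01 n02 n03"
    and "w04 = conj4 a b b1 b2 n00 n01 n02 n03 n04"
  shows "n20 - al * n12 + n04 = symm_part al a th n00 w02 w04 w11 w20 + anti_part al a b th n00 w01 w02 w03 w10 w12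
     + conj_rem al a b b1 b2 h th d n00 w01 w10"
  unfolding assms symm_part_def anti_part_def conj_rem_def conj1_def conj2_def conj3_def conj4_def
  by (simp add: algebra_simps eval_nat_numeral)

lemma sqbound_add: "x^2 \<le> K * n \<Longrightarrow> y^2 \<le> L * n \<Longrightarrow> (x + y)^2 \<le> (2 * K + 2 * L) * n" for x y :: real
  using sum_squares_bound[of x y] by (simp add: algebra_simps power2_sum)
lemma sqbound_diff: "x^2 \<le> K * n \<Longrightarrow> y^2 \<le> L * n \<Longrightarrow> (x - y)^2 \<le> (2 * K + 2 * L) * n" for x y :: real
  using sqbound_add[of x K n "-y" L] by simp
lemma sqbound_mult: "\<bar>c\<bar> \<le> C \<Longrightarrow> x^2 \<le> K * n \<Longrightarrow> (c * x)^2 \<le> (C^2 * K) * n" for c x :: real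
  unfolding power_mult_distrib mult.assoc by (rule mult_mono) (auto simp: abs_le_square_iff[symmetric])
lemma sqadd: "x \<le> K * n \<Longrightarrow> y \<le> L * n \<Longrightarrow> x + y \<le> (K + L) * n" for x y :: real
  by (simp add: algebra_simps)
lemma sqbound_base: "x^2 \<le> n \<Longrightarrow> x^2 \<le> 1 * n" for x :: real by simp

section \<open>Size and coercivity of the principal commutator\<close>

definition comm_main_scaled :: "real \<Rightarrow> real \<Rightarrow> real \<Rightarrow> real \<Rightarrow> real \<Rightarrow> real \<Rightarrow> real \<Rightarrow> real \<Rightarrow> real \<Rightarrow> real" where
  "comm_main_scaled bt A B y0 y1 y2 y3 z0 z1 =
    8 * B * ((y3 + 2 * A^2 * y1)^2 + A^2 * y2^2 + 5 * A^4 * y1^2 + A^6 * y0^2)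
    + B * (bt^2 * z1^2 + 3 * bt^2 * A^2 * z0^2 + 32 * bt * A^3 * y1 * z0)"

lemma comm_main_scaling:
  "comm_main al (rho * A) (del * r * rho^2 * B) y0 (rho * y1) (rho^2 * y2) (rho^3 * y3) (om * rho^2 * z0) (om * rho^3 * z1)
   = rho^8 * (del * r) * comm_main_scaled (al * om) A B y0 y1 y2 y3 z0 z1"
  unfolding comm_main_def comm_main_scaled_def
  by (simp add: algebra_simps eval_nat_numeral)

lemma comm_main_scaled_bound:
  "\<exists>K. \<forall>bt A B y0 y1 y2 y3 z0 z1 n. \<bar>bt\<bar> \<le> 1 \<longrightarrow> \<bar>A\<bar> \<le> M \<longrightarrow> \<bar>B\<bar> \<le> M \<longrightarrow>
    y0^2 \<le> n \<longrightarrow> y1^2 \<le> n \<longrightarrow> y2^2 \<le> n \<longrightarrow> y3^2 \<le> n \<longrightarrow> z0^2 \<le> n \<longrightarrow> z1^2 \<le> n \<longrightarrow>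
    \<bar>comm_main_scaled bt A B y0 y1 y2 y3 z0 z1\<bar> \<le> K * n"
proof -
  \<comment> \<open>With the square expanded, every summand is a coefficient times two unknowns, the
    form that \<open>qbound_sq\<close> and \<open>qbound_prod\<close> accept.\<close>
  have eq: "comm_main_scaled bt A B y0 y1 y2 y3 z0 z1 =
     (8 * B) * y3^2 + (32 * B * A^2) * y3 * y1 + (72 * B * A^4) * y1^2 + (8 * B * A^2) * y2^2 + (8 * B * A^6) * y0^2
     + (B * bt^2) * z1^2 + (3 * B * bt^2 * A^2) * z0^2 + (32 * B * bt * A^3) * y1 * z0" for bt A B y0 y1 y2 y3 z0 z1
    unfolding comm_main_scaled_def by (simp add: algebra_simps eval_nat_numeral)
  show ?thesis
    unfolding eq
    apply (rule exI)
    apply (intro allI impI)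
    apply (rule qbound_add)+
    apply ((rule qbound_sq qbound_prod; (rule bound_coeff | assumption)+)+)
    done
qed

text \<open>Completing squares. Absorbing the product of \<open>y1\<close> and \<open>z0\<close>
  takes \<open>32 * (A * bt * z0)^2\<close>, of which 3 are already present, hence 29. One factor
  \<open>g\<close> comes from \<open>B\<close> and three from \<open>A^6\<close>; \<open>M^3\<close>
  bounds \<open>B * A^2\<close>.\<close>

lemma comm_main_scaled_lower:
  fixes A B bt :: real
  assumes "g \<le> A^2" "g \<le> B" "0 < g" "g \<le> 1" "\<bar>A\<bar> \<le> M" "\<bar>B\<bar> \<le> M"
  shows "g^4 * (y0^2 + y1^2 + y2^2 + y3^2 + bt^2 * z1^2) \<le> comm_main_scaled bt A B y0 y1 y2 y3 z0 z1 + 29 * M^3 * (bt^2 * z0^2)"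
proof -
  have A4: "g^2 \<le> A^4" using power_mono[OF assms(1), of 2] assms(3) by simp
  have A6: "g^3 \<le> A^6" using power_mono[OF assms(1), of 3] assms(3) by simp
  have B0: "0 \<le> B" using assms by linarith
  have g1: "g^3 \<le> g" "g^3 \<le> g^2" "g^3 \<le> 1" using assms(3,4) power_decreasing[of 1 3 g] power_decreasing[of 2 3 g] power_decreasing[of 0 3 g] by auto
  define m where "m = comm_main_scaled bt A B y0 y1 y2 y3 z0 z1"
  have "B * (2 * y3^2 + 16 * (A^4 * y1^2) + 8 * (A^2 * y2^2) + 8 * (A^6 * y0^2) + bt^2 * z1^2 - 29 * (A^2 * (bt^2 * z0^2)))
     \<le> B * (8 * ((y3 + 2 * A^2 * y1)^2 + A^2 * y2^2 + 5 * A^4 * y1^2 + A^6 * y0^2)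
        + (bt^2 * z1^2 + 3 * bt^2 * A^2 * z0^2 + 32 * bt * A^3 * y1 * z0))"
  proof (rule mult_left_mono[OF _ B0])
    have "8 * ((y3 + 2 * A^2 * y1)^2 + A^2 * y2^2 + 5 * A^4 * y1^2 + A^6 * y0^2)
        + (bt^2 * z1^2 + 3 * bt^2 * A^2 * z0^2 + 32 * bt * A^3 * y1 * z0)
      - (2 * y3^2 + 16 * (A^4 * y1^2) + 8 * (A^2 * y2^2) + 8 * (A^6 * y0^2) + bt^2 * z1^2 - 29 * (A^2 * (bt^2 * z0^2)))
      = 8 * (A^2 * y1 + 2 * (A * bt * z0))^2 + 2 * (y3 + 4 * A^2 * y1)^2 + 4 * (y3 + 2 * A^2 * y1)^2"
      by (simp add: algebra_simps eval_nat_numeral)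
    also have "\<dots> \<ge> 0" by simp
    finally show "2 * y3^2 + 16 * (A^4 * y1^2) + 8 * (A^2 * y2^2) + 8 * (A^6 * y0^2) + bt^2 * z1^2 - 29 * (A^2 * (bt^2 * z0^2))
      \<le> 8 * ((y3 + 2 * A^2 * y1)^2 + A^2 * y2^2 + 5 * A^4 * y1^2 + A^6 * y0^2)
        + (bt^2 * z1^2 + 3 * bt^2 * A^2 * z0^2 + 32 * bt * A^3 * y1 * z0)" by simp
  qed
  also have "\<dots> = m" unfolding m_def comm_main_scaled_def by (simp add: algebra_simps)
  finally have 1: "B * (2 * y3^2 + 16 * (A^4 * y1^2) + 8 * (A^2 * y2^2) + 8 * (A^6 * y0^2) + bt^2 * z1^2)
     \<le> m + 29 * (B * A^2 * (bt^2 * z0^2))" by (simp add: algebra_simps)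
  have nn: "0 \<le> A^2" "0 \<le> A^4" "0 \<le> A^6" by simp_all
  have c: "g^3 \<le> 2" "g^3 \<le> 16 * A^4" "g^3 \<le> 8 * A^2" "g^3 \<le> 8 * A^6"
    using g1 A4 A6 assms(1) nn by linarith+
  have 2: "g^3 * y3^2 \<le> 2 * y3^2" using mult_right_mono[OF c(1), of "y3^2"] by simp
  have 3: "g^3 * y1^2 \<le> 16 * (A^4 * y1^2)" using mult_right_mono[OF c(2), of "y1^2"] by simp
  have 4: "g^3 * y2^2 \<le> 8 * (A^2 * y2^2)" using mult_right_mono[OF c(3), of "y2^2"] by simp
  have 5: "g^3 * y0^2 \<le> 8 * (A^6 * y0^2)" using mult_right_mono[OF c(4), of "y0^2"] by simp
  have 6: "g^3 * (bt^2 * z1^2) \<le> bt^2 * z1^2" using g1 mult_right_mono[of "g^3" 1 "bt^2 * z1^2"] by simp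
  have "g^4 * (y0^2 + y1^2 + y2^2 + y3^2 + bt^2 * z1^2) = g * (g^3 * y0^2 + g^3 * y1^2 + g^3 * y2^2 + g^3 * y3^2 + g^3 * (bt^2 * z1^2))"
    by (simp add: algebra_simps eval_nat_numeral)
  also have "\<dots> \<le> B * (2 * y3^2 + 16 * (A^4 * y1^2) + 8 * (A^2 * y2^2) + 8 * (A^6 * y0^2) + bt^2 * z1^2)"
    using 2 3 4 5 6 assms(2,3) by (intro mult_mono) (auto intro!: add_nonneg_nonneg mult_nonneg_nonneg)
  also note 1
  also have "B * A^2 * (bt^2 * z0^2) \<le> M^3 * (bt^2 * z0^2)"
  proof (rule mult_right_mono)
    have "A^2 \<le> M^2" using assms(5) by (metis abs_ge_zero order_trans power2_abs power_mono)
    then have "B * A^2 \<le> M * M^2" using assms(6) B0 by (intro mult_mono) auto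
    then show "B * A^2 \<le> M^3" by (simp add: eval_nat_numeral)
  qed simp
  finally show ?thesis unfolding m_def by simp
qed

definition conj_rem_scaled :: "real \<Rightarrow> real \<Rightarrow> real \<Rightarrow> real \<Rightarrow> real \<Rightarrow> real \<Rightarrow> real \<Rightarrow> real \<Rightarrow> real \<Rightarrow> real \<Rightarrow> real \<Rightarrow> real \<Rightarrow> real \<Rightarrow> real \<Rightarrow> real" where
  "conj_rem_scaled del r om bt A B B1 B2 H Th D y0 y1 z0 =
    (4 * A * B1 * del * r + B * H * bt * del^2 * r + 3 * B^2 * del * r - 2 * A^2 * H * bt * del - B * Th * bt * del - B2 * del^2 * r^2 - D * del * om^2) * y0
    + (12 * A * B + 2 * A * H * bt * del - 4 * B1 * del * r) * y1 + (B * bt) * z0"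

text \<open>Squared, the remainder has the prefactor \<open>rho^8 * (del * r)\<close> of the
  principal commutator and a further \<open>del * r\<close>, so it is absorbable like
  \<open>comm_err\<close>.\<close>

lemma conj_rem_scaling:
  "conj_rem al (rho * A) (del * r * rho^2 * B) (del^2 * r^2 * rho^3 * B1) (del^3 * r^3 * rho^4 * B2) (del^2 * r * om * rho^2 * H)
     (del * om * rho^2 * Th) (del^2 * r * om^2 * rho^4 * D) y0 (rho * y1) (om * rho^2 * z0)
   = rho^4 * (del * r) * conj_rem_scaled del r om (al * om) A B B1 B2 H Th D y0 y1 z0"
  unfolding conj_rem_def conj_rem_scaled_def
  by (simp add: algebra_simps eval_nat_numeral)

lemma conj_rem_scaled_bound:
  "\<exists>K. \<forall>del r om bt A B B1 B2 H Th D y0 y1 z0 n. \<bar>del\<bar> \<le> 1 \<longrightarrow> \<bar>r\<bar> \<le> 1 \<longrightarrow> \<bar>om\<bar> \<le> 1 \<longrightarrow> \<bar>bt\<bar> \<le> 1 \<longrightarrow>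
    \<bar>A\<bar> \<le> M \<longrightarrow> \<bar>B\<bar> \<le> M \<longrightarrow> \<bar>B1\<bar> \<le> M \<longrightarrow> \<bar>B2\<bar> \<le> M \<longrightarrow> \<bar>H\<bar> \<le> M \<longrightarrow> \<bar>Th\<bar> \<le> M \<longrightarrow> \<bar>D\<bar> \<le> M \<longrightarrow>
    y0^2 \<le> n \<longrightarrow> y1^2 \<le> n \<longrightarrow> z0^2 \<le> n \<longrightarrow>
    (conj_rem_scaled del r om bt A B B1 B2 H Th D y0 y1 z0)^2 \<le> K * n"
  unfolding conj_rem_scaled_def
  apply (rule exI)
  apply (intro allI impI)
  apply (rule sqbound_add)+
  apply ((rule sqbound_mult, ((rule bound_coeff | assumption)+)[1], rule sqbound_base, assumption)+)
  done

text \<open>The errors are quadratic in the conjugated jets, while the estimate is wanted for the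
  jets of \<eta>; this bound transfers the errors.\<close>

lemma conj_scaled_le:
  fixes M :: real
  shows "\<exists>K. \<forall>del eps A B B1 H Th e0 e1 e2 e3 f0 f1 n. \<bar>del\<bar> \<le> 1 \<longrightarrow> \<bar>eps\<bar> \<le> 1 \<longrightarrow>
    \<bar>A\<bar> \<le> M \<longrightarrow> \<bar>B\<bar> \<le> M \<longrightarrow> \<bar>B1\<bar> \<le> M \<longrightarrow> \<bar>H\<bar> \<le> M \<longrightarrow> \<bar>Th\<bar> \<le> M \<longrightarrow>
    e0^2 \<le> n \<longrightarrow> e1^2 \<le> n \<longrightarrow> e2^2 \<le> n \<longrightarrow> e3^2 \<le> n \<longrightarrow> f0^2 \<le> n \<longrightarrow> f1^2 \<le> n \<longrightarrow>
    e0^2 + (e1 + A * e0)^2 + (e2 + (2 * A) * e1 + (A^2 + eps * B) * e0)^2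
    + (e3 + (3 * A) * e2 + (3 * (A^2 + eps * B)) * e1 + (A^3 + 3 * eps * A * B + eps^2 * B1) * e0)^2
    + (f0 + (del * Th) * e0)^2 + (f1 + (del * Th) * e1 + (eps * del * H * A) * e0 + A * f0 + (A * del * Th) * e0)^2 \<le> K * n"
  apply (rule exI)
  apply (intro allI impI)
  apply (rule sqadd)+
  apply ((((rule sqbound_add)+)?,
     ((rule sqbound_mult, ((rule bound_coeff | assumption)+)[1], rule sqbound_base, assumption) | (rule sqbound_base, assumption))+)+)
  done

text \<open>Inversion of the triangular change of unknowns from the jets of \<open>\<eta>\<close> to those of its conjugate.\<close>

lemma conj_scaled_ge:
  fixes M :: real
  shows "\<exists>K. \<forall>eps A B B1 e0 e1 e2 e3 n. \<bar>eps\<bar> \<le> 1 \<longrightarrow>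
    \<bar>A\<bar> \<le> M \<longrightarrow> \<bar>B\<bar> \<le> M \<longrightarrow> \<bar>B1\<bar> \<le> M \<longrightarrow>
    e0^2 \<le> n \<longrightarrow> (e1 + A * e0)^2 \<le> n \<longrightarrow> (e2 + (2 * A) * e1 + (A^2 + eps * B) * e0)^2 \<le> n \<longrightarrow>
    (e3 + (3 * A) * e2 + (3 * (A^2 + eps * B)) * e1 + (A^3 + 3 * eps * A * B + eps^2 * B1) * e0)^2 \<le> n \<longrightarrow>
    e0^2 + e1^2 + e2^2 + e3^2 \<le> K * n"
proof -
  have "\<exists>K. \<forall>eps A B B1 y0 y1 y2 y3 n. \<bar>eps\<bar> \<le> 1 \<longrightarrow> \<bar>A\<bar> \<le> M \<longrightarrow> \<bar>B\<bar> \<le> M \<longrightarrow> \<bar>B1\<bar> \<le> M \<longrightarrow>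
    y0^2 \<le> n \<longrightarrow> y1^2 \<le> n \<longrightarrow> y2^2 \<le> n \<longrightarrow> y3^2 \<le> n \<longrightarrow>
    y0^2 + (y1 - A * y0)^2 + (y2 - (2 * A) * y1 + (A^2 - eps * B) * y0)^2
     + (y3 - (3 * A) * y2 + (3 * A^2 - 3 * eps * B) * y1 + (3 * eps * A * B - A^3 - eps^2 * B1) * y0)^2 \<le> K * n"
    apply (rule exI)
    apply (intro allI impI)
    apply (rule sqadd)+
    apply ((((rule sqbound_add sqbound_diff)+)?,
     ((rule sqbound_mult, ((rule bound_coeff | assumption)+)[1], rule sqbound_base, assumption) | (rule sqbound_base, assumption))+)+)
    done
  then obtain K where K: "\<And>eps A B B1 y0 y1 y2 y3 n. \<bar>eps\<bar> \<le> 1 \<Longrightarrow> \<bar>A\<bar> \<le> M \<Longrightarrow> \<bar>B\<bar> \<le> M \<Longrightarrow> \<bar>B1\<bar> \<le> M \<Longrightarrow>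
    y0^2 \<le> n \<Longrightarrow> y1^2 \<le> n \<Longrightarrow> y2^2 \<le> n \<Longrightarrow> y3^2 \<le> n \<Longrightarrow>
    y0^2 + (y1 - A * y0)^2 + (y2 - (2 * A) * y1 + (A^2 - eps * B) * y0)^2
     + (y3 - (3 * A) * y2 + (3 * A^2 - 3 * eps * B) * y1 + (3 * eps * A * B - A^3 - eps^2 * B1) * y0)^2 \<le> K * n" by blast
  show ?thesis
  proof (intro exI[of _ K] allI impI)
    fix eps A B B1 e0 e1 e2 e3 n :: real
    let ?y1 = "e1 + A * e0" and ?y2 = "e2 + (2 * A) * e1 + (A^2 + eps * B) * e0"
      and ?y3 = "e3 + (3 * A) * e2 + (3 * (A^2 + eps * B)) * e1 + (A^3 + 3 * eps * A * B + eps^2 * B1) * e0"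
    assume *: "\<bar>eps\<bar> \<le> 1" "\<bar>A\<bar> \<le> M" "\<bar>B\<bar> \<le> M" "\<bar>B1\<bar> \<le> M" "e0^2 \<le> n" "?y1^2 \<le> n" "?y2^2 \<le> n" "?y3^2 \<le> n"
    have "e1 = ?y1 - A * e0" "e2 = ?y2 - (2 * A) * ?y1 + (A^2 - eps * B) * e0"
      "e3 = ?y3 - (3 * A) * ?y2 + (3 * A^2 - 3 * eps * B) * ?y1 + (3 * eps * A * B - A^3 - eps^2 * B1) * e0"
      by (simp_all add: algebra_simps eval_nat_numeral)
    then show "e0^2 + e1^2 + e2^2 + e3^2 \<le> K * n"
      using K[OF *] by metis
  qed
qed

section \<open>Coercivity of the commutator\<close>

text \<open>\<open>chi\<close> is the localiser: where it is at least 1 the error term pays for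
  everything, elsewhere \<open>g\<close> bounds \<open>A^2\<close> and \<open>B\<close> from below.
  \<open>X\<close> is the part of the product that will integrate to zero. The product
  \<open>al * om\<close> is at most 1, so no constant sees the size of \<open>al\<close>.\<close>

definition scaled_carleman :: "real \<Rightarrow> real \<Rightarrow> real \<Rightarrow> real \<Rightarrow> bool" where
  "scaled_carleman M g c K \<longleftrightarrow> (
    \<forall>rho del r al om A B B1 B2 H Th D chi e0 e1 e2 e3 f0 f1 y1 y2 y3 z0 z1 P X w04 w12 w20.
    0 < del \<longrightarrow> del \<le> 1 \<longrightarrow> 0 < r \<longrightarrow> r \<le> 1 \<longrightarrow> 0 \<le> al \<longrightarrow> om = 1 / (1 + al) \<longrightarrow>
    \<bar>A\<bar> \<le> M \<longrightarrow> \<bar>B\<bar> \<le> M \<longrightarrow> \<bar>B1\<bar> \<le> M \<longrightarrow> \<bar>B2\<bar> \<le> M \<longrightarrow> \<bar>H\<bar> \<le> M \<longrightarrow> \<bar>Th\<bar> \<le> M \<longrightarrow> \<bar>D\<bar> \<le> M \<longrightarrow>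
    0 \<le> chi \<longrightarrow> 1 \<le> chi \<or> g \<le> A^2 \<and> g \<le> B \<longrightarrow>
    y1 = e1 + A * e0 \<longrightarrow> y2 = e2 + (2 * A) * e1 + (A^2 + del * r * B) * e0 \<longrightarrow>
    y3 = e3 + (3 * A) * e2 + (3 * (A^2 + del * r * B)) * e1 + (A^3 + 3 * (del * r) * A * B + (del * r)^2 * B1) * e0 \<longrightarrow>
    z0 = f0 + (del * Th) * e0 \<longrightarrow>
    z1 = f1 + (del * Th) * e1 + (del * r * del * H * A) * e0 + A * f0 + (A * del * Th) * e0 \<longrightarrow>
    P = symm_part al (rho * A) (del * om * rho^2 * Th) e0 (rho^2 * y2) w04 (om * rho^3 * z1) w20
      + anti_part al (rho * A) (del * r * rho^2 * B) (del * om * rho^2 * Th) e0 (rho * y1) (rho^2 * y2) (rho^3 * y3) (om * rho^2 * z0) w12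
      + conj_rem al (rho * A) (del * r * rho^2 * B) (del^2 * r^2 * rho^3 * B1) (del^3 * r^3 * rho^4 * B2) (del^2 * r * om * rho^2 * H)
         (del * om * rho^2 * Th) (del^2 * r * om^2 * rho^4 * D) e0 (rho * y1) (om * rho^2 * z0) \<longrightarrow>
    X = symm_part al (rho * A) (del * om * rho^2 * Th) e0 (rho^2 * y2) w04 (om * rho^3 * z1) w20
      * anti_part al (rho * A) (del * r * rho^2 * B) (del * om * rho^2 * Th) e0 (rho * y1) (rho^2 * y2) (rho^3 * y3) (om * rho^2 * z0) w12
      - comm_main al (rho * A) (del * r * rho^2 * B) e0 (rho * y1) (rho^2 * y2) (rho^3 * y3) (om * rho^2 * z0) (om * rho^3 * z1)
      - comm_err al (rho * A) (del * r * rho^2 * B) (del^2 * r^2 * rho^3 * B1) (del^2 * r * om * rho^2 * H)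
          (del * om * rho^2 * Th) (del^2 * r * om^2 * rho^4 * D)
          e0 (rho * y1) (rho^2 * y2) (rho^3 * y3) (om * rho^2 * z0) (om * rho^3 * z1) \<longrightarrow>
    c * (rho^8 * (del * r) * (e0^2 + e1^2 + e2^2 + e3^2 + (al * om)^2 * f1^2))
      \<le> P^2 - X + K * (rho^8 * (del * r) * ((al * om)^2 * f0^2 + (chi + del) * (e0^2 + e1^2 + e2^2 + e3^2 + f0^2 + f1^2))))"

lemma scaled_carleman_exists:
  fixes M g :: real
  assumes g: "0 < g" "g \<le> 1"
  obtains c K where "0 < c" "0 \<le> K" "scaled_carleman M g c K"
proof -
  obtain K1 where K1: "\<And>bt A B y0 y1 y2 y3 z0 z1 n. \<bar>bt\<bar> \<le> 1 \<Longrightarrow> \<bar>A\<bar> \<le> M \<Longrightarrow> \<bar>B\<bar> \<le> M \<Longrightarrow>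
    y0^2 \<le> n \<Longrightarrow> y1^2 \<le> n \<Longrightarrow> y2^2 \<le> n \<Longrightarrow> y3^2 \<le> n \<Longrightarrow> z0^2 \<le> n \<Longrightarrow> z1^2 \<le> n \<Longrightarrow>
    \<bar>comm_main_scaled bt A B y0 y1 y2 y3 z0 z1\<bar> \<le> K1 * n"
    using comm_main_scaled_bound[of M] by blast
  obtain K2 where K2: "\<And>del r om bt A B B1 H Th D y0 y1 y2 y3 z0 z1 n. \<bar>del\<bar> \<le> 1 \<Longrightarrow> \<bar>r\<bar> \<le> 1 \<Longrightarrow> \<bar>om\<bar> \<le> 1 \<Longrightarrow> \<bar>bt\<bar> \<le> 1 \<Longrightarrow>
    \<bar>A\<bar> \<le> M \<Longrightarrow> \<bar>B\<bar> \<le> M \<Longrightarrow> \<bar>B1\<bar> \<le> M \<Longrightarrow> \<bar>H\<bar> \<le> M \<Longrightarrow> \<bar>Th\<bar> \<le> M \<Longrightarrow> \<bar>D\<bar> \<le> M \<Longrightarrow>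
    y0^2 \<le> n \<Longrightarrow> y1^2 \<le> n \<Longrightarrow> y2^2 \<le> n \<Longrightarrow> y3^2 \<le> n \<Longrightarrow> z0^2 \<le> n \<Longrightarrow> z1^2 \<le> n \<Longrightarrow>
    \<bar>comm_err_scaled del r om bt A B B1 H Th D y0 y1 y2 y3 z0 z1\<bar> \<le> K2 * n"
    using comm_err_scaled_bound[of M] by blast
  obtain K3 where K3: "\<And>del r om bt A B B1 B2 H Th D y0 y1 z0 n. \<bar>del\<bar> \<le> 1 \<Longrightarrow> \<bar>r\<bar> \<le> 1 \<Longrightarrow> \<bar>om\<bar> \<le> 1 \<Longrightarrow> \<bar>bt\<bar> \<le> 1 \<Longrightarrow>
    \<bar>A\<bar> \<le> M \<Longrightarrow> \<bar>B\<bar> \<le> M \<Longrightarrow> \<bar>B1\<bar> \<le> M \<Longrightarrow> \<bar>B2\<bar> \<le> M \<Longrightarrow> \<bar>H\<bar> \<le> M \<Longrightarrow> \<bar>Th\<bar> \<le> M \<Longrightarrow> \<bar>D\<bar> \<le> M \<Longrightarrow>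
    y0^2 \<le> n \<Longrightarrow> y1^2 \<le> n \<Longrightarrow> z0^2 \<le> n \<Longrightarrow>
    (conj_rem_scaled del r om bt A B B1 B2 H Th D y0 y1 z0)^2 \<le> K3 * n"
    using conj_rem_scaled_bound[of M] by blast
  obtain K4 where K4: "\<And>del eps A B B1 H Th e0 e1 e2 e3 f0 f1 n. \<bar>del\<bar> \<le> 1 \<Longrightarrow> \<bar>eps\<bar> \<le> 1 \<Longrightarrow>
    \<bar>A\<bar> \<le> M \<Longrightarrow> \<bar>B\<bar> \<le> M \<Longrightarrow> \<bar>B1\<bar> \<le> M \<Longrightarrow> \<bar>H\<bar> \<le> M \<Longrightarrow> \<bar>Th\<bar> \<le> M \<Longrightarrow>
    e0^2 \<le> n \<Longrightarrow> e1^2 \<le> n \<Longrightarrow> e2^2 \<le> n \<Longrightarrow> e3^2 \<le> n \<Longrightarrow> f0^2 \<le> n \<Longrightarrow> f1^2 \<le> n \<Longrightarrow>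
    e0^2 + (e1 + A * e0)^2 + (e2 + (2 * A) * e1 + (A^2 + eps * B) * e0)^2
    + (e3 + (3 * A) * e2 + (3 * (A^2 + eps * B)) * e1 + (A^3 + 3 * eps * A * B + eps^2 * B1) * e0)^2
    + (f0 + (del * Th) * e0)^2 + (f1 + (del * Th) * e1 + (eps * del * H * A) * e0 + A * f0 + (A * del * Th) * e0)^2 \<le> K4 * n"
    using conj_scaled_le[of M] by blast
  obtain K5 where K5: "\<And>eps A B B1 e0 e1 e2 e3 n. \<bar>eps\<bar> \<le> 1 \<Longrightarrow>
    \<bar>A\<bar> \<le> M \<Longrightarrow> \<bar>B\<bar> \<le> M \<Longrightarrow> \<bar>B1\<bar> \<le> M \<Longrightarrow>
    e0^2 \<le> n \<Longrightarrow> (e1 + A * e0)^2 \<le> n \<Longrightarrow> (e2 + (2 * A) * e1 + (A^2 + eps * B) * e0)^2 \<le> n \<Longrightarrow>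
    (e3 + (3 * A) * e2 + (3 * (A^2 + eps * B)) * e1 + (A^3 + 3 * eps * A * B + eps^2 * B1) * e0)^2 \<le> n \<Longrightarrow>
    e0^2 + e1^2 + e2^2 + e3^2 \<le> K5 * n"
    using conj_scaled_ge[of M] by blast
  \<comment> \<open>\<open>C\<close> is the price of recovering \<open>f1\<close> from
    \<open>z1\<close>. \<open>L\<close> covers both cases of the localiser: the 29 stems from the
    coercive one, \<open>K1\<close> and the 1 from the other. \<open>N\<close> collects the errors
    proportional to \<open>chi + del\<close>. \<open>c\<close> loses \<open>K5\<close> for inverting
    the conjugation in x and \<open>C\<close> for inverting it in t.\<close>
  define C where "C = 32 * (1 + \<bar>M\<bar>)^4"
  define L where "L = 29 * \<bar>M\<bar>^3 + \<bar>K1\<bar> + 1"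
  define N where "N = \<bar>K3\<bar> + \<bar>K2\<bar> + L"
  define c where "c = g^4 / ((1 + C) * (\<bar>K5\<bar> + 2))"
  define K where "K = 1 + N * \<bar>K4\<bar> + 2 * L * (1 + M^2)"
  have C0: "1 \<le> C"
  proof -
    have "1 \<le> (1 + \<bar>M\<bar>)^4" by (rule one_le_power) simp
    then show ?thesis unfolding C_def by linarith
  qed
  have L0: "0 \<le> L" "0 \<le> N" unfolding L_def N_def by auto
  have g4: "0 < g^4" "g^4 \<le> 1" using g by (auto simp: power_le_one)
  have c0: "0 < c" unfolding c_def using C0 g4 by (intro divide_pos_pos mult_pos_pos) auto
  have cK: "c * (1 + C) * \<bar>K5\<bar> \<le> g^4" "c * 2 \<le> g^4" "c * C \<le> 1"
  proof -
    have e: "c * ((1 + C) * (\<bar>K5\<bar> + 2)) = g^4" unfolding c_def using C0 by simp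
    have "c * (1 + C) * \<bar>K5\<bar> \<le> c * ((1 + C) * (\<bar>K5\<bar> + 2))" using c0 C0 by (simp add: algebra_simps)
    then show "c * (1 + C) * \<bar>K5\<bar> \<le> g^4" using e by simp
    have "c * 2 \<le> c * ((1 + C) * (\<bar>K5\<bar> + 2))"
      using c0 C0 mult_mono[of 1 "1 + C" 2 "\<bar>K5\<bar> + 2"] by (intro mult_left_mono) auto
    then show "c * 2 \<le> g^4" using e by simp
    have "c * C \<le> c * ((1 + C) * (\<bar>K5\<bar> + 2))"
      using c0 C0 mult_mono[of C "1 + C" 1 "\<bar>K5\<bar> + 2"] by (intro mult_left_mono) auto
    then show "c * C \<le> 1" using e g4 by simp
  qed
  have K0: "0 \<le> K" unfolding K_def using L0 by (auto intro!: add_nonneg_nonneg mult_nonneg_nonneg)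
  show ?thesis
  proof (rule that[OF c0 K0], unfold scaled_carleman_def, intro allI impI)
    fix rho del r al om A B B1 B2 H Th D chi e0 e1 e2 e3 f0 f1 y1 y2 y3 z0 z1 P X w04 w12 w20 :: real
    assume del: "0 < del" "del \<le> 1" and r: "0 < r" "r \<le> 1" and al: "0 \<le> al" and om: "om = 1 / (1 + al)"
      and M: "\<bar>A\<bar> \<le> M" "\<bar>B\<bar> \<le> M" "\<bar>B1\<bar> \<le> M" "\<bar>B2\<bar> \<le> M" "\<bar>H\<bar> \<le> M" "\<bar>Th\<bar> \<le> M" "\<bar>D\<bar> \<le> M"
      and chi: "0 \<le> chi" "1 \<le> chi \<or> g \<le> A^2 \<and> g \<le> B"
      and y1: "y1 = e1 + A * e0" and y2: "y2 = e2 + (2 * A) * e1 + (A^2 + del * r * B) * e0"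
      and y3: "y3 = e3 + (3 * A) * e2 + (3 * (A^2 + del * r * B)) * e1 + (A^3 + 3 * (del * r) * A * B + (del * r)^2 * B1) * e0"
      and z0: "z0 = f0 + (del * Th) * e0"
      and z1: "z1 = f1 + (del * Th) * e1 + (del * r * del * H * A) * e0 + A * f0 + (A * del * Th) * e0"
    define S where "S = symm_part al (rho * A) (del * om * rho^2 * Th) e0 (rho^2 * y2) w04 (om * rho^3 * z1) w20"
    define T where "T = anti_part al (rho * A) (del * r * rho^2 * B) (del * om * rho^2 * Th) e0 (rho * y1) (rho^2 * y2) (rho^3 * y3) (om * rho^2 * z0) w12"
    define R where "R = conj_rem_scaled del r om (al * om) A B B1 B2 H Th D e0 y1 z0"
    define E where "E = comm_err_scaled del r om (al * om) A B B1 H Th D e0 y1 y2 y3 z0 z1"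
    define m where "m = comm_main_scaled (al * om) A B e0 y1 y2 y3 z0 z1"
    define bt where "bt = al * om"
    define q where "q = rho^8 * (del * r)"
    define ne where "ne = e0^2 + e1^2 + e2^2 + e3^2 + f0^2 + f1^2"
    define Se where "Se = e0^2 + e1^2 + e2^2 + e3^2"
    define Sy where "Sy = e0^2 + y1^2 + y2^2 + y3^2"
    define ny where "ny = Sy + z0^2 + z1^2"
    assume P: "P = symm_part al (rho * A) (del * om * rho^2 * Th) e0 (rho^2 * y2) w04 (om * rho^3 * z1) w20
      + anti_part al (rho * A) (del * r * rho^2 * B) (del * om * rho^2 * Th) e0 (rho * y1) (rho^2 * y2) (rho^3 * y3) (om * rho^2 * z0) w12
      + conj_rem al (rho * A) (del * r * rho^2 * B) (del^2 * r^2 * rho^3 * B1) (del^3 * r^3 * rho^4 * B2) (del^2 * r * om * rho^2 * H)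
         (del * om * rho^2 * Th) (del^2 * r * om^2 * rho^4 * D) e0 (rho * y1) (om * rho^2 * z0)"
    assume X: "X = symm_part al (rho * A) (del * om * rho^2 * Th) e0 (rho^2 * y2) w04 (om * rho^3 * z1) w20
      * anti_part al (rho * A) (del * r * rho^2 * B) (del * om * rho^2 * Th) e0 (rho * y1) (rho^2 * y2) (rho^3 * y3) (om * rho^2 * z0) w12
      - comm_main al (rho * A) (del * r * rho^2 * B) e0 (rho * y1) (rho^2 * y2) (rho^3 * y3) (om * rho^2 * z0) (om * rho^3 * z1)
      - comm_err al (rho * A) (del * r * rho^2 * B) (del^2 * r^2 * rho^3 * B1) (del^2 * r * om * rho^2 * H)
          (del * om * rho^2 * Th) (del^2 * r * om^2 * rho^4 * D)
          e0 (rho * y1) (rho^2 * y2) (rho^3 * y3) (om * rho^2 * z0) (om * rho^3 * z1)"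
    have P': "P = S + T + rho^4 * (del * r) * R"
      unfolding P conj_rem_scaling S_def T_def R_def by simp
    have X': "X = S * T - q * m - q * del * E"
      unfolding X comm_main_scaling comm_err_scaling S_def T_def m_def E_def q_def
      by (simp add: algebra_simps power2_eq_square)
    have bt: "0 \<le> bt" "bt \<le> 1" "bt^2 \<le> 1" and om1: "\<bar>om\<bar> \<le> 1"
      using al unfolding bt_def om by (auto simp: field_simps power_le_one)
    have d1: "\<bar>del\<bar> \<le> 1" and r1: "\<bar>r\<bar> \<le> 1" using del r by auto
    have abt: "\<bar>al * om\<bar> \<le> 1" using bt unfolding bt_def by simp
    have dr: "0 < del * r" "del * r \<le> 1" "del * r \<le> del" using del r by (auto simp: mult_le_one mult_left_le)
    have dr1: "\<bar>del * r\<bar> \<le> 1" using dr by simp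
    have q0: "0 \<le> q" unfolding q_def using dr by simp
    have Sy0: "0 \<le> Sy" "0 \<le> Se" "0 \<le> ne" unfolding Sy_def Se_def ne_def by (auto intro!: add_nonneg_nonneg)
    have ny_ge: "e0^2 \<le> ny" "y1^2 \<le> ny" "y2^2 \<le> ny" "y3^2 \<le> ny" "z0^2 \<le> ny" "z1^2 \<le> ny" "Sy \<le> ny"
      unfolding ny_def Sy_def by (auto intro!: add_nonneg_nonneg)
    have ny0: "0 \<le> ny" using ny_ge(1) zero_le_power2 order_trans by blast
    have ne_ge: "e0^2 \<le> ne" "e1^2 \<le> ne" "e2^2 \<le> ne" "e3^2 \<le> ne" "f0^2 \<le> ne" "f1^2 \<le> ne"
      unfolding ne_def by (auto intro!: add_nonneg_nonneg)
    have nyne: "ny \<le> \<bar>K4\<bar> * ne"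
    proof -
      have "ny \<le> K4 * ne"
        using K4[OF d1 dr1 M(1,2,3,5,6) ne_ge]
        unfolding ny_def Sy_def y1 y2 y3 z0 z1 by (simp only: add.assoc mult.assoc)
      also have "\<dots> \<le> \<bar>K4\<bar> * ne" using Sy0 by (intro mult_right_mono) auto
      finally show ?thesis .
    qed
    have i: "g^4 * (Sy + bt^2 * z1^2) \<le> m + L * (bt^2 * z0^2 + chi * ny)"
    proof (cases "1 \<le> chi")
      case True
      have "Sy + bt^2 * z1^2 \<le> ny" unfolding ny_def using mult_right_mono[OF bt(3), of "z1^2"] zero_le_power2[of z0] zero_le_power2[of z1] by linarith
      then have "g^4 * (Sy + bt^2 * z1^2) \<le> 1 * ny"
        using g4 Sy0 by (intro mult_mono) auto
      moreover have "- m \<le> \<bar>K1\<bar> * ny"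
        using K1[OF abt M(1,2) ny_ge(1-6)] mult_right_mono[of K1 "\<bar>K1\<bar>" ny] ny0 unfolding m_def by linarith
      moreover have "(\<bar>K1\<bar> + 1) * (1 * ny) \<le> L * (chi * ny)"
        using True ny0 unfolding L_def by (intro mult_mono) auto
      moreover have "0 \<le> L * (bt^2 * z0^2)" using L0 by simp
      ultimately show ?thesis by (simp add: algebra_simps)
    next
      case False
      then have "g^4 * (Sy + bt^2 * z1^2) \<le> m + 29 * M^3 * (bt^2 * z0^2)"
        using comm_main_scaled_lower[of g A B M e0 y1 y2 y3 bt z1 z0] chi g M
        unfolding m_def bt_def Sy_def by (auto simp: algebra_simps)
      moreover have "29 * M^3 * (bt^2 * z0^2) \<le> L * (bt^2 * z0^2)"
        using M(1) by (intro mult_right_mono) (auto simp: L_def)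
      moreover have "0 \<le> L * (chi * ny)" using L0 chi ny0 by simp
      ultimately show ?thesis by (simp add: algebra_simps)
    qed
    have ii: "- (del * E) \<le> \<bar>K2\<bar> * (del * ny)"
    proof -
      have "\<bar>E\<bar> \<le> K2 * ny" unfolding E_def
        using K2[OF d1 r1 om1 abt M(1,2,3,5,6,7) ny_ge(1-6)] .
      also have "\<dots> \<le> \<bar>K2\<bar> * ny" using ny0 by (intro mult_right_mono) auto
      finally have "del * - E \<le> del * (\<bar>K2\<bar> * ny)" using del by (intro mult_left_mono) auto
      then show ?thesis by (simp add: algebra_simps)
    qed
    have iii: "(rho^4 * (del * r) * R)^2 \<le> q * (\<bar>K3\<bar> * (del * ny))"
    proof -
      have "R^2 \<le> K3 * ny" unfolding R_def
        using K3[OF d1 r1 om1 abt M(1-7) ny_ge(1,2,5)] .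
      also have "\<dots> \<le> \<bar>K3\<bar> * ny" using ny0 by (intro mult_right_mono) auto
      finally have "(del * r) * R^2 \<le> del * (\<bar>K3\<bar> * ny)" using del dr by (intro mult_mono) auto
      then have "q * ((del * r) * R^2) \<le> q * (del * (\<bar>K3\<bar> * ny))" using q0 by (intro mult_left_mono)
      moreover have "(rho^4 * (del * r) * R)^2 = q * ((del * r) * R^2)"
        unfolding q_def by (simp add: algebra_simps eval_nat_numeral)
      moreover have "q * (del * (\<bar>K3\<bar> * ny)) = q * (\<bar>K3\<bar> * (del * ny))" by simp
      ultimately show ?thesis by metis
    qed
    \<comment> \<open>Only the product of the two parts is exploited and their squares are
      discarded. The remainder, here \<open>U\<close>, costs one extra square.\<close>
    have iv: "S * T \<le> P^2 + (rho^4 * (del * r) * R)^2"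
    proof -
      have "S * T \<le> (S + T + U)^2 + U^2" for U
      proof -
        have "(S + T + U)^2 + U^2 - S * T = (S + T + 2 * U)^2 / 2 + (S^2 + T^2) / 2"
          by (simp add: field_simps power2_eq_square)
        also have "\<dots> \<ge> 0" by simp
        finally show ?thesis by simp
      qed
      then show ?thesis unfolding P' .
    qed
    have "q * (g^4 * (Sy + bt^2 * z1^2)) \<le> q * (m + L * (bt^2 * z0^2 + chi * ny))"
      using i q0 by (intro mult_left_mono)
    also have "\<dots> = S * T - X - q * del * E + q * (L * (bt^2 * z0^2 + chi * ny))"
      unfolding X' by (simp add: algebra_simps)
    also have "\<dots> \<le> P^2 + q * (\<bar>K3\<bar> * (del * ny)) - X + q * (\<bar>K2\<bar> * (del * ny)) + q * (L * (bt^2 * z0^2 + chi * ny))"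
      using iii iv mult_left_mono[OF ii q0] by (simp add: algebra_simps)
    also have "\<dots> \<le> P^2 - X + q * (L * (bt^2 * z0^2) + N * ((chi + del) * ny))"
    proof -
      have "0 \<le> q * (\<bar>K3\<bar> * (chi * ny))" "0 \<le> q * (\<bar>K2\<bar> * (chi * ny))" "0 \<le> q * (L * (del * ny))"
        using q0 chi ny0 L0 del by auto
      then show ?thesis unfolding N_def by (simp add: algebra_simps)
    qed
    finally have v: "q * (g^4 * (Sy + bt^2 * z1^2)) \<le> P^2 - X + q * (L * (bt^2 * z0^2) + N * ((chi + del) * ny))" .
    \<comment> \<open>Passing from \<open>z0\<close> to \<open>f0\<close> costs \<open>e0\<close>
      with a factor \<open>del\<close>. Thus \<open>al^2\<close> times the square of the time
      derivative is the only error with neither \<open>chi\<close> nor \<open>del\<close> in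
      front.\<close>
    have vi: "bt^2 * z0^2 \<le> 2 * (bt^2 * f0^2) + 2 * M^2 * (del * ne)"
    proof -
      have "z0^2 \<le> 2 * f0^2 + 2 * (del * Th * e0)^2" using sum_squares_bound[of f0 "del * Th * e0"]
        unfolding z0 by (simp add: power2_sum algebra_simps)
      then have "bt^2 * z0^2 \<le> bt^2 * (2 * f0^2 + 2 * (del * Th * e0)^2)" by (intro mult_left_mono) auto
      moreover have "bt^2 * (del * Th * e0)^2 \<le> 1 * (M^2 * (del * ne))"
      proof (rule mult_mono[OF bt(3)])
        have "Th^2 * (del^2 * e0^2) \<le> M^2 * (del * ne)"
        proof (rule mult_mono)
          show "Th^2 \<le> M^2" using M(6) abs_le_square_iff[of Th M] by auto
          show "del^2 * e0^2 \<le> del * ne" using del ne_ge(1)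
            by (intro mult_mono) (auto simp: power2_eq_square mult_left_le)
        qed auto
        then show "(del * Th * e0)^2 \<le> M^2 * (del * ne)" by (simp add: power_mult_distrib algebra_simps)
      qed auto
      ultimately show ?thesis by (simp add: algebra_simps)
    qed
    have vii: "Se \<le> \<bar>K5\<bar> * Sy"
    proof -
      have Sy_ge: "e0^2 \<le> Sy" "(e1 + A * e0)^2 \<le> Sy" "(e2 + (2 * A) * e1 + (A^2 + del * r * B) * e0)^2 \<le> Sy"
        "(e3 + (3 * A) * e2 + (3 * (A^2 + del * r * B)) * e1 + (A^3 + 3 * (del * r) * A * B + (del * r)^2 * B1) * e0)^2 \<le> Sy"
        unfolding Sy_def y1[symmetric] y2[symmetric] y3[symmetric] by simp_all
      have "Se \<le> K5 * Sy" unfolding Se_def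
        using K5[OF dr1 M(1,2,3) Sy_ge] .
      also have "\<dots> \<le> \<bar>K5\<bar> * Sy" using Sy0 by (intro mult_right_mono) auto
      finally show ?thesis .
    qed
    have viii: "bt^2 * f1^2 \<le> 2 * (bt^2 * z1^2) + C * Se + C * (bt^2 * f0^2)"
    proof -
      define a1 a2 a3 a4 where a: "a1 = del * Th * e1" "a2 = del * r * del * H * A * e0" "a3 = A * f0" "a4 = A * del * Th * e0"
      have f1: "f1 = z1 - (a1 + a2 + a3 + a4)" unfolding z1 a by simp
      have four: "f1^2 \<le> 2 * z1^2 + 8 * a1^2 + 8 * a2^2 + 8 * a3^2 + 8 * a4^2"
      proof -
        have "2 * z1^2 + 8 * a1^2 + 8 * a2^2 + 8 * a3^2 + 8 * a4^2 - f1^2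
          = (z1 + (a1 + a2 + a3 + a4))^2 + 2 * ((a1 - a2)^2 + (a1 - a3)^2 + (a1 - a4)^2 + (a2 - a3)^2 + (a2 - a4)^2 + (a3 - a4)^2)"
          unfolding f1 by (simp add: algebra_simps power2_eq_square)
        also have "\<dots> \<ge> 0" by simp
        finally show ?thesis by simp
      qed
      let ?M = "1 + \<bar>M\<bar>"
      have M1: "\<bar>A\<bar> \<le> ?M" "\<bar>H\<bar> \<le> ?M" "\<bar>Th\<bar> \<le> ?M" "1 \<le> ?M" using M by auto
      have MM: "?M^2 \<le> ?M^4" "1 \<le> ?M^2" by (rule power_increasing) auto
      have "\<bar>del * Th\<bar> \<le> 1 * ?M" using del M1 by (intro bound_mult) auto
      then have b1: "a1^2 \<le> ?M^4 * e1^2" unfolding a power_mult_distrib[of "del * Th"]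
        using MM power_mono[of "\<bar>del * Th\<bar>" ?M 2] by (intro mult_right_mono) auto
      have "\<bar>(del * r * del) * (H * A)\<bar> \<le> 1 * (?M * ?M)"
        using del r dr M1 by (intro bound_mult) (auto simp: mult_le_one)
      then have b2: "a2^2 \<le> ?M^4 * e0^2" unfolding a power_mult_distrib[of "del * r * del * H * A"]
        using power_mono[of "\<bar>(del * r * del) * (H * A)\<bar>" "?M * ?M" 2]
        by (intro mult_right_mono) (auto simp: power2_eq_square eval_nat_numeral mult.assoc)
      have b3: "a3^2 \<le> ?M^4 * f0^2" unfolding a power_mult_distrib
        using MM power_mono[of "\<bar>A\<bar>" ?M 2] M1 by (intro mult_right_mono) auto
      have "\<bar>A * (del * Th)\<bar> \<le> ?M * (1 * ?M)" using del M1 by (intro bound_mult) auto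
      then have b4: "a4^2 \<le> ?M^4 * e0^2" unfolding a power_mult_distrib[of "A * del * Th"]
        using power_mono[of "\<bar>A * (del * Th)\<bar>" "?M * ?M" 2]
        by (intro mult_right_mono) (auto simp: power2_eq_square eval_nat_numeral mult.assoc)
      have S2: "8 * a1^2 + 8 * a2^2 + 8 * a4^2 \<le> C * Se"
      proof -
        have "0 \<le> ?M^4 * e1^2" by simp
        then have "8 * a1^2 + 8 * a2^2 + 8 * a4^2 \<le> 16 * (?M^4 * e0^2) + 16 * (?M^4 * e1^2)"
          using b1 b2 b4 by linarith
        also have "\<dots> = 16 * ?M^4 * (e0^2 + e1^2)" by (simp only: distrib_left mult.assoc)
        also have "\<dots> \<le> C * Se" unfolding C_def Se_def by (intro mult_mono) auto
        finally show ?thesis .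
      qed
      have S3: "8 * a3^2 \<le> C * f0^2"
      proof -
        have "0 \<le> ?M^4 * f0^2" by simp
        then have "8 * a3^2 \<le> 32 * (?M^4 * f0^2)" using b3 by linarith
        then show ?thesis unfolding C_def by (simp only: mult.assoc)
      qed
      have "bt^2 * f1^2 \<le> bt^2 * (2 * z1^2 + C * f0^2 + C * Se)"
        using four S2 S3 by (intro mult_left_mono) auto
      also have "\<dots> \<le> 2 * (bt^2 * z1^2) + C * (bt^2 * f0^2) + 1 * (C * Se)"
        using mult_right_mono[OF bt(3), of "C * Se"] C0 Sy0 by (simp add: algebra_simps)
      finally show ?thesis by simp
    qed
    have ix: "c * (Se + bt^2 * f1^2) \<le> g^4 * (Sy + bt^2 * z1^2) + bt^2 * f0^2"
    proof -
      have "c * (Se + bt^2 * f1^2) \<le> c * ((1 + C) * (\<bar>K5\<bar> * Sy) + 2 * (bt^2 * z1^2) + C * (bt^2 * f0^2))"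
        using viii mult_left_mono[OF vii, of "1 + C"] C0 c0 by (intro mult_left_mono) (auto simp: algebra_simps)
      also have "\<dots> = (c * (1 + C) * \<bar>K5\<bar>) * Sy + (c * 2) * (bt^2 * z1^2) + (c * C) * (bt^2 * f0^2)"
        by (simp add: algebra_simps)
      also have "\<dots> \<le> g^4 * Sy + g^4 * (bt^2 * z1^2) + 1 * (bt^2 * f0^2)"
        using cK Sy0 by (intro add_mono mult_right_mono) auto
      finally show ?thesis by (simp add: algebra_simps)
    qed
    have x: "bt^2 * f0^2 + (L * (bt^2 * z0^2) + N * ((chi + del) * ny)) \<le> K * (bt^2 * f0^2 + (chi + del) * ne)"
    proof -
      have "N * ((chi + del) * ny) \<le> N * ((chi + del) * (\<bar>K4\<bar> * ne))"
        using nyne L0 chi del by (intro mult_left_mono) auto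
      moreover have "L * (bt^2 * z0^2) \<le> L * (2 * (bt^2 * f0^2) + 2 * M^2 * ((chi + del) * ne))"
      proof -
        have "2 * M^2 * (del * ne) \<le> 2 * M^2 * ((chi + del) * ne)" using chi Sy0 by (intro mult_left_mono mult_right_mono) auto
        then show ?thesis using vi L0 by (intro mult_left_mono) linarith+
      qed
      moreover have "0 \<le> N * \<bar>K4\<bar> * (bt^2 * f0^2)" "0 \<le> 2 * L * M^2 * (bt^2 * f0^2)"
        "0 \<le> (1 + 2 * L) * ((chi + del) * ne)" using L0 chi del Sy0 by auto
      ultimately show ?thesis unfolding K_def by (simp add: algebra_simps)
    qed
    have "c * (q * (Se + bt^2 * f1^2)) = q * (c * (Se + bt^2 * f1^2))" by simp
    also have "\<dots> \<le> q * (g^4 * (Sy + bt^2 * z1^2) + bt^2 * f0^2)" using ix q0 by (intro mult_left_mono)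
    also have "\<dots> \<le> P^2 - X + q * (bt^2 * f0^2 + (L * (bt^2 * z0^2) + N * ((chi + del) * ny)))"
      using v by (simp add: algebra_simps)
    also have "\<dots> \<le> P^2 - X + q * (K * (bt^2 * f0^2 + (chi + del) * ne))"
      using x q0 by (intro add_left_mono mult_left_mono)
    finally show "c * (rho^8 * (del * r) * (e0^2 + e1^2 + e2^2 + e3^2 + (al * om)^2 * f1^2))
      \<le> P^2 - X + K * (rho^8 * (del * r) * ((al * om)^2 * f0^2 + (chi + del) * (e0^2 + e1^2 + e2^2 + e3^2 + f0^2 + f1^2)))"
      unfolding q_def ne_def Se_def bt_def by (simp add: algebra_simps)
  qed
qed

text \<open>In the application \<open>rho\<close> is s \<mu> \<xi> and \<open>eps\<close> is 1 / (s
  \<xi>). From the second x-derivative on, each derivative of the exponent costs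
  \<open>eps * rho\<close>, that is \<mu>; each time derivative brings a factor
  \<open>1 / (1 + al)\<close>, and all time quantities carry \<open>del\<close>.\<close>

definition admissible :: "real \<Rightarrow> real \<Rightarrow> real \<Rightarrow> real \<Rightarrow> real \<Rightarrow> real \<Rightarrow> real \<Rightarrow> real \<Rightarrow> real \<Rightarrow> real \<Rightarrow> real \<Rightarrow> real \<Rightarrow> bool" where
  "admissible M rho eps del al a b b1 b2 h th d \<longleftrightarrow>
     0 < rho \<and> 0 < eps \<and> eps \<le> del \<and> del \<le> 1 \<and> 0 \<le> al \<and>
     \<bar>a\<bar> \<le> M * rho \<and> \<bar>b\<bar> \<le> M * (eps * rho^2) \<and> \<bar>b1\<bar> \<le> M * (eps^2 * rho^3) \<and> \<bar>b2\<bar> \<le> M * (eps^3 * rho^4) \<and>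
     \<bar>h\<bar> \<le> M * (eps * del * rho^2 / (1 + al)) \<and> \<bar>th\<bar> \<le> M * (del * rho^2 / (1 + al)) \<and>
     \<bar>d\<bar> \<le> M * (eps * del * rho^4 / (1 + al)^2)"

definition xenergy :: "real \<Rightarrow> real \<Rightarrow> real \<Rightarrow> real \<Rightarrow> real \<Rightarrow> real" where
  "xenergy rho n00 n01 n02 n03 = (rho^4 * n00)^2 + (rho^3 * n01)^2 + (rho^2 * n02)^2 + (rho * n03)^2"

definition tenergy :: "real \<Rightarrow> real \<Rightarrow> real \<Rightarrow> real" where
  "tenergy rho n10 n11 = (rho^2 * n10)^2 + (rho * n11)^2"

definition pointwise_carleman :: "real \<Rightarrow> real \<Rightarrow> real \<Rightarrow> real \<Rightarrow> bool" where
  "pointwise_carleman M g c K \<longleftrightarrow>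
    (\<forall>rho eps del al a b b1 b2 h th d chi n00 n01 n02 n03 n04 n10 n11 n12 n20 w01 w02 w03 w04 w10 w11 w12 w20 P X.
      admissible M rho eps del al a b b1 b2 h th d \<longrightarrow> 0 \<le> chi \<longrightarrow> 1 \<le> chi \<or> g * rho^2 \<le> a^2 \<and> g * (eps * rho^2) \<le> b \<longrightarrow>
      w10 = n10 + th * n00 \<longrightarrow>
      w11 = conj1 a w10 (n11 + th * n01 + h * a * n00) \<longrightarrow>
      w12 = conj2 a b w10 (n11 + th * n01 + h * a * n00) (n12 + th * n02 + 2 * h * a * n01 + h * b * n00) \<longrightarrow>
      w20 = n20 + 2 * th * n10 + (d + th^2) * n00 \<longrightarrow>
      w01 = conj1 a n00 n01 \<longrightarrow> w02 = conj2 a b n00 n01 n02 \<longrightarrow> w03 = conj3 a b b1 n00 n01 n02 n03 \<longrightarrow>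
      w04 = conj4 a b b1 b2 n00 n01 n02 n03 n04 \<longrightarrow>
      P = n20 - al * n12 + n04 \<longrightarrow>
      X = symm_part al a th n00 w02 w04 w11 w20 * anti_part al a b th n00 w01 w02 w03 w10 w12
        - comm_main al a b n00 w01 w02 w03 w10 w11 - comm_err al a b b1 h th d n00 w01 w02 w03 w10 w11 \<longrightarrow>
      c * (eps * (xenergy rho n00 n01 n02 n03 + al^2 * (rho * n11)^2))
        \<le> P^2 - X + K * (eps * (al^2 * (rho^2 * n10)^2 + (chi + del) * (xenergy rho n00 n01 n02 n03 + (1 + al)^2 * tenergy rho n10 n11))))"

text \<open>The scaling of the beam operator: an x-derivative counts as \<open>rho\<close>, a
  t-derivative as \<open>rho^2 / (1 + al)\<close>. Dividing by these reduces the claim to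
  \<open>scaled_carleman\<close> with \<open>r = eps / del\<close>.\<close>

lemma pointwise_carleman_exists:
  fixes M g :: real
  assumes g: "0 < g" "g \<le> 1"
  obtains c K where "0 < c" "0 \<le> K" "pointwise_carleman M g c K"
proof -
  obtain c K where c: "0 < c" "0 \<le> K" and scaled: "scaled_carleman M g c K"
    by (rule scaled_carleman_exists[OF g])
  show ?thesis
  proof (rule that[OF c], unfold pointwise_carleman_def, intro allI impI)
    fix rho eps del al a b b1 b2 h th d chi n00 n01 n02 n03 n04 n10 n11 n12 n20 w01 w02 w03 w04 w10 w11 w12 w20 P X :: real
    assume adm: "admissible M rho eps del al a b b1 b2 h th d" and chi: "0 \<le> chi" "1 \<le> chi \<or> g * rho^2 \<le> a^2 \<and> g * (eps * rho^2) \<le> b"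
      and w10: "w10 = n10 + th * n00"
      and w11: "w11 = conj1 a w10 (n11 + th * n01 + h * a * n00)"
      and w12: "w12 = conj2 a b w10 (n11 + th * n01 + h * a * n00) (n12 + th * n02 + 2 * h * a * n01 + h * b * n00)"
      and w20: "w20 = n20 + 2 * th * n10 + (d + th^2) * n00"
      and w01: "w01 = conj1 a n00 n01" and w02: "w02 = conj2 a b n00 n01 n02" and w03: "w03 = conj3 a b b1 n00 n01 n02 n03"
      and w04: "w04 = conj4 a b b1 b2 n00 n01 n02 n03 n04"
      and P: "P = n20 - al * n12 + n04"
      and X: "X = symm_part al a th n00 w02 w04 w11 w20 * anti_part al a b th n00 w01 w02 w03 w10 w12
        - comm_main al a b n00 w01 w02 w03 w10 w11 - comm_err al a b b1 h th d n00 w01 w02 w03 w10 w11"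
    define r om A B B1 B2 H Th D where def: "r = eps / del" "om = 1 / (1 + al)" "A = a / rho" "B = b / (eps * rho^2)"
      "B1 = b1 / (eps^2 * rho^3)" "B2 = b2 / (eps^3 * rho^4)" "H = h / (eps * del * rho^2 / (1 + al))"
      "Th = th / (del * rho^2 / (1 + al))" "D = d / (eps * del * rho^4 / (1 + al)^2)"
    define e1 e2 e3 f0 f1 where edef: "e1 = n01 / rho" "e2 = n02 / rho^2" "e3 = n03 / rho^3" "f0 = n10 * (1 + al) / rho^2" "f1 = n11 * (1 + al) / rho^3"
    define y1 y2 y3 z0 z1 where ydef: "y1 = e1 + A * n00" "y2 = e2 + (2 * A) * e1 + (A^2 + del * r * B) * n00"
      "y3 = e3 + (3 * A) * e2 + (3 * (A^2 + del * r * B)) * e1 + (A^3 + 3 * (del * r) * A * B + (del * r)^2 * B1) * n00"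
      "z0 = f0 + (del * Th) * n00" "z1 = f1 + (del * Th) * e1 + (del * r * del * H * A) * n00 + A * f0 + (A * del * Th) * n00"
    have pos: "0 < rho" "0 < eps" "0 < del" "0 \<le> al" "0 < 1 + al" "eps \<le> del" "del \<le> 1" using adm unfolding admissible_def by auto
    have eps: "eps = del * r" using pos unfolding def by simp
    have bd: "\<bar>x\<bar> \<le> M * y \<Longrightarrow> 0 < y \<Longrightarrow> \<bar>x / y\<bar> \<le> M" for x y :: real by (simp add: field_simps abs_divide)
    have M: "\<bar>A\<bar> \<le> M" "\<bar>B\<bar> \<le> M" "\<bar>B1\<bar> \<le> M" "\<bar>B2\<bar> \<le> M" "\<bar>H\<bar> \<le> M" "\<bar>Th\<bar> \<le> M" "\<bar>D\<bar> \<le> M"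
      unfolding def by (rule bd; use adm pos in \<open>simp add: admissible_def\<close>)+
    have eqs: "rho * A = a" "del * r * rho^2 * B = b" "del^2 * r^2 * rho^3 * B1 = b1" "del^3 * r^3 * rho^4 * B2 = b2"
        "del^2 * r * om * rho^2 * H = h" "del * om * rho^2 * Th = th" "del^2 * r * om^2 * rho^4 * D = d"
    proof -
      define q where "q = 1 + al"
      have "q \<noteq> 0" using pos unfolding q_def by simp
      then show "rho * A = a" "del * r * rho^2 * B = b" "del^2 * r^2 * rho^3 * B1 = b1" "del^3 * r^3 * rho^4 * B2 = b2"
        "del^2 * r * om * rho^2 * H = h" "del * om * rho^2 * Th = th" "del^2 * r * om^2 * rho^4 * D = d"
        using pos unfolding def q_def[symmetric] by (simp_all add: field_simps power2_eq_square power3_eq_cube)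
    qed
    have eqe: "n01 = rho * e1" "n02 = rho^2 * e2" "n03 = rho^3 * e3" "n10 = om * rho^2 * f0" "n11 = om * rho^3 * f1"
      using pos unfolding def edef by simp_all
    have eqw: "rho * y1 = w01" "rho^2 * y2 = w02" "rho^3 * y3 = w03" "om * rho^2 * z0 = w10" "om * rho^3 * z1 = w11"
      unfolding w01 w02 w03 w11 w10 conj1_def conj2_def conj3_def ydef eqe
      by (simp_all add: eqs[symmetric] algebra_simps eval_nat_numeral)
    have chi': "1 \<le> chi \<or> g \<le> A^2 \<and> g \<le> B"
      using chi(2) pos unfolding def by (auto simp: field_simps)
    have r: "0 < r" "r \<le> 1" using pos unfolding def by auto
    have P': "P = symm_part al a th n00 w02 w04 w11 w20 + anti_part al a b th n00 w01 w02 w03 w10 w12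
     + conj_rem al a b b1 b2 h th d n00 w01 w10"
      unfolding P by (rule conj_decomposition[OF w10 w11 w12 w20 w01 w02 w03 w04])
    have main: "c * (rho^8 * (del * r) * (n00^2 + e1^2 + e2^2 + e3^2 + (al * om)^2 * f1^2))
      \<le> P^2 - X + K * (rho^8 * (del * r) * ((al * om)^2 * f0^2 + (chi + del) * (n00^2 + e1^2 + e2^2 + e3^2 + f0^2 + f1^2)))"
      by (rule scaled[unfolded scaled_carleman_def, rule_format, where A = A and B = B and ?B1.0 = B1 and ?B2.0 = B2 and H = H and Th = Th and D = D, OF pos(3,7) r pos(4) def(2) M chi(1) chi' ydef, of P rho w04 w20 w12, unfolded eqs eqw, OF P' X])
    have omal: "om * (1 + al) = 1" using pos unfolding def by simp
    have q: "rho^8 * n00^2 = (rho^4 * n00)^2" "rho^8 * e1^2 = (rho^3 * n01)^2" "rho^8 * e2^2 = (rho^2 * n02)^2" "rho^8 * e3^2 = (rho * n03)^2"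
      unfolding eqe by (simp_all add: power_mult_distrib flip: power_mult power_add)
    have om2: "om^2 * (1 + al)^2 = 1" using omal by (metis power_mult_distrib power_one)
    have f1: "(1 + al)^2 * (rho * n11)^2 = rho^8 * f1^2"
    proof -
      have "(1 + al)^2 * (rho * n11)^2 = (om^2 * (1 + al)^2) * (rho^8 * f1^2)" unfolding eqe by (simp add: algebra_simps eval_nat_numeral)
      then show ?thesis by (simp add: om2)
    qed
    have f0: "(1 + al)^2 * (rho^2 * n10)^2 = rho^8 * f0^2"
    proof -
      have "(1 + al)^2 * (rho^2 * n10)^2 = (om^2 * (1 + al)^2) * (rho^8 * f0^2)" unfolding eqe by (simp add: algebra_simps eval_nat_numeral)
      then show ?thesis by (simp add: om2)
    qed
    have a1: "al^2 * (rho * n11)^2 = rho^8 * ((al * om)^2 * f1^2)" "al^2 * (rho^2 * n10)^2 = rho^8 * ((al * om)^2 * f0^2)"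
      unfolding eqe by (simp_all add: algebra_simps eval_nat_numeral)
    have l: "eps * (xenergy rho n00 n01 n02 n03 + al^2 * (rho * n11)^2) = rho^8 * (del * r) * (n00^2 + e1^2 + e2^2 + e3^2 + (al * om)^2 * f1^2)"
      unfolding xenergy_def a1 q[symmetric] eps by (simp add: algebra_simps)
    have rr: "eps * (al^2 * (rho^2 * n10)^2 + (chi + del) * (xenergy rho n00 n01 n02 n03 + (1 + al)^2 * tenergy rho n10 n11))
       = rho^8 * (del * r) * ((al * om)^2 * f0^2 + (chi + del) * (n00^2 + e1^2 + e2^2 + e3^2 + f0^2 + f1^2))"
      unfolding xenergy_def tenergy_def a1 q[symmetric] eps distrib_left[of "(1 + al)^2"] f0 f1 by (simp add: algebra_simps)
    show "c * (eps * (xenergy rho n00 n01 n02 n03 + al^2 * (rho * n11)^2))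
        \<le> P^2 - X + K * (eps * (al^2 * (rho^2 * n10)^2 + (chi + del) * (xenergy rho n00 n01 n02 n03 + (1 + al)^2 * tenergy rho n10 n11)))"
      unfolding l rr by (rule main)
  qed
qed

section \<open>Multipliers and absorption\<close>

lemma young: "x * y \<le> kp * x^2 + y^2 / (4 * kp)" if "0 < kp" for x y kp :: real
proof -
  have "0 \<le> (2 * kp * x - y)^2 / (4 * kp)" using that by simp
  also have "\<dots> = kp * x^2 + y^2 / (4 * kp) - x * y" using that by (simp add: field_simps power2_eq_square)
  finally show ?thesis by simp
qed

lemma young_half: "x * y \<le> (x^2 + y^2) / 2" for x y :: real
  using sum_squares_bound[of x y] by simp

lemma half_quotient: "0 \<le> z / w \<Longrightarrow> 2 * (z / (4 * w)) \<le> z / w" for z w :: real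
proof -
  assume "0 \<le> z / w"
  moreover have "2 * (z / (4 * w)) = (z / w) / 2" by simp
  ultimately show ?thesis by linarith
qed

text \<open>\<open>Y\<close> is the sum of the divergences that arise when the equation is tested
  with \<open>f\<close> times \<eta>, so it disappears on integration. \<open>u\<close> and
  \<open>ut\<close> are the logarithmic derivatives in x and t of the multiplier together with the
  weight e^(2 \<kappa>). \<open>f * n10^2\<close> is the quantity sought; Young's inequality takes
  half of it back, hence the factor 2.\<close>

lemma eta_t_pointwise:
  fixes M :: real
  assumes rho: "0 < rho" and eps: "0 < eps" "eps \<le> 1" and u: "\<bar>u\<bar> \<le> M * rho" and ut: "\<bar>ut\<bar> \<le> M * rho^2"
    and f: "f = eps * rho^4"
    and Y: "Y = f * n00 * P + f * n10^2 + f * ut * n00 * n10 - al * (f * u * n00 * n11 + f * n01 * n11)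
      + f * u * n00 * n03 + f * n01 * n03"
  shows "eps * (rho^2 * n10)^2 \<le> 2 * Y + P^2 + (4 + 5 * M^2) * (eps * (xenergy rho n00 n01 n02 n03 + al^2 * (rho * n11)^2))"
proof -
  define U V where "U = u / rho" and "V = ut / rho^2"
  have uv: "u = rho * U" "ut = rho^2 * V" using rho unfolding U_def V_def by auto
  have UV: "\<bar>U\<bar> \<le> M" "\<bar>V\<bar> \<le> M" using u ut rho unfolding U_def V_def by (simp_all add: field_simps)
  then have UV2: "U^2 \<le> M^2" "V^2 \<le> M^2" using abs_le_square_iff[of _ M] by auto
  define E0 E1 E2 E3 F0 F1 where E: "E0 = rho^4 * n00" "E1 = rho^3 * n01" "E2 = rho^2 * n02" "E3 = rho * n03" "F0 = rho^2 * n10" "F1 = rho * n11"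
  have Yeq: "Y = eps * (E0 * P + F0^2 + V * E0 * F0 - al * F1 * (U * E0 + E1) + (U * E0 + E1) * E3)"
    unfolding Y f uv E by (simp add: algebra_simps eval_nat_numeral)
  have 1: "- (E0 * P) \<le> E0^2 / 2 + P^2 / 2" using young_half[of "- E0" P] by simp
  have 2: "- (V * E0 * F0) \<le> F0^2 / 2 + M^2 * E0^2 / 2"
  proof -
    have "- (V * E0 * F0) \<le> ((V * E0)^2 + F0^2) / 2" using young_half[of "- (V * E0)" F0] by simp
    moreover have "(V * E0)^2 \<le> M^2 * E0^2" unfolding power_mult_distrib by (rule mult_right_mono[OF UV2(2)]) simp
    ultimately show ?thesis by simp
  qed
  have s: "(U * E0 + E1)^2 \<le> 2 * (M^2 * E0^2) + 2 * E1^2"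
  proof -
    have "(U * E0 + E1)^2 \<le> 2 * (U * E0)^2 + 2 * E1^2" using sum_squares_bound[of "U * E0" E1] by (simp add: power2_sum)
    moreover have "(U * E0)^2 \<le> M^2 * E0^2" unfolding power_mult_distrib by (rule mult_right_mono[OF UV2(1)]) simp
    ultimately show ?thesis by simp
  qed
  have 3: "al * F1 * (U * E0 + E1) \<le> (al * F1)^2 / 2 + M^2 * E0^2 + E1^2"
    using young_half[of "al * F1" "U * E0 + E1"] s by simp
  have 4: "- ((U * E0 + E1) * E3) \<le> E3^2 / 2 + M^2 * E0^2 + E1^2"
    using young_half[of "U * E0 + E1" "- E3"] s by simp
  have "F0^2 / 2 - (E0 * P + F0^2 + V * E0 * F0 - al * F1 * (U * E0 + E1) + (U * E0 + E1) * E3)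
     \<le> P^2 / 2 + (1/2 + 5/2 * M^2) * E0^2 + 2 * E1^2 + E3^2 / 2 + al^2 * F1^2 / 2 - F0^2 / 2 + F0^2 / 2"
    using 1 2 3 4 by (simp add: algebra_simps)
  also have "\<dots> \<le> P^2 / 2 + (2 + 5/2 * M^2) * (E0^2 + E1^2 + E2^2 + E3^2 + al^2 * F1^2)"
  proof -
    have "0 \<le> M^2 * E1^2" "0 \<le> M^2 * E2^2" "0 \<le> M^2 * E3^2" "0 \<le> M^2 * (al^2 * F1^2)" "0 \<le> E0^2" "0 \<le> E2^2" "0 \<le> E3^2" "0 \<le> al^2 * F1^2" "0 \<le> M^2 * E0^2" by simp_all
    then show ?thesis unfolding distrib_left distrib_right mult.assoc by linarith
  qed
  finally have "eps * (F0^2 / 2 - (E0 * P + F0^2 + V * E0 * F0 - al * F1 * (U * E0 + E1) + (U * E0 + E1) * E3))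
    \<le> eps * (P^2 / 2 + (2 + 5/2 * M^2) * (E0^2 + E1^2 + E2^2 + E3^2 + al^2 * F1^2))"
    using eps by (intro mult_left_mono) auto
  moreover have "eps * P^2 \<le> 1 * P^2" using eps by (intro mult_right_mono) auto
  ultimately show ?thesis unfolding Yeq xenergy_def E[symmetric] by (simp add: algebra_simps)
qed

text \<open>Tested with the second x-derivative of \<eta>, the term with \<alpha> is half the
  t-derivative of a square. What survives is \<alpha> times \<open>ut\<close> to the first power,
  hence the hypothesis on \<open>al * ut\<close>; the factor \<open>1 / (1 + al)\<close> in
  \<open>admissible\<close> provides it.\<close>

lemma eta_tx_pointwise:
  fixes M :: real
  assumes rho: "0 < rho" and eps: "0 < eps" "eps \<le> 1" and u: "\<bar>u\<bar> \<le> M * rho" and ut: "\<bar>ut\<bar> \<le> M * rho^2" "\<bar>al * ut\<bar> \<le> M * rho^2"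
    and M: "1 \<le> M" and f: "f = eps * rho^2"
    and Y: "Y = - (f * n02 * P) + f * n11^2 - f * ut * n02 * n10 + al / 2 * (f * ut * n02^2)
      + f * u * n10 * n11 - f * u * n02 * n03 - f * n03^2"
  shows "eps * (rho * n11)^2 \<le> 2 * Y + P^2 + 6 * M^2 * (eps * (xenergy rho n00 n01 n02 n03 + (rho^2 * n10)^2))"
proof -
  define U V W where "U = u / rho" and "V = ut / rho^2" and "W = al * ut / rho^2"
  have uv: "u = rho * U" "ut = rho^2 * V" "al * ut = rho^2 * W" using rho unfolding U_def V_def W_def by auto
  have UV: "\<bar>U\<bar> \<le> M" "\<bar>V\<bar> \<le> M" "\<bar>W\<bar> \<le> M" using u ut rho unfolding U_def V_def W_def by (simp_all add: field_simps)
  then have UV2: "U^2 \<le> M^2" "V^2 \<le> M^2" using abs_le_square_iff[of _ M] by auto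
  define E0 E1 E2 E3 F0 F1 where E: "E0 = rho^4 * n00" "E1 = rho^3 * n01" "E2 = rho^2 * n02" "E3 = rho * n03" "F0 = rho^2 * n10" "F1 = rho * n11"
  have "Y = - (f * n02 * P) + f * n11^2 - f * ut * n02 * n10 + (f * (al * ut) * n02^2) / 2
      + f * u * n10 * n11 - f * u * n02 * n03 - f * n03^2" unfolding Y by simp
  also have "\<dots> = eps * (- (E2 * P) + F1^2 - V * E2 * F0 + W * E2^2 / 2 + U * F0 * F1 - U * E2 * E3 - E3^2)"
    unfolding uv(3) unfolding f uv(1,2) E by (simp add: algebra_simps eval_nat_numeral)
  finally have Yeq: "Y = eps * (- (E2 * P) + F1^2 - V * E2 * F0 + W * E2^2 / 2 + U * F0 * F1 - U * E2 * E3 - E3^2)" .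
  have M2: "M \<le> M^2" "1 \<le> M^2" using M power_increasing[of 1 2 M] power_increasing[of 0 2 M] by auto
  have sqM: "(Z * x)^2 \<le> M^2 * x^2" if "Z^2 \<le> M^2" for Z x :: real
    unfolding power_mult_distrib by (rule mult_right_mono[OF that]) simp
  have 1: "E2 * P \<le> E2^2 / 2 + P^2 / 2" using young_half[of E2 P] by simp
  have 2: "V * E2 * F0 \<le> F0^2 / 2 + M^2 * E2^2 / 2" using young_half[of "V * E2" F0] sqM[OF UV2(2), of E2] by simp
  have 3: "- (W * E2^2 / 2) \<le> M^2 * E2^2 / 2"
    using UV(3) M2 mult_right_mono[of "- W" "M^2" "E2^2"] by simp
  have 4: "- (U * F0 * F1) \<le> F1^2 / 2 + M^2 * F0^2 / 2" using young_half[of "- (U * F0)" F1] sqM[OF UV2(1), of F0] by simp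
  have 5: "U * E2 * E3 \<le> E3^2 / 2 + M^2 * E2^2 / 2" using young_half[of "U * E2" E3] sqM[OF UV2(1), of E2] by simp
  have "F1^2 / 2 - (- (E2 * P) + F1^2 - V * E2 * F0 + W * E2^2 / 2 + U * F0 * F1 - U * E2 * E3 - E3^2)
     \<le> P^2 / 2 + E2^2 / 2 + (3/2) * (M^2 * E2^2) + F0^2 / 2 + M^2 * F0^2 / 2 + (3/2) * E3^2"
    using 1 2 3 4 5 by (simp add: algebra_simps)
  also have "\<dots> \<le> P^2 / 2 + 3 * M^2 * (E0^2 + E1^2 + E2^2 + E3^2 + F0^2)"
  proof -
    have "0 \<le> M^2 * E0^2" "0 \<le> M^2 * E1^2" "E2^2 \<le> M^2 * E2^2" "E3^2 \<le> M^2 * E3^2" "F0^2 \<le> M^2 * F0^2"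
      using mult_right_mono[OF M2(2), of "E2^2"] mult_right_mono[OF M2(2), of "E3^2"] mult_right_mono[OF M2(2), of "F0^2"] by simp_all
    moreover have "0 \<le> E2^2" "0 \<le> E3^2" "0 \<le> F0^2" by simp_all
    ultimately show ?thesis unfolding distrib_left mult.assoc by linarith
  qed
  finally have "eps * (F1^2 / 2 - (- (E2 * P) + F1^2 - V * E2 * F0 + W * E2^2 / 2 + U * F0 * F1 - U * E2 * E3 - E3^2))
    \<le> eps * (P^2 / 2 + 3 * M^2 * (E0^2 + E1^2 + E2^2 + E3^2 + F0^2))"
    using eps by (intro mult_left_mono) auto
  moreover have "eps * P^2 \<le> 1 * P^2" using eps by (intro mult_right_mono) auto
  ultimately show ?thesis unfolding Yeq xenergy_def E[symmetric] by (simp add: algebra_simps)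
qed

text \<open>Differentiating \<open>G^4\<close> loses one power of \<open>G\<close>. After Young's
  inequality \<open>G^6\<close> remains in front of the first order term, which is at most
  \<open>M^4\<close> times the \<open>G^2\<close> that the next interpolation can handle.\<close>

lemma local_xx_pointwise:
  fixes M :: real
  assumes rho: "0 < rho" and eps: "0 < eps" and G: "0 \<le> G" "G \<le> M" and M: "1 \<le> M" and kp: "0 < kp"
    and vf: "\<bar>vf\<bar> \<le> M * (eps * rho^5 * G^3)" and f: "f = eps * rho^4 * G^4"
    and Y: "Y = vf * n01 * n02 + f * n02^2 + f * n01 * n03"
  shows "eps * (G^4 * (rho^2 * n02)^2) \<le> Y + kp * (eps * xenergy rho n00 n01 n02 n03) + M^6 / kp * (eps * (G^2 * (rho^3 * n01)^2))"
proof -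
  define E0 E1 E2 E3 where E: "E0 = rho^4 * n00" "E1 = rho^3 * n01" "E2 = rho^2 * n02" "E3 = rho * n03"
  have 1: "- (vf * n01 * n02) \<le> eps * (kp * E2^2 + M^6 * G^2 * E1^2 / (4 * kp))"
  proof -
    have "- (vf * n01 * n02) \<le> \<bar>vf\<bar> * (\<bar>n01\<bar> * \<bar>n02\<bar>)" using abs_ge_minus_self[of "vf * n01 * n02"] by (simp add: abs_mult mult.assoc)
    also have "\<dots> \<le> M * (eps * rho^5 * G^3) * (\<bar>n01\<bar> * \<bar>n02\<bar>)" using vf by (intro mult_right_mono) auto
    also have "\<dots> = eps * (\<bar>E2\<bar> * (M * G^3 * \<bar>E1\<bar>))" unfolding E using rho by (simp add: abs_mult eval_nat_numeral ac_simps)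
    also have "\<dots> \<le> eps * (kp * \<bar>E2\<bar>^2 + (M * G^3 * \<bar>E1\<bar>)^2 / (4 * kp))" using eps by (intro mult_left_mono young kp) auto
    also have "\<dots> \<le> eps * (kp * E2^2 + M^6 * G^2 * E1^2 / (4 * kp))"
    proof -
      have "G^4 \<le> M^4" using G by (intro power_mono) auto
      then have "M^2 * G^4 * (G^2 * E1^2) \<le> M^2 * M^4 * (G^2 * E1^2)" by (intro mult_right_mono mult_left_mono) auto
      moreover have "(M * G^3 * \<bar>E1\<bar>)^2 = M^2 * G^4 * (G^2 * E1^2)" by (simp add: power_mult_distrib eval_nat_numeral)
      moreover have "M^6 * G^2 * E1^2 = M^2 * M^4 * (G^2 * E1^2)" by (simp add: eval_nat_numeral)
      ultimately have "(M * G^3 * \<bar>E1\<bar>)^2 \<le> M^6 * G^2 * E1^2" by simp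
      then show ?thesis using eps kp by (intro mult_left_mono add_mono divide_right_mono) auto
    qed
    finally show ?thesis .
  qed
  have 2: "- (f * n01 * n03) \<le> eps * (kp * E3^2 + M^6 * G^2 * E1^2 / (4 * kp))"
  proof -
    have "- (f * n01 * n03) = eps * (E3 * (- (G^4 * E1)))" unfolding E f by (simp add: eval_nat_numeral ac_simps)
    also have "\<dots> \<le> eps * (kp * E3^2 + (- (G^4 * E1))^2 / (4 * kp))" using eps by (intro mult_left_mono young kp) auto
    also have "\<dots> \<le> eps * (kp * E3^2 + M^6 * G^2 * E1^2 / (4 * kp))"
    proof -
      have "G^6 \<le> M^6" using G by (intro power_mono) auto
      then have "G^6 * (G^2 * E1^2) \<le> M^6 * (G^2 * E1^2)" by (intro mult_right_mono) auto
      then have "(- (G^4 * E1))^2 \<le> M^6 * G^2 * E1^2" by (simp add: eval_nat_numeral ac_simps)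
      then show ?thesis using eps kp by (intro mult_left_mono add_mono divide_right_mono) auto
    qed
    finally show ?thesis .
  qed
  have "eps * (G^4 * E2^2) = Y - vf * n01 * n02 - f * n01 * n03"
    unfolding Y f E by (simp add: algebra_simps eval_nat_numeral)
  also have "\<dots> \<le> Y + eps * (kp * (E2^2 + E3^2)) + eps * (2 * (M^6 * G^2 * E1^2 / (4 * kp)))"
    using 1 2 by (simp add: algebra_simps)
  also have "\<dots> \<le> Y + eps * (kp * (E0^2 + E1^2 + E2^2 + E3^2)) + eps * (M^6 * G^2 * E1^2 / kp)"
  proof -
    have "0 \<le> M^6 * G^2 * E1^2 / kp" using kp by simp
    then have q: "2 * (M^6 * G^2 * E1^2 / (4 * kp)) \<le> M^6 * G^2 * E1^2 / kp" by (rule half_quotient)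
    have "E2^2 + E3^2 \<le> E0^2 + E1^2 + E2^2 + E3^2" by simp
    then have "kp * (E2^2 + E3^2) \<le> kp * (E0^2 + E1^2 + E2^2 + E3^2)" using kp by (intro mult_left_mono) auto
    note e = this[THEN mult_left_mono, OF less_imp_le[OF eps]] q[THEN mult_left_mono, OF less_imp_le[OF eps]]
    show ?thesis by (rule add_mono[OF add_mono[OF order_refl e(1)] e(2)])
  qed
  finally show ?thesis unfolding xenergy_def E[symmetric] by (simp add: mult.assoc mult.left_commute)
qed

text \<open>The derivative of \<open>G^2\<close> still has one factor \<open>G\<close>; its square
  is exactly the cutoff \<open>G^2\<close> allowed at order zero.\<close>

lemma local_x_pointwise:
  fixes M :: real
  assumes rho: "0 < rho" and eps: "0 < eps" and G: "0 \<le> G" "G \<le> M" and M: "1 \<le> M" and kp: "0 < kp"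
    and vf: "\<bar>vf\<bar> \<le> M * (eps * rho^7 * G)" and f: "f = eps * rho^6 * G^2"
    and Y: "Y = vf * n00 * n01 + f * n01^2 + f * n00 * n02"
  shows "eps * (G^2 * (rho^3 * n01)^2) \<le> Y + kp * (eps * xenergy rho n00 n01 n02 n03) + M^6 / kp * (eps * (G^2 * (rho^4 * n00)^2))"
proof -
  define E0 E1 E2 E3 where E: "E0 = rho^4 * n00" "E1 = rho^3 * n01" "E2 = rho^2 * n02" "E3 = rho * n03"
  have M26: "M^2 \<le> M^6" using M by (intro power_increasing) auto
  have 1: "- (vf * n00 * n01) \<le> eps * (kp * E1^2 + M^6 * G^2 * E0^2 / (4 * kp))"
  proof -
    have "- (vf * n00 * n01) \<le> \<bar>vf\<bar> * (\<bar>n00\<bar> * \<bar>n01\<bar>)" using abs_ge_minus_self[of "vf * n00 * n01"] by (simp add: abs_mult mult.assoc)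
    also have "\<dots> \<le> M * (eps * rho^7 * G) * (\<bar>n00\<bar> * \<bar>n01\<bar>)" using vf by (intro mult_right_mono) auto
    also have "\<dots> = eps * (\<bar>E1\<bar> * (M * G * \<bar>E0\<bar>))" unfolding E using rho by (simp add: abs_mult eval_nat_numeral ac_simps)
    also have "\<dots> \<le> eps * (kp * \<bar>E1\<bar>^2 + (M * G * \<bar>E0\<bar>)^2 / (4 * kp))" using eps by (intro mult_left_mono young kp) auto
    also have "\<dots> \<le> eps * (kp * E1^2 + M^6 * G^2 * E0^2 / (4 * kp))"
    proof -
      have "M^2 * (G^2 * E0^2) \<le> M^6 * (G^2 * E0^2)" by (rule mult_right_mono[OF M26]) simp
      then have "(M * G * \<bar>E0\<bar>)^2 \<le> M^6 * G^2 * E0^2" by (simp add: power_mult_distrib mult.assoc)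
      then show ?thesis using eps kp by (intro mult_left_mono add_mono divide_right_mono) auto
    qed
    finally show ?thesis .
  qed
  have 2: "- (f * n00 * n02) \<le> eps * (kp * E2^2 + M^6 * G^2 * E0^2 / (4 * kp))"
  proof -
    have "- (f * n00 * n02) = eps * (E2 * (- (G^2 * E0)))" unfolding E f by (simp add: eval_nat_numeral ac_simps)
    also have "\<dots> \<le> eps * (kp * E2^2 + (- (G^2 * E0))^2 / (4 * kp))" using eps by (intro mult_left_mono young kp) auto
    also have "\<dots> \<le> eps * (kp * E2^2 + M^6 * G^2 * E0^2 / (4 * kp))"
    proof -
      have "G^2 \<le> M^2" using G by (intro power_mono) auto
      then have "G^2 * (G^2 * E0^2) \<le> M^6 * (G^2 * E0^2)" using M26 by (intro mult_right_mono) auto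
      then have "(- (G^2 * E0))^2 \<le> M^6 * G^2 * E0^2" by (simp add: eval_nat_numeral ac_simps)
      then show ?thesis using eps kp by (intro mult_left_mono add_mono divide_right_mono) auto
    qed
    finally show ?thesis .
  qed
  have "eps * (G^2 * E1^2) = Y - vf * n00 * n01 - f * n00 * n02"
    unfolding Y f E by (simp add: algebra_simps eval_nat_numeral)
  also have "\<dots> \<le> Y + eps * (kp * (E1^2 + E2^2)) + eps * (2 * (M^6 * G^2 * E0^2 / (4 * kp)))"
    using 1 2 by (simp add: algebra_simps)
  also have "\<dots> \<le> Y + eps * (kp * (E0^2 + E1^2 + E2^2 + E3^2)) + eps * (M^6 * G^2 * E0^2 / kp)"
  proof -
    have "0 \<le> M^6 * G^2 * E0^2 / kp" using kp by simp
    then have q: "2 * (M^6 * G^2 * E0^2 / (4 * kp)) \<le> M^6 * G^2 * E0^2 / kp" by (rule half_quotient)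
    have "E1^2 + E2^2 \<le> E0^2 + E1^2 + E2^2 + E3^2" by simp
    then have "kp * (E1^2 + E2^2) \<le> kp * (E0^2 + E1^2 + E2^2 + E3^2)" using kp by (intro mult_left_mono) auto
    note e = this[THEN mult_left_mono, OF less_imp_le[OF eps]] q[THEN mult_left_mono, OF less_imp_le[OF eps]]
    show ?thesis by (rule add_mono[OF add_mono[OF order_refl e(1)] e(2)])
  qed
  finally show ?thesis unfolding xenergy_def E[symmetric] by (simp add: mult.assoc mult.left_commute)
qed

text \<open>The closing argument stripped to real numbers. The variables stand for integrated
  energies, \<open>PP\<close> for the integral of the squared equation, and \<open>M1\<close>,
  \<open>M2\<close> for the local terms of order one and two that must be interpolated away. As
  \<open>al\<close> is quantified inside, \<open>D\<close> is uniform in it.\<close>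

definition absorbing :: "real \<Rightarrow> real \<Rightarrow> real \<Rightarrow> real \<Rightarrow> real \<Rightarrow> bool" where
  "absorbing c K C del D \<longleftrightarrow>
    (\<forall>X T0 T1 L0 Ls M1 M2 PP al. 0 \<le> X \<longrightarrow> 0 \<le> T0 \<longrightarrow> 0 \<le> T1 \<longrightarrow> 0 \<le> L0 \<longrightarrow> 0 \<le> Ls \<longrightarrow> 0 \<le> PP \<longrightarrow> 0 \<le> al \<longrightarrow>
      c * (X + al^2 * T1) \<le> PP + K * (al^2 * T0 + (C * (L0 + M1) + M2 + Ls) + del * (X + (1 + al)^2 * (T0 + T1))) \<longrightarrow>
      T0 \<le> PP + K * (X + al^2 * T1) \<longrightarrow> T1 \<le> PP + K * (X + T0) \<longrightarrow>
      (\<forall>kp>0. M2 \<le> kp * X + C / kp * M1) \<longrightarrow> (\<forall>kp>0. M1 \<le> kp * X + C / kp * L0) \<longrightarrow>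
      X + (1 + al^2) * (T0 + T1) \<le> D * (PP + al^2 * T0 + L0 + Ls))"

text \<open>Every error carries the small factor \<open>del\<close> or the free parameter \<open>kp\<close>; the choice of both depends on \<open>c\<close>, \<open>K\<close>, \<open>C\<close> only.\<close>

lemma absorbing_exists:
  fixes c K C :: real
  assumes c: "0 < c" and K: "1 \<le> K" and C: "1 \<le> C"
  obtains del D where "0 < del" "del \<le> 1" "0 < D" "absorbing c K C del D"
proof -
  define c' where "c' = min c 1"
  have c': "0 < c'" "c' \<le> 1" "c' \<le> c" using c unfolding c'_def by auto
  \<comment> \<open>Tuned so that half of \<open>c' * S\<close> survives: \<open>K * k2\<close> and
    \<open>K * (C + C / k2) * k1\<close> equal \<open>c' / 8\<close> each, and
    \<open>K * del * 9 * K^2\<close> is at most \<open>c' / 4\<close>. \<open>k1\<close> depends on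
    \<open>k2\<close> because reducing \<open>M2\<close> to \<open>M1\<close> enlarges the factor of
    \<open>M1\<close>.\<close>
  define del where "del = c' / (40 * K^3)"
  define k2 where "k2 = c' / (8 * K)"
  define k1 where "k1 = c' / (8 * K * (C + C / k2))"
  define H where "H = K * (C + (C + C / k2) * (C / k1))"
  define D where "D = (6 + 2 * K + K^2) * (20 * K^2 + H) * (4 / c') + (10 * K^2)"
  have K3: "1 \<le> K^2" "1 \<le> K^3" "K \<le> K^2" "K \<le> K^3" "K^2 \<le> K^3"
    using K power_increasing[of 1 2 K] power_increasing[of 1 3 K] power_increasing[of 2 3 K] one_le_power[of K 2] one_le_power[of K 3] by auto
  have k2: "0 < k2" unfolding k2_def using c' K by simp
  have CC: "0 < C + C / k2" using C k2 by (intro add_pos_pos divide_pos_pos) auto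
  have k1: "0 < k1" unfolding k1_def using c' K CC by (intro divide_pos_pos mult_pos_pos) auto
  have H: "0 \<le> H" "K \<le> H" "K * (C + (C + C / k2) * (C / k1)) = H"
  proof -
    show "K * (C + (C + C / k2) * (C / k1)) = H" unfolding H_def ..
    have "0 \<le> (C + C / k2) * (C / k1)" using CC C k1 by simp
    then have "K * 1 \<le> K * (C + (C + C / k2) * (C / k1))" using K C by (intro mult_left_mono) auto
    then show "K \<le> H" unfolding H_def by simp
    then show "0 \<le> H" using K by simp
  qed
  have kK: "K * k2 = c' / 8" "K * ((C + C / k2) * k1) = c' / 8"
  proof -
    show "K * k2 = c' / 8" unfolding k2_def using K by simp
    have "K \<noteq> 0" "C + C / k2 \<noteq> 0" using K CC by auto
    then show "K * ((C + C / k2) * k1) = c' / 8" unfolding k1_def by simp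
  qed
  have del: "0 < del" "del \<le> 1" unfolding del_def using c' K3 K by (auto simp: field_simps)
  have D: "0 < D" unfolding D_def using c' K K3 H by (intro add_nonneg_pos mult_nonneg_nonneg) auto
  show ?thesis
  proof (rule that[OF del D], unfold absorbing_def, intro allI impI)
    fix X T0 T1 L0 Ls M1 M2 PP al :: real
    assume nn: "0 \<le> X" "0 \<le> T0" "0 \<le> T1" "0 \<le> L0" "0 \<le> Ls" "0 \<le> PP" "0 \<le> al"
      and 1: "c * (X + al^2 * T1) \<le> PP + K * (al^2 * T0 + (C * (L0 + M1) + M2 + Ls) + del * (X + (1 + al)^2 * (T0 + T1)))"
      and 2: "T0 \<le> PP + K * (X + al^2 * T1)" and 3: "T1 \<le> PP + K * (X + T0)"
      and 4: "\<forall>kp>0. M2 \<le> kp * X + C / kp * M1" and 5: "\<forall>kp>0. M1 \<le> kp * X + C / kp * L0"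
    \<comment> \<open>\<open>S\<close> is what the commutator estimate controls, and both time
      energies are bounded through it. \<open>F\<close> has no small factor and stays on the
      right.\<close>
    define S where "S = X + al^2 * T1"
    define F where "F = al^2 * T0"
    define R where "R = PP + F + L0 + Ls"
    have S: "0 \<le> S" "X \<le> S" "al^2 * T1 \<le> S" unfolding S_def using nn by auto
    have F: "0 \<le> F" unfolding F_def using nn by simp
    have R: "0 \<le> R" "PP \<le> R" "F \<le> R" "L0 \<le> R" "Ls \<le> R" unfolding R_def using nn F by auto
    have T0: "T0 \<le> PP + K * S" using 2 unfolding S_def .
    have T1: "T1 \<le> (1 + K) * PP + (K + K^2) * S"
    proof -
      have "K * (X + T0) \<le> K * (S + (PP + K * S))" using T0 S K by (intro mult_left_mono add_mono) auto
      then show ?thesis using 3 by (simp add: algebra_simps power2_eq_square)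
    qed
    have sq: "(1 + al)^2 \<le> 2 + 2 * al^2" using sum_squares_bound[of 1 al] by (simp add: power2_sum)
    have TT: "T0 + T1 \<le> (2 + K) * PP + (2 * K + K^2) * S" using T0 T1 by (simp add: algebra_simps)
    have aT: "al^2 * (T0 + T1) \<le> F + S" unfolding F_def using S(3) by (simp add: algebra_simps)
    have "(1 + al)^2 * (T0 + T1) \<le> (2 + 2 * al^2) * (T0 + T1)" using sq nn by (intro mult_right_mono) auto
    also have "\<dots> = 2 * (T0 + T1) + 2 * (al^2 * (T0 + T1))" by (simp add: algebra_simps)
    also have "\<dots> \<le> 2 * ((2 + K) * PP + (2 * K + K^2) * S) + 2 * (F + S)"
      by (rule add_mono[OF mult_left_mono[OF TT] mult_left_mono[OF aT]]) auto
    finally have w: "X + (1 + al)^2 * (T0 + T1) \<le> (4 + 2 * K) * PP + 2 * F + (3 + 4 * K + 2 * K^2) * S"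
      using S(2) by (simp add: algebra_simps)
    also have "\<dots> \<le> 9 * K^2 * (PP + F + S)"
    proof -
      have "(4 + 2 * K) * PP \<le> 9 * K^2 * PP" "2 * F \<le> 9 * K^2 * F" "(3 + 4 * K + 2 * K^2) * S \<le> 9 * K^2 * S"
        using K3 K nn F S by (intro mult_right_mono; linarith)+
      then show ?thesis by (simp add: algebra_simps)
    qed
    finally have w: "X + (1 + al)^2 * (T0 + T1) \<le> 9 * K^2 * (PP + F + S)" .
    have wd: "K * (del * (X + (1 + al)^2 * (T0 + T1))) \<le> c' / 4 * (PP + F + S)"
    proof -
      have "K * (del * (X + (1 + al)^2 * (T0 + T1))) \<le> K * (del * (9 * K^2 * (PP + F + S)))"
        using w del K by (intro mult_left_mono) auto
      also have "\<dots> = (K * del * 9 * K^2) * (PP + F + S)" by simp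
      also have "K * del * 9 * K^2 = c' * (9 / 40)" unfolding del_def using K by (simp add: power2_eq_square power3_eq_cube)
      also have "c' * (9 / 40) * (PP + F + S) \<le> c' / 4 * (PP + F + S)" using c' nn F S by (intro mult_right_mono) auto
      finally show ?thesis .
    qed
    have loc: "K * (C * (L0 + M1) + M2) \<le> c' / 4 * S + H * L0"
    proof -
      have "M2 \<le> k2 * X + C / k2 * M1" using 4 k2 by blast
      then have "C * (L0 + M1) + M2 \<le> C * L0 + k2 * X + (C + C / k2) * M1" by (simp add: algebra_simps)
      also have "\<dots> \<le> C * L0 + k2 * X + (C + C / k2) * (k1 * X + C / k1 * L0)"
        using 5[rule_format, OF k1] CC by (intro add_mono mult_left_mono order_refl) auto
      also have "\<dots> = (k2 + (C + C / k2) * k1) * X + (C + (C + C / k2) * (C / k1)) * L0"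
      proof -
        have "C * L0 + k2 * X + Q * (k1 * X + w * L0) = (k2 + Q * k1) * X + (C + Q * w) * L0" for Q w
          by (simp add: algebra_simps)
        then show ?thesis .
      qed
      finally have "K * (C * (L0 + M1) + M2) \<le> K * ((k2 + (C + C / k2) * k1) * X + (C + (C + C / k2) * (C / k1)) * L0)"
        using K by (intro mult_left_mono) auto
      also have "\<dots> = (K * k2 + K * ((C + C / k2) * k1)) * X + (K * (C + (C + C / k2) * (C / k1))) * L0" by (simp only: distrib_left distrib_right mult.assoc)
      also have "\<dots> = c' / 4 * X + H * L0" unfolding kK H(3) by simp
      also have "\<dots> \<le> c' / 4 * S + H * L0" using S c' by (intro add_right_mono mult_left_mono) auto
      finally show ?thesis .
    qed
    have "c' * S \<le> c * S" using c' S by (intro mult_right_mono) auto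
    also have "\<dots> \<le> PP + K * F + K * (C * (L0 + M1) + M2) + K * Ls + K * (del * (X + (1 + al)^2 * (T0 + T1)))"
      using 1 unfolding S_def F_def by (simp add: algebra_simps)
    also have "\<dots> \<le> PP + K * F + (c' / 4 * S + H * L0) + K * Ls + c' / 4 * (PP + F + S)"
      using loc wd by linarith
    finally have "c' / 2 * S \<le> (1 + c' / 4) * PP + (K + c' / 4) * F + H * L0 + K * Ls"
      unfolding distrib_left distrib_right by linarith
    also have "\<dots> \<le> (5 * K^2 + H) * PP + (5 * K^2 + H) * F + (5 * K^2 + H) * L0 + (5 * K^2 + H) * Ls"
      using c' K K3 H nn F by (intro add_mono mult_right_mono; linarith)
    also have "\<dots> = (5 * K^2 + H) * R" unfolding R_def by (simp add: algebra_simps)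
    finally have "c' / 2 * S \<le> (5 * K^2 + H) * R" .
    then have "S \<le> (5 * K^2 + H) * R * (2 / c')" using c' by (simp add: field_simps)
    also have "\<dots> \<le> (20 * K^2 + H) * R * (4 / c')" using c' K3 H R by (intro mult_mono) (auto simp: divide_right_mono)
    finally have SR: "S \<le> (20 * K^2 + H) * (4 / c') * R" by (simp add: ac_simps)
    have "X + (1 + al^2) * (T0 + T1) = X + (T0 + T1) + al^2 * (T0 + T1)" by (simp add: algebra_simps)
    also have "\<dots> \<le> S + ((2 + K) * PP + (2 * K + K^2) * S) + (F + S)" by (intro add_mono S(2) TT aT)
    also have "\<dots> \<le> (6 + 2 * K + K^2) * S + 10 * K^2 * R"
    proof -
      have "(2 + K) * PP + F \<le> (2 + K) * R + R" using R nn K by (intro add_mono mult_left_mono) auto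
      also have "\<dots> = (3 + K) * R" by (simp add: algebra_simps)
      also have "\<dots> \<le> 10 * K^2 * R" using K3 R by (intro mult_right_mono) auto
      finally show ?thesis using S by (simp add: algebra_simps)
    qed
    also have "\<dots> \<le> (6 + 2 * K + K^2) * ((20 * K^2 + H) * (4 / c') * R) + 10 * K^2 * R"
      using SR K K3 by (intro add_right_mono mult_left_mono) auto
    also have "\<dots> = D * R" unfolding D_def by (simp only: distrib_right mult.assoc)
    finally show "X + (1 + al^2) * (T0 + T1) \<le> D * (PP + al^2 * T0 + L0 + Ls)" unfolding R_def F_def .
  qed
qed

section \<open>Weighted integrals over the cylinder\<close>

text \<open>A singularity of finite order in \<open>1 / \<ell>\<close> at \<open>t = 0, T\<close> is beaten by the weight \<open>e\<^sup>2\<^sup>s\<^sup>\<phi>\<close>, so tame fluxes have no boundary terms.\<close>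

definition tame :: "real \<Rightarrow> (real \<Rightarrow> real \<Rightarrow> real) \<Rightarrow> bool" where
  "tame T f \<longleftrightarrow>
     continuous_on ({0<..<T} \<times> UNIV) (\<lambda>z. f (fst z) (snd z)) \<and>
     (\<forall>t\<in>{0<..<T}. \<forall>x. f t (x + 2 * pi) = f t x) \<and>
     (\<exists>C m. \<forall>t\<in>{0<..<T}. \<forall>x. \<bar>f t x\<bar> \<le> C * (1 + 1 / ell T t) ^ m)"

lemma ell_pos: "t \<in> {0<..<T} \<Longrightarrow> 0 < ell T t"
  by (simp add: ell_def)

lemma tame_const [intro]: "tame T (\<lambda>t x. c)"
  unfolding tame_def by (auto intro!: exI[of _ "\<bar>c\<bar>"] exI[of _ "0::nat"])

lemma tame_bound_raise:
  assumes "\<And>t x. t \<in> {0<..<T} \<Longrightarrow> \<bar>f t x\<bar> \<le> C * (1 + 1 / ell T t) ^ m" "m \<le> n" "t \<in> {0<..<T}"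
  shows "\<bar>f t x\<bar> \<le> \<bar>C\<bar> * (1 + 1 / ell T t) ^ n"
proof -
  have "1 \<le> 1 + 1 / ell T t" using ell_pos[OF assms(3)] by simp
  then have "(1 + 1 / ell T t) ^ m \<le> (1 + 1 / ell T t) ^ n" "0 \<le> (1 + 1 / ell T t) ^ m"
    using assms(2) by (auto intro: power_increasing)
  then have "C * (1 + 1 / ell T t) ^ m \<le> \<bar>C\<bar> * (1 + 1 / ell T t) ^ n" by (intro mult_mono) auto
  then show ?thesis using assms(1)[OF assms(3), of x] by linarith
qed

lemma tame_add [intro]:
  assumes "tame T f" "tame T g"
  shows "tame T (\<lambda>t x. f t x + g t x)"
proof -
  obtain C m where f: "\<And>t x. t \<in> {0<..<T} \<Longrightarrow> \<bar>f t x\<bar> \<le> C * (1 + 1 / ell T t) ^ m"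
    using assms(1) unfolding tame_def by blast
  obtain D n where g: "\<And>t x. t \<in> {0<..<T} \<Longrightarrow> \<bar>g t x\<bar> \<le> D * (1 + 1 / ell T t) ^ n"
    using assms(2) unfolding tame_def by blast
  have "\<bar>f t x + g t x\<bar> \<le> (\<bar>C\<bar> + \<bar>D\<bar>) * (1 + 1 / ell T t) ^ (m + n)" if "t \<in> {0<..<T}" for t x
  proof -
    have "\<bar>f t x\<bar> \<le> \<bar>C\<bar> * (1 + 1 / ell T t) ^ (m + n)" by (rule tame_bound_raise[OF f _ that]) auto
    moreover have "\<bar>g t x\<bar> \<le> \<bar>D\<bar> * (1 + 1 / ell T t) ^ (m + n)" by (rule tame_bound_raise[OF g _ that]) auto
    ultimately show ?thesis by (simp add: algebra_simps)
  qed
  then have "\<exists>C m. \<forall>t\<in>{0<..<T}. \<forall>x. \<bar>f t x + g t x\<bar> \<le> C * (1 + 1 / ell T t) ^ m" by blast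
  then show ?thesis
    using assms unfolding tame_def by (simp add: continuous_on_add)
qed

lemma tame_mult [intro]:
  assumes "tame T f" "tame T g"
  shows "tame T (\<lambda>t x. f t x * g t x)"
proof -
  obtain C m where f: "\<And>t x. t \<in> {0<..<T} \<Longrightarrow> \<bar>f t x\<bar> \<le> C * (1 + 1 / ell T t) ^ m"
    using assms(1) unfolding tame_def by blast
  obtain D n where g: "\<And>t x. t \<in> {0<..<T} \<Longrightarrow> \<bar>g t x\<bar> \<le> D * (1 + 1 / ell T t) ^ n"
    using assms(2) unfolding tame_def by blast
  have "\<bar>f t x * g t x\<bar> \<le> (C * D) * (1 + 1 / ell T t) ^ (m + n)" if "t \<in> {0<..<T}" for t x
    using mult_mono'[OF f[OF that, of x] g[OF that, of x]] by (simp add: abs_mult power_add algebra_simps)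
  then have "\<exists>C m. \<forall>t\<in>{0<..<T}. \<forall>x. \<bar>f t x * g t x\<bar> \<le> C * (1 + 1 / ell T t) ^ m" by blast
  then show ?thesis
    using assms unfolding tame_def by (simp add: continuous_on_mult)
qed

lemma tame_uminus [intro]: "tame T f \<Longrightarrow> tame T (\<lambda>t x. - f t x)"
  using tame_mult[OF tame_const[of T "-1"], of f] by simp

lemma tame_diff [intro]: "tame T f \<Longrightarrow> tame T g \<Longrightarrow> tame T (\<lambda>t x. f t x - g t x)"
  using tame_add[of T f "\<lambda>t x. - g t x"] by auto

lemma tame_power [intro]: "tame T f \<Longrightarrow> tame T (\<lambda>t x. f t x ^ n)"
  by (induction n) auto

lemma tame_cong:
  assumes "tame T f" "\<And>t x. t \<in> {0<..<T} \<Longrightarrow> g t x = f t x"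
  shows "tame T g"
proof -
  have "continuous_on ({0<..<T} \<times> UNIV) (\<lambda>z. g (fst z) (snd z))
     \<longleftrightarrow> continuous_on ({0<..<T} \<times> UNIV) (\<lambda>z. f (fst z) (snd z))"
    by (rule continuous_on_cong) (auto simp: assms(2))
  then show ?thesis using assms unfolding tame_def by simp
qed

section \<open>Integration by parts against the weight\<close>

locale weighted_strip =
  fixes T :: real and kap ka kt :: "real \<Rightarrow> real \<Rightarrow> real" and c0 :: real
  assumes T: "0 < T"
    and kap_cont: "continuous_on ({0<..<T} \<times> UNIV) (\<lambda>z. kap (fst z) (snd z))"
    and kap_periodic: "\<And>t x. kap t (x + 2 * pi) = kap t x"
    and kap_decay: "0 < c0" "\<And>t x. t \<in> {0<..<T} \<Longrightarrow> kap t x \<le> - c0 / ell T t"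
    and kap_dx: "\<And>t x. t \<in> {0<..<T} \<Longrightarrow> (kap t has_real_derivative ka t x) (at x)"
    and kap_dt: "\<And>t x. t \<in> {0<..<T} \<Longrightarrow> ((\<lambda>r. kap r x) has_real_derivative kt t x) (at t)"
begin

definition wint :: "(real \<Rightarrow> real \<Rightarrow> real) \<Rightarrow> real" where
  "wint f = integral_cyl T UNIV (\<lambda>t x. exp (2 * kap t x) * f t x)"

abbreviation cell :: "(real \<times> real) set" where
  "cell \<equiv> {0<..<T} \<times> {0..<2 * pi}"

text \<open>The factor \<open>ell T t\<close>, stronger than mere boundedness, is what makes
  weighted fluxes vanish at t = 0 and t = T.\<close>

lemma weight_bound:
  assumes "tame T f"
  shows "\<exists>C. 0 \<le> C \<and> (\<forall>t\<in>{0<..<T}. \<forall>x. \<bar>exp (2 * kap t x) * f t x\<bar> \<le> C * ell T t)"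
proof -
  obtain C m where f: "\<And>t x. t \<in> {0<..<T} \<Longrightarrow> \<bar>f t x\<bar> \<le> C * (1 + 1 / ell T t) ^ m"
    using assms(1) unfolding tame_def by blast
  \<comment> \<open>One power more than the growth of \<open>f\<close>: since
    \<open>y * ell T t\<close> is at least 1, the extra power of \<open>y\<close> can be traded for
    the factor \<open>ell T t\<close>. The power \<open>y ^ n\<close> itself is dominated by a
    single term of the exponential series.\<close>
  define n where "n = Suc m"
  define D where "D = \<bar>C\<bar> * (exp (2 * c0) * (fact n / (2 * c0) ^ n))"
  have "0 \<le> D" unfolding D_def using kap_decay(1) by simp
  moreover have "\<bar>exp (2 * kap t x) * f t x\<bar> \<le> D * ell T t" if t: "t \<in> {0<..<T}" for t x
  proof -
    define y where "y = 1 + 1 / ell T t"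
    have l: "0 < ell T t" by (rule ell_pos[OF t])
    have y: "1 \<le> y" "1 \<le> y * ell T t" using l unfolding y_def by (auto simp: field_simps)
    have "(2 * c0 * y) ^ n / fact n \<le> exp (2 * c0 * y)"
    proof -
      have "(2 * c0 * y) ^ n / fact n = (\<Sum>i\<in>{n}. (2 * c0 * y) ^ i / fact i)" by simp
      also have "\<dots> \<le> (\<Sum>i. (2 * c0 * y) ^ i / fact i)"
        using kap_decay(1) y summable_exp[of "2 * c0 * y"]
        by (intro sum_le_suminf) (auto simp: field_simps)
      also have "\<dots> = exp (2 * c0 * y)" by (simp add: exp_def field_simps scaleR_conv_of_real)
      finally show ?thesis .
    qed
    then have yn: "y ^ n \<le> fact n / (2 * c0) ^ n * exp (2 * c0 * y)"
      using kap_decay(1) by (simp add: field_simps power_mult_distrib)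
    have "exp (2 * kap t x) \<le> exp (2 * c0 - 2 * c0 * y)"
    proof -
      have "2 * kap t x \<le> 2 * (- c0 / ell T t)" using kap_decay(2)[OF t, of x] by simp
      also have "\<dots> = 2 * c0 - 2 * c0 * y" unfolding y_def by (simp add: algebra_simps)
      finally show ?thesis by simp
    qed
    also have "\<dots> = exp (2 * c0) * exp (- (2 * c0 * y))" by (simp flip: exp_add)
    finally have e: "exp (2 * kap t x) \<le> exp (2 * c0) * exp (- (2 * c0 * y))" .
    have "\<bar>f t x\<bar> \<le> \<bar>C\<bar> * y ^ m" using f[OF t, of x] y unfolding y_def
      by (smt (verit) mult_right_mono zero_le_power abs_ge_self)
    also have "\<dots> \<le> \<bar>C\<bar> * (y ^ m * (y * ell T t))"
      using y by (intro mult_left_mono) (auto simp: mult_le_cancel_left1)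
    also have "\<dots> = \<bar>C\<bar> * ell T t * y ^ n" unfolding n_def by simp
    also have "\<dots> \<le> \<bar>C\<bar> * ell T t * (fact n / (2 * c0) ^ n * exp (2 * c0 * y))"
      using yn l by (intro mult_left_mono) auto
    finally have "exp (2 * kap t x) * \<bar>f t x\<bar> \<le>
      (exp (2 * c0) * exp (- (2 * c0 * y))) * (\<bar>C\<bar> * ell T t * (fact n / (2 * c0) ^ n * exp (2 * c0 * y)))"
      using e by (intro mult_mono) auto
    also have "\<dots> = D * ell T t * (exp (- (2 * c0 * y)) * exp (2 * c0 * y))"
      unfolding D_def by (simp add: ac_simps)
    also have "exp (- (2 * c0 * y)) * exp (2 * c0 * y) = 1" by (simp flip: exp_add)
    finally show ?thesis by (simp add: abs_mult)
  qed
  ultimately show ?thesis by blast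
qed

lemma integrable_indicator:
  assumes "tame T f" "A \<in> sets borel"
  shows "set_integrable lborel ({0<..<T} \<times> (A \<inter> {0..<2 * pi})) (\<lambda>(t, x). exp (2 * kap t x) * f t x)"
proof -
  let ?g = "\<lambda>z. exp (2 * kap (fst z) (snd z)) * f (fst z) (snd z)"
  let ?B = "{0<..<T} \<times> (A \<inter> {0..<2 * pi})"
  have B: "?B \<in> sets borel" using assms(2) by (intro borel_Times) auto
  obtain C where C: "0 \<le> C" "\<And>t x. t \<in> {0<..<T} \<Longrightarrow> \<bar>exp (2 * kap t x) * f t x\<bar> \<le> C * ell T t"
    using weight_bound[OF assms(1)] by blast
  have cont: "continuous_on ({0<..<T} \<times> UNIV) ?g"
    using kap_cont assms(1) unfolding tame_def by (auto intro!: continuous_intros)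
  \<comment> \<open>Continuity holds on the open strip only, so measurability is first shown there
    and then cut down to the set of integration.\<close>
  have "(\<lambda>z. indicator ({0<..<T} \<times> UNIV) z *\<^sub>R ?g z) \<in> borel_measurable borel"
    by (rule borel_measurable_continuous_on_indicator[OF _ cont]) (simp add: open_Times borel_open)
  then have "(\<lambda>z. indicator ?B z *\<^sub>R (indicator ({0<..<T} \<times> UNIV) z *\<^sub>R ?g z)) \<in> borel_measurable borel"
    by (rule borel_measurable_scaleR[OF borel_measurable_indicator[OF B]])
  also have "(\<lambda>z. indicator ?B z *\<^sub>R (indicator ({0<..<T} \<times> UNIV) z *\<^sub>R ?g z)) = (\<lambda>z. indicator ?B z *\<^sub>R ?g z)"
    by (auto simp: indicator_def)
  finally have meas: "(\<lambda>z. indicator ?B z *\<^sub>R ?g z) \<in> borel_measurable lborel" by simp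
  have "bounded (({0..T} \<times> {0..2 * pi}) :: (real \<times> real) set)" by (intro bounded_Times) auto
  then have "bounded ?B" by (rule bounded_subset) auto
  then have fin: "emeasure lborel ?B < \<infinity>" by (rule emeasure_bounded_finite)
  have ell: "ell T t \<le> T * T" if "t \<in> {0<..<T}" for t
    using that unfolding ell_def by (intro mult_mono) auto
  have "norm (indicator ?B z *\<^sub>R ?g z) \<le> C * (T * T)" if "z \<in> ?B" for z
    using that C(2)[of "fst z" "snd z"] mult_left_mono[OF ell[of "fst z"] C(1)] by (force simp: indicator_def abs_mult)
  then have "AE z in lborel. z \<in> ?B \<longrightarrow> norm (indicator ?B z *\<^sub>R ?g z) \<le> C * (T * T)" by blast
  moreover have "AE z in lborel. z \<notin> ?B \<longrightarrow> indicator ?B z *\<^sub>R ?g z = 0" by simp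
  moreover have "?B \<in> sets lborel" using B by simp
  ultimately have "integrable lborel (\<lambda>z. indicator ?B z *\<^sub>R ?g z)"
    using integrableI_bounded_set[OF _ meas fin] by blast
  then show ?thesis unfolding set_integrable_def case_prod_unfold .
qed

lemma wint_integrable: "tame T f \<Longrightarrow> set_integrable lborel cell (\<lambda>(t, x). exp (2 * kap t x) * f t x)"
  using integrable_indicator[of f UNIV] by simp

lemma wint_add: "tame T f \<Longrightarrow> tame T g \<Longrightarrow> wint (\<lambda>t x. f t x + g t x) = wint f + wint g"
  using set_integral_add(2)[OF wint_integrable[of f] wint_integrable[of g]]
  unfolding wint_def integral_cyl_def by (simp add: case_prod_unfold distrib_left)

lemma wint_cmult: "wint (\<lambda>t x. c * f t x) = c * wint f"
proof -
  have "wint (\<lambda>t x. c * f t x) = set_lebesgue_integral lborel cell (\<lambda>z. c * (case z of (t, x) \<Rightarrow> exp (2 * kap t x) * f t x))"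
    unfolding wint_def integral_cyl_def by (simp add: case_prod_unfold mult.left_commute)
  then show ?thesis unfolding wint_def integral_cyl_def by simp
qed

lemma wint_mono:
  assumes "tame T f" "tame T g" "\<And>t x. t \<in> {0<..<T} \<Longrightarrow> f t x \<le> g t x"
  shows "wint f \<le> wint g"
  unfolding wint_def integral_cyl_def
  using set_integral_mono[OF wint_integrable[OF assms(1)] wint_integrable[OF assms(2)]] assms(3)
  by (auto simp: mult_left_mono)

lemma wint_nonneg: "tame T f \<Longrightarrow> (\<And>t x. t \<in> {0<..<T} \<Longrightarrow> 0 \<le> f t x) \<Longrightarrow> 0 \<le> wint f"
  using wint_mono[of "\<lambda>t x. 0" f] wint_cmult[of 0 f] by auto

text \<open>By the hypothesis e^(2 \<kappa>) \<open>D\<close> is the x-derivative of e^(2 \<kappa>)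
  \<open>F\<close>, and periodicity cancels the values at 0 and 2 \<pi>.\<close>

lemma wint_dx:
  assumes "tame T F" "tame T D"
    and der: "\<And>t x. t \<in> {0<..<T} \<Longrightarrow> (F t has_real_derivative D t x - 2 * ka t x * F t x) (at x)"
  shows "wint D = 0"
proof -
  let ?g = "\<lambda>(t, x). exp (2 * kap t x) * D t x"
  have int: "integrable (lborel \<Otimes>\<^sub>M lborel) (\<lambda>z. indicator cell z *\<^sub>R ?g z)"
    using wint_integrable[OF assms(2)] unfolding set_integrable_def lborel_prod .
  have inner: "(\<integral>x. indicator cell (t, x) *\<^sub>R ?g (t, x) \<partial>lborel) = 0" for t
  proof (cases "t \<in> {0<..<T}")
    case True
    have d: "((\<lambda>x. exp (2 * kap t x) * F t x) has_real_derivative exp (2 * kap t x) * D t x) (at x)" for x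
      by (rule DERIV_cong, (rule derivative_eq_intros kap_dx der True refl)+) (simp add: algebra_simps)
    have c: "continuous_on {0..2 * pi} (\<lambda>x. exp (2 * kap t x) * D t x)"
    proof -
      have "continuous_on {0..2*pi} (\<lambda>x. D t x)"
        using assms(2) True unfolding tame_def
        by (intro continuous_on_compose2[of "{0<..<T} \<times> UNIV" "\<lambda>z. D (fst z) (snd z)" _ "\<lambda>x. (t, x)", simplified])
          (auto intro!: continuous_intros)
      moreover have "continuous_on {0..2*pi} (\<lambda>x. kap t x)"
        using kap_dx[OF True] by (intro continuous_at_imp_continuous_on ballI) (rule DERIV_isCont)
      ultimately show ?thesis by (intro continuous_intros)
    qed
    have "(\<integral>x. indicator cell (t, x) *\<^sub>R ?g (t, x) \<partial>lborel)
      = (\<integral>x. indicator {0..2 * pi} x *\<^sub>R (exp (2 * kap t x) * D t x) \<partial>lborel)"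
    proof (rule integral_cong_AE)
      show "AE x in lborel. indicator cell (t, x) *\<^sub>R ?g (t, x) = indicator {0..2 * pi} x *\<^sub>R (exp (2 * kap t x) * D t x)"
        using AE_lborel_singleton[of "2 * pi"] by eventually_elim (use True in \<open>auto simp: indicator_def\<close>)
      have m: "(\<lambda>x. indicator {0..2 * pi} x *\<^sub>R (exp (2 * kap t x) * D t x)) \<in> borel_measurable borel"
        by (rule borel_measurable_continuous_on_indicator[OF _ c]) simp
      then show "(\<lambda>x. indicator {0..2 * pi} x *\<^sub>R (exp (2 * kap t x) * D t x)) \<in> borel_measurable lborel" by simp
      have "(\<lambda>x. indicator {0..<2 * pi} x *\<^sub>R (indicator {0..2 * pi} x *\<^sub>R (exp (2 * kap t x) * D t x))) \<in> borel_measurable borel"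
        by (rule borel_measurable_scaleR[OF borel_measurable_indicator m]) simp
      also have "(\<lambda>x. indicator {0..<2 * pi} x *\<^sub>R (indicator {0..2 * pi} x *\<^sub>R (exp (2 * kap t x) * D t x)))
         = (\<lambda>x. indicator cell (t, x) *\<^sub>R ?g (t, x))"
        using True by (auto simp: indicator_def)
      finally show "(\<lambda>x. indicator cell (t, x) *\<^sub>R ?g (t, x)) \<in> borel_measurable lborel" by simp
    qed
    also have "\<dots> = exp (2 * kap t (2 * pi)) * F t (2 * pi) - exp (2 * kap t 0) * F t 0"
      using d by (intro integral_FTC_atLeastAtMost c)
        (auto simp: has_real_derivative_iff_has_vector_derivative intro: has_vector_derivative_at_within)
    also have "\<dots> = 0" using kap_periodic[of t 0] assms(1) True unfolding tame_def by (metis add_0 diff_self)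
    finally show ?thesis .
  next
    case False
    then have *: "indicator cell (t, x) *\<^sub>R ?g (t, x) = 0" for x by (auto simp: indicator_def)
    show ?thesis unfolding * by simp
  qed
  have "wint D = (\<integral>z. indicator cell z *\<^sub>R ?g z \<partial>(lborel \<Otimes>\<^sub>M lborel))"
    unfolding wint_def integral_cyl_def set_lebesgue_integral_def lborel_prod by simp
  also have "\<dots> = (\<integral>t. (\<integral>x. indicator cell (t, x) *\<^sub>R ?g (t, x) \<partial>lborel) \<partial>lborel)"
    using lborel_pair.integral_fst'[OF int] by simp
  also have "\<dots> = 0" unfolding inner by simp
  finally show ?thesis .
qed

text \<open>Unlike in x, the boundary values do not cancel but vanish, by
  \<open>weight_bound\<close>.\<close>

lemma wint_dt:
  assumes "tame T F" "tame T D"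
    and der: "\<And>t x. t \<in> {0<..<T} \<Longrightarrow> ((\<lambda>r. F r x) has_real_derivative D t x - 2 * kt t x * F t x) (at t)"
  shows "wint D = 0"
proof -
  let ?g = "\<lambda>(t, x). exp (2 * kap t x) * D t x"
  have int: "integrable (lborel \<Otimes>\<^sub>M lborel) (\<lambda>z. indicator cell z *\<^sub>R ?g z)"
    using wint_integrable[OF assms(2)] unfolding set_integrable_def lborel_prod .
  obtain C where C: "0 \<le> C" "\<And>t x. t \<in> {0<..<T} \<Longrightarrow> \<bar>exp (2 * kap t x) * F t x\<bar> \<le> C * ell T t"
    using weight_bound[OF assms(1)] by blast
  obtain C' where C': "0 \<le> C'" "\<And>t x. t \<in> {0<..<T} \<Longrightarrow> \<bar>exp (2 * kap t x) * D t x\<bar> \<le> C' * ell T t"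
    using weight_bound[OF assms(2)] by blast
  have inner: "(\<integral>t. indicator cell (t, x) *\<^sub>R ?g (t, x) \<partial>lborel) = 0" for x
  proof (cases "x \<in> {0..<2 * pi}")
    case True
    \<comment> \<open>Extended by zero, the weighted flux is continuous at the end points because it
      is dominated by a multiple of \<open>ell\<close>. The fundamental theorem then applies with
      derivatives in the interior.\<close>
    define G where "G t = (if t \<in> {0<..<T} then exp (2 * kap t x) * F t x else 0)" for t
    have d: "((\<lambda>t. exp (2 * kap t x) * F t x) has_real_derivative exp (2 * kap t x) * D t x) (at t)" if "t \<in> {0<..<T}" for t
      by (rule DERIV_cong, (rule derivative_eq_intros kap_dt der that refl)+) (simp add: algebra_simps)
    have dG: "(G has_real_derivative exp (2 * kap t x) * D t x) (at t)" if t: "t \<in> {0<..<T}" for t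
    proof -
      have "eventually (\<lambda>r. r \<in> {0<..<T}) (nhds t)" using t by (intro eventually_nhds_in_open) auto
      then have "eventually (\<lambda>r. exp (2 * kap r x) * F r x = G r) (nhds t)"
        by eventually_elim (simp add: G_def)
      then show ?thesis using d[OF t] DERIV_cong_ev[OF refl _ refl, of "\<lambda>r. exp (2 * kap r x) * F r x" G t] by blast
    qed
    have Gb: "\<bar>G t\<bar> \<le> C * \<bar>ell T t\<bar>" for t using C ell_pos[of t T] by (auto simp: G_def)
    have G0: "isCont G t" if "ell T t = 0" for t
    proof -
      have "((\<lambda>t. C * \<bar>ell T t\<bar>) \<longlongrightarrow> C * \<bar>ell T t\<bar>) (at t)"
        unfolding ell_def by (intro tendsto_intros)
      then have "(G \<longlongrightarrow> 0) (at t)"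
        using that by (intro Lim_null_comparison[where f = G and g = "\<lambda>t. C * \<bar>ell T t\<bar>"]) (auto intro!: Gb always_eventually)
      moreover have "G t = 0" using Gb[of t] that by simp
      ultimately show ?thesis by (simp add: isCont_def)
    qed
    have cont: "continuous_on {0..T} G"
    proof (intro continuous_at_imp_continuous_on ballI)
      fix t assume "t \<in> {0..T}"
      then have "t \<in> {0<..<T} \<or> ell T t = 0" by (auto simp: ell_def)
      then show "isCont G t" using G0 dG DERIV_isCont by blast
    qed
    have "((\<lambda>t. exp (2 * kap t x) * D t x) has_integral (G T - G 0)) {0..T}"
      using T dG by (intro fundamental_theorem_of_calculus_interior cont)
        (auto simp: has_real_derivative_iff_has_vector_derivative)
    then have hi: "((\<lambda>t. exp (2 * kap t x) * D t x) has_integral 0) {0<..<T}"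
      by (simp add: G_def has_integral_Icc_iff_Ioo)
    have "set_integrable lborel {0<..<T} (\<lambda>t. exp (2 * kap t x) * D t x)"
    proof -
      have "continuous_on {0<..<T} (\<lambda>t. D t x)"
        using assms(2) unfolding tame_def
        by (intro continuous_on_compose2[of "{0<..<T} \<times> UNIV" "\<lambda>z. D (fst z) (snd z)" _ "\<lambda>t. (t, x)", simplified])
          (auto intro!: continuous_intros)
      moreover have "continuous_on {0<..<T} (\<lambda>t. kap t x)"
        using kap_dt by (intro continuous_at_imp_continuous_on ballI) (rule DERIV_isCont)
      ultimately have "continuous_on {0<..<T} (\<lambda>t. exp (2 * kap t x) * D t x)" by (intro continuous_intros)
      then have "(\<lambda>t. indicator {0<..<T} t *\<^sub>R (exp (2 * kap t x) * D t x)) \<in> borel_measurable borel"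
        by (intro borel_measurable_continuous_on_indicator) auto
      moreover have "\<bar>exp (2 * kap t x) * D t x\<bar> \<le> C' * (T * T)" if "t \<in> {0<..<T}" for t
      proof -
        have "ell T t \<le> T * T" using that unfolding ell_def by (intro mult_mono) auto
        then show ?thesis using C'(2)[OF that, of x] mult_left_mono[of "ell T t" "T * T" C'] C'(1) by linarith
      qed
      ultimately show ?thesis unfolding set_integrable_def
        using T by (intro integrableI_bounded_set[of "{0<..<T}" lborel _ "C' * (T * T)"]) (auto simp: indicator_def)
    qed
    then have "(LINT t:{0<..<T}|lborel. exp (2 * kap t x) * D t x) = 0"
      using hi by (simp add: set_borel_integral_eq_integral integral_unique)
    then show ?thesis using True by (simp add: set_lebesgue_integral_def indicator_times)
  next
    case False
    then have *: "indicator cell (t, x) *\<^sub>R ?g (t, x) = 0" for t by (auto simp: indicator_def)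
    show ?thesis unfolding * by simp
  qed
  have "wint D = (\<integral>z. indicator cell z *\<^sub>R ?g z \<partial>(lborel \<Otimes>\<^sub>M lborel))"
    unfolding wint_def integral_cyl_def set_lebesgue_integral_def lborel_prod by simp
  also have "\<dots> = (\<integral>x. (\<integral>t. indicator cell (t, x) *\<^sub>R ?g (t, x) \<partial>lborel) \<partial>lborel)"
    using lborel_pair.integral_snd[of "\<lambda>t x. indicator cell (t, x) *\<^sub>R ?g (t, x)"] int by (simp add: case_prod_unfold)
  also have "\<dots> = 0" unfolding inner by simp
  finally show ?thesis .
qed

end

section \<open>Jets of the solution\<close>

declare Ck_on.simps(2) [simp del] Cm_C4.simps(2) [simp del]

lemma Ck_on_SucD:
  fixes f :: "real \<Rightarrow> real"
  assumes "Ck_on (Suc n) UNIV f"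
  shows "(f has_real_derivative deriv f x) (at x)" "Ck_on n UNIV (deriv f)"
proof -
  from assms obtain f' where 1: "\<forall>x\<in>UNIV. (f has_derivative f' x) (at x within UNIV)" and 2: "\<forall>h. Ck_on n UNIV (\<lambda>x. f' x h)"
    unfolding Ck_on.simps by (elim exE conjE) (rule that)
  have f': "(f has_derivative f' x) (at x)" "Ck_on n UNIV (\<lambda>x. f' x h)" for x h
    by (rule bspec[OF 1 UNIV_I], rule spec[OF 2])
  have der: "(f has_real_derivative f' x 1) (at x)" for x
  proof -
    interpret bounded_linear "f' x" using f'(1) by (rule has_derivative_bounded_linear)
    have "f' x = (*) (f' x 1)"
    proof
      fix y
      show "f' x y = f' x 1 * y" using scaleR[of y 1] by simp
    qed
    then show ?thesis using f'(1)[of x] unfolding has_field_derivative_def by simp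
  qed
  then have "deriv f = (\<lambda>x. f' x 1)" by (auto intro: DERIV_imp_deriv)
  then show "(f has_real_derivative deriv f x) (at x)" "Ck_on n UNIV (deriv f)"
    using der f'(2) by auto
qed

lemma Ck_on_deriv:
  fixes f :: "real \<Rightarrow> real"
  assumes "Ck_on n UNIV f" "i \<le> n"
  shows "Ck_on (n - i) UNIV ((deriv ^^ i) f)"
  using assms(2)
proof (induction i)
  case (Suc i)
  then have "Ck_on (Suc (n - Suc i)) UNIV ((deriv ^^ i) f)" by (simp add: Suc_diff_Suc)
  then show ?case using Ck_on_SucD(2) by simp
qed (use assms in simp)

lemma Ck_on_has_deriv:
  fixes f :: "real \<Rightarrow> real"
  assumes "Ck_on n UNIV f" "i < n"
  shows "((deriv ^^ i) f has_real_derivative (deriv ^^ Suc i) f x) (at x)"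
proof -
  have "Ck_on (Suc (n - Suc i)) UNIV ((deriv ^^ i) f)" using Ck_on_deriv[OF assms(1), of i] assms(2) by (simp add: Suc_diff_Suc)
  from Ck_on_SucD(1)[OF this] show ?thesis by simp
qed

lemma Ck_on_imp_continuous_on:
  fixes f :: "real \<Rightarrow> real"
  assumes "Ck_on n UNIV f"
  shows "continuous_on UNIV f"
proof (cases n)
  case (Suc m)
  then show ?thesis using Ck_on_SucD(1)[of m f] assms by (auto intro!: DERIV_isCont continuous_at_imp_continuous_on)
qed (use assms in simp)

lemma Ck_on_continuous:
  fixes f :: "real \<Rightarrow> real"
  assumes "Ck_on n UNIV f" "i \<le> n"
  shows "continuous_on UNIV ((deriv ^^ i) f)"
  using Ck_on_imp_continuous_on[OF Ck_on_deriv[OF assms]] .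

section \<open>Periodicity and the norm of C4\<close>

lemma deriv_periodic:
  fixes f :: "real \<Rightarrow> real"
  assumes "\<And>x. f (x + p) = f x"
  shows "deriv f (x + p) = deriv f x"
proof -
  have "(f has_real_derivative D) (at (x + p)) \<longleftrightarrow> (f has_real_derivative D) (at x)" for D
    unfolding DERIV_shift assms ..
  then show ?thesis by (simp add: deriv_def)
qed

lemma deriv_funpow_periodic:
  fixes f :: "real \<Rightarrow> real"
  assumes "\<And>x. f (x + p) = f x"
  shows "(deriv ^^ i) f (x + p) = (deriv ^^ i) f x"
proof (induction i arbitrary: x)
  case (Suc i)
  then show ?case using deriv_periodic[of "(deriv ^^ i) f" p x] by simp
qed (use assms in simp)

lemma periodic_representative:
  fixes f :: "real \<Rightarrow> 'a"
  assumes "\<And>x. f (x + 2 * pi) = f x"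
  obtains y where "y \<in> {0..<2 * pi}" "f x = f y" "\<exists>n. y = x + of_int n * (2 * pi)"
proof -
  interpret periodic_fun_simple f "2 * pi" by standard (rule assms)
  define n where "n = \<lfloor>x / (2 * pi)\<rfloor>"
  have "of_int n \<le> x / (2 * pi)" "x / (2 * pi) < of_int n + 1" unfolding n_def by linarith+
  then have "x - of_int n * (2 * pi) \<in> {0..<2 * pi}" by (simp add: field_simps)
  moreover have "f x = f (x - of_int n * (2 * pi))" by (simp add: minus_of_int)
  moreover have "\<exists>m. x - of_int n * (2 * pi) = x + of_int m * (2 * pi)" by (intro exI[of _ "-n"]) simp
  ultimately show ?thesis by (rule that)
qed

lemma periodic_continuous_bounded:
  fixes f :: "real \<Rightarrow> real"
  assumes "\<And>x. f (x + 2 * pi) = f x" "continuous_on UNIV f"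
  shows "\<exists>B. \<forall>x. \<bar>f x\<bar> \<le> B"
proof -
  have "compact (f ` {0..2 * pi})"
    by (intro compact_continuous_image continuous_on_subset[OF assms(2)]) auto
  then obtain B where B: "\<And>x. x \<in> {0..2 * pi} \<Longrightarrow> \<bar>f x\<bar> \<le> B"
    using compact_imp_bounded bounded_iff by (metis imageI real_norm_def)
  have "\<bar>f x\<bar> \<le> B" for x
  proof -
    obtain y where "y \<in> {0..<2 * pi}" "f x = f y" using periodic_representative[of f x] assms(1) by blast
    then show ?thesis using B[of y] by simp
  qed
  then show ?thesis by blast
qed

lemma C4_torus_periodic: "C4_torus f \<Longrightarrow> (deriv ^^ i) f (x + 2 * pi) = (deriv ^^ i) f x"
  unfolding C4_torus_def by (intro deriv_funpow_periodic) (simp add: periodic_fun_simple_def)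

lemma C4_torus_deriv: "C4_torus f \<Longrightarrow> i < 4 \<Longrightarrow> ((deriv ^^ i) f has_real_derivative (deriv ^^ Suc i) f x) (at x)"
  unfolding C4_torus_def using Ck_on_has_deriv[of 4 f i x] by blast

lemma C4_torus_continuous: "C4_torus f \<Longrightarrow> i \<le> 4 \<Longrightarrow> continuous_on UNIV ((deriv ^^ i) f)"
  unfolding C4_torus_def using Ck_on_continuous[of 4 f i] by blast

lemma C4_torus_bounded: "C4_torus f \<Longrightarrow> i \<le> 4 \<Longrightarrow> \<exists>B. \<forall>x. \<bar>(deriv ^^ i) f x\<bar> \<le> B"
  by (rule periodic_continuous_bounded[OF C4_torus_periodic C4_torus_continuous])

lemma deriv_funpow_lincomb:
  fixes f g h :: "real \<Rightarrow> real"
  assumes "C4_torus f" "C4_torus g" "C4_torus h" "i \<le> 4"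
  shows "(deriv ^^ i) (\<lambda>x. a * f x + b * g x + c * h x)
    = (\<lambda>x. a * (deriv ^^ i) f x + b * (deriv ^^ i) g x + c * (deriv ^^ i) h x)"
  using assms(4)
proof (induction i)
  case (Suc i)
  have "((\<lambda>x. a * (deriv ^^ i) f x + b * (deriv ^^ i) g x + c * (deriv ^^ i) h x) has_real_derivative
     a * (deriv ^^ Suc i) f x + b * (deriv ^^ Suc i) g x + c * (deriv ^^ Suc i) h x) (at x)" for x
    using C4_torus_deriv[OF assms(1), of i x] C4_torus_deriv[OF assms(2), of i x] C4_torus_deriv[OF assms(3), of i x] Suc(2)
    by (intro DERIV_add DERIV_cmult) auto
  then show ?case using Suc by (auto intro!: DERIV_imp_deriv)
qed simp

text \<open>A real supremum dominates its family only when the family is bounded above, which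
  compactness of the torus supplies. Three functions with free coefficients cover both a difference
  and a difference quotient minus its limit.\<close>

lemma C4_norm_lincomb_bound:
  fixes f g h :: "real \<Rightarrow> real"
  assumes "C4_torus f" "C4_torus g" "C4_torus h" "i \<le> 4"
  shows "\<bar>a * (deriv ^^ i) f x + b * (deriv ^^ i) g x + c * (deriv ^^ i) h x\<bar> \<le> C4_norm (\<lambda>x. a * f x + b * g x + c * h x)"
proof -
  let ?u = "\<lambda>x. a * f x + b * g x + c * h x"
  have bdd: "bdd_above (range (\<lambda>x. \<bar>(deriv ^^ j) ?u x\<bar>))" if j: "j \<le> 4" for j
  proof -
    obtain A B C where "\<And>x. \<bar>(deriv ^^ j) f x\<bar> \<le> A" "\<And>x. \<bar>(deriv ^^ j) g x\<bar> \<le> B" "\<And>x. \<bar>(deriv ^^ j) h x\<bar> \<le> C"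
      using C4_torus_bounded[OF assms(1) j] C4_torus_bounded[OF assms(2) j] C4_torus_bounded[OF assms(3) j] by blast
    then have "\<bar>(deriv ^^ j) ?u x\<bar> \<le> \<bar>a\<bar> * A + \<bar>b\<bar> * B + \<bar>c\<bar> * C" for x
      unfolding deriv_funpow_lincomb[OF assms(1-3) j]
      by (intro bound_add bound_mult order_refl)
    then show ?thesis by (rule bdd_aboveI2)
  qed
  have le: "\<bar>(deriv ^^ j) ?u x\<bar> \<le> (SUP x. \<bar>(deriv ^^ j) ?u x\<bar>)" if "j \<le> 4" for j x
    by (rule cSUP_upper[OF UNIV_I bdd[OF that]])
  have "\<bar>(deriv ^^ i) ?u x\<bar> \<le> (SUP x. \<bar>(deriv ^^ i) ?u x\<bar>)" using le assms(4) by blast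
  also have "\<dots> \<le> (\<Sum>j\<le>4. SUP x. \<bar>(deriv ^^ j) ?u x\<bar>)"
    using le assms(4) by (intro member_le_sum) (auto intro: order_trans[OF abs_ge_zero])
  finally show ?thesis unfolding C4_norm_def deriv_funpow_lincomb[OF assms] .
qed

lemma Cm_C4_torus: "Cm_C4 m T eta \<Longrightarrow> t \<in> {0..T} \<Longrightarrow> C4_torus (eta t)"
  by (cases m) (auto simp: Cm_C4.simps(2))

text \<open>Convergence in the norm of C4 gives convergence of all x-derivatives up to order four;
  this is the source of the commutation of \<partial>t with \<partial>x.\<close>

lemma Cm_C4_has_deriv:
  assumes "Cm_C4 m T eta'" and C4: "\<And>t. t \<in> {0..T} \<Longrightarrow> C4_torus (eta t)"
    and lim: "((\<lambda>r. C4_norm (\<lambda>x. (eta r x - eta t x) / (r - t) - eta' t x)) \<longlongrightarrow> 0) (at t within {0..T})"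
    and t: "t \<in> {0..T}" and j: "j \<le> 4"
  shows "((\<lambda>r. (deriv ^^ j) (eta r) x) has_real_derivative (deriv ^^ j) (eta' t) x) (at t within {0..T})"
proof -
  have C4': "C4_torus (eta' t)" using Cm_C4_torus[OF assms(1) t] .
  have "\<bar>((deriv ^^ j) (eta r) x - (deriv ^^ j) (eta t) x) / (r - t) - (deriv ^^ j) (eta' t) x\<bar>
     \<le> C4_norm (\<lambda>x. (eta r x - eta t x) / (r - t) - eta' t x)" if r: "r \<in> {0..T}" for r
    using C4_norm_lincomb_bound[OF C4[OF r] C4[OF t] C4' j, of "1 / (r - t)" x "- 1 / (r - t)" "-1"]
    by (simp add: diff_divide_distrib)
  then have "((\<lambda>r. ((deriv ^^ j) (eta r) x - (deriv ^^ j) (eta t) x) / (r - t) - (deriv ^^ j) (eta' t) x) \<longlongrightarrow> 0) (at t within {0..T})"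
    by (intro Lim_null_comparison[OF _ lim]) (auto simp: eventually_at_filter)
  then show ?thesis
    unfolding has_field_derivative_iff using LIM_zero_iff by blast
qed

text \<open>The successor clause of \<open>Cm_C4\<close> mentions only difference quotients, so
  continuity is recovered from them: multiplied by the distance of \<open>r\<close> and
  \<open>t\<close>, a bounded quotient tends to zero.\<close>

lemma Cm_C4_uniform:
  assumes "Cm_C4 m T eta" and t: "t \<in> {0..T}" and j: "j \<le> 4"
  shows "\<exists>q. (q \<longlongrightarrow> 0) (at t within {0..T}) \<and>
    (\<forall>r\<in>{0..T}. r \<noteq> t \<longrightarrow> (\<forall>x. \<bar>(deriv ^^ j) (eta r) x - (deriv ^^ j) (eta t) x\<bar> \<le> q r))"
proof -
  have C4: "\<And>t. t \<in> {0..T} \<Longrightarrow> C4_torus (eta t)" using Cm_C4_torus[OF assms(1)] .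
  show ?thesis
  proof (cases m)
    case 0
    let ?q = "\<lambda>r. C4_norm (\<lambda>x. eta r x - eta t x)"
    have "(?q \<longlongrightarrow> 0) (at t within {0..T})" using assms(1) t unfolding 0 by simp
    moreover have "\<bar>(deriv ^^ j) (eta r) x - (deriv ^^ j) (eta t) x\<bar> \<le> ?q r" if "r \<in> {0..T}" for r x
      using C4_norm_lincomb_bound[OF C4[OF that] C4[OF t] C4[OF t] j, of 1 x "-1" 0] by simp
    ultimately show ?thesis by (intro exI[of _ ?q]) blast
  next
    case (Suc m')
    from assms(1)[unfolded Suc Cm_C4.simps(2)] obtain eta' where eta': "Cm_C4 m' T eta'"
      "((\<lambda>r. C4_norm (\<lambda>x. (eta r x - eta t x) / (r - t) - eta' t x)) \<longlongrightarrow> 0) (at t within {0..T})"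
      using t by blast
    have C4': "C4_torus (eta' t)" using Cm_C4_torus[OF eta'(1) t] .
    obtain B where B: "\<And>x. \<bar>(deriv ^^ j) (eta' t) x\<bar> \<le> B" using C4_torus_bounded[OF C4' j] by blast
    let ?p = "\<lambda>r. C4_norm (\<lambda>x. (eta r x - eta t x) / (r - t) - eta' t x)"
    let ?q = "\<lambda>r. \<bar>r - t\<bar> * (?p r + B)"
    have "(?q \<longlongrightarrow> \<bar>t - t\<bar> * (0 + B)) (at t within {0..T})"
      by (intro tendsto_intros eta'(2))
    moreover have "\<bar>(deriv ^^ j) (eta r) x - (deriv ^^ j) (eta t) x\<bar> \<le> ?q r" if r: "r \<in> {0..T}" "r \<noteq> t" for r x
    proof -
      have "\<bar>((deriv ^^ j) (eta r) x - (deriv ^^ j) (eta t) x) / (r - t) - (deriv ^^ j) (eta' t) x\<bar> \<le> ?p r"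
        using C4_norm_lincomb_bound[OF C4[OF r(1)] C4[OF t] C4' j, of "1 / (r - t)" x "- 1 / (r - t)" "-1"]
        by (simp add: diff_divide_distrib)
      then have "\<bar>((deriv ^^ j) (eta r) x - (deriv ^^ j) (eta t) x) / (r - t)\<bar> \<le> ?p r + B"
        using B[of x] by linarith
      then have "\<bar>r - t\<bar> * \<bar>((deriv ^^ j) (eta r) x - (deriv ^^ j) (eta t) x) / (r - t)\<bar> \<le> ?q r"
        by (rule mult_left_mono) simp
      then show ?thesis using r(2) by (simp add: abs_divide)
    qed
    ultimately show ?thesis by (intro exI[of _ ?q]) auto
  qed
qed

text \<open>Continuity in t that is uniform in x combines with continuity in x at one fixed
  time.\<close>

lemma Cm_C4_continuous:
  assumes "Cm_C4 m T eta" and j: "j \<le> 4"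
  shows "continuous_on ({0..T} \<times> UNIV) (\<lambda>z. (deriv ^^ j) (eta (fst z)) (snd z))"
  unfolding continuous_on_iff
proof (intro ballI allI impI)
  fix z :: "real \<times> real" and e :: real assume z: "z \<in> {0..T} \<times> UNIV" and e: "0 < e"
  obtain t x where tx: "z = (t, x)" by fastforce
  have t: "t \<in> {0..T}" using z tx by auto
  obtain q where q: "(q \<longlongrightarrow> 0) (at t within {0..T})"
    "\<And>r x. r \<in> {0..T} \<Longrightarrow> r \<noteq> t \<Longrightarrow> \<bar>(deriv ^^ j) (eta r) x - (deriv ^^ j) (eta t) x\<bar> \<le> q r"
    using Cm_C4_uniform[OF assms(1) t j] by blast
  obtain d1 where d1: "0 < d1" "\<And>r. r \<in> {0..T} \<Longrightarrow> r \<noteq> t \<Longrightarrow> dist r t < d1 \<Longrightarrow> q r < e / 2"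
    using order_tendstoD(2)[OF q(1), of "e / 2"] e unfolding eventually_at by auto
  have "continuous_on UNIV ((deriv ^^ j) (eta t))" using C4_torus_continuous[OF Cm_C4_torus[OF assms(1) t] j] .
  then obtain d2 where d2: "0 < d2" "\<And>y. dist y x < d2 \<Longrightarrow> dist ((deriv ^^ j) (eta t) y) ((deriv ^^ j) (eta t) x) < e / 2"
    unfolding continuous_on_iff using e by (metis UNIV_I half_gt_zero)
  show "\<exists>d>0. \<forall>z'\<in>{0..T} \<times> UNIV. dist z' z < d \<longrightarrow>
     dist ((deriv ^^ j) (eta (fst z')) (snd z')) ((deriv ^^ j) (eta (fst z)) (snd z)) < e"
  proof (intro exI[of _ "min d1 d2"] conjI ballI impI)
    fix z' :: "real \<times> real" assume z': "z' \<in> {0..T} \<times> UNIV" "dist z' z < min d1 d2"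
    obtain r y where ry: "z' = (r, y)" by fastforce
    have r: "r \<in> {0..T}" "dist r t < d1" "dist y x < d2"
      using z' dist_fst_le[of z' z] dist_snd_le[of z' z] unfolding ry tx by auto
    have "\<bar>(deriv ^^ j) (eta r) y - (deriv ^^ j) (eta t) y\<bar> < e / 2"
      using q(2)[OF r(1), of y] d1(2)[OF r(1) _ r(2)] e by (cases "r = t") force+
    then show "dist ((deriv ^^ j) (eta (fst z')) (snd z')) ((deriv ^^ j) (eta (fst z)) (snd z)) < e"
      using d2(2)[OF r(3)] unfolding ry tx dist_real_def by (simp, linarith)
  qed (use d1 d2 in auto)
qed

lemma Cm_C4_tame:
  assumes "Cm_C4 m T eta" and j: "j \<le> 4"
  shows "tame T (\<lambda>t. (deriv ^^ j) (eta t))"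
proof -
  let ?F = "\<lambda>z. (deriv ^^ j) (eta (fst z)) (snd z)"
  have c: "continuous_on ({0..T} \<times> UNIV) ?F" by (rule Cm_C4_continuous[OF assms])
  have per: "(deriv ^^ j) (eta t) (x + 2 * pi) = (deriv ^^ j) (eta t) x" if "t \<in> {0..T}" for t x
    by (rule C4_torus_periodic[OF Cm_C4_torus[OF assms(1) that]])
  have "compact (?F ` ({0..T} \<times> {0..2 * pi}))"
    by (intro compact_continuous_image continuous_on_subset[OF c] compact_Times) auto
  then have "bounded (?F ` ({0..T} \<times> {0..2 * pi}))" by (rule compact_imp_bounded)
  then obtain B where "\<forall>y\<in>?F ` ({0..T} \<times> {0..2 * pi}). norm y \<le> B" unfolding bounded_iff by blast
  then have B: "\<bar>(deriv ^^ j) (eta t) x\<bar> \<le> B" if "t \<in> {0..T}" "x \<in> {0..2 * pi}" for t x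
    using that by (auto dest!: bspec[of _ _ "?F (t, x)"])
  have "\<bar>(deriv ^^ j) (eta t) x\<bar> \<le> B" if t: "t \<in> {0..T}" for t x
  proof -
    obtain y where "y \<in> {0..<2 * pi}" "(deriv ^^ j) (eta t) x = (deriv ^^ j) (eta t) y"
      using periodic_representative[of "(deriv ^^ j) (eta t)" x] per[OF t] by blast
    then show ?thesis using B[OF t, of y] by simp
  qed
  then have "\<exists>C m. \<forall>t\<in>{0<..<T}. \<forall>x. \<bar>(deriv ^^ j) (eta t) x\<bar> \<le> C * (1 + 1 / ell T t) ^ m"
    by (intro exI[of _ B] exI[of _ "0::nat"]) auto
  moreover have "continuous_on ({0<..<T} \<times> UNIV) ?F" by (rule continuous_on_subset[OF c]) auto
  ultimately show ?thesis using per unfolding tame_def by auto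
qed

text \<open>The time derivatives are taken from the witnesses inside \<open>Cm_C4\<close>, which are
  regular up to t = 0 and t = T; this bounds every jet. In the open interval the one-sided limits
  become genuine derivatives.\<close>

lemma Cm_C4_jets:
  assumes "Cm_C4 2 T eta"
  obtains N :: "nat \<Rightarrow> nat \<Rightarrow> real \<Rightarrow> real \<Rightarrow> real" where
    "\<And>j t x. N 0 j t x = (deriv ^^ j) (eta t) x"
    "\<And>i j t x. N i j t x = (deriv ^^ j) (N i 0 t) x"
    "\<And>i j t x. i \<le> 2 \<Longrightarrow> j < 4 \<Longrightarrow> t \<in> {0..T} \<Longrightarrow> (N i j t has_real_derivative N i (Suc j) t x) (at x)"
    "\<And>i j t x. i < 2 \<Longrightarrow> j \<le> 4 \<Longrightarrow> t \<in> {0<..<T} \<Longrightarrow> ((\<lambda>r. N i j r x) has_real_derivative N (Suc i) j t x) (at t)"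
    "\<And>i j. i \<le> 2 \<Longrightarrow> j \<le> 4 \<Longrightarrow> tame T (N i j)"
proof -
  have "Cm_C4 (Suc (Suc 0)) T eta" using assms by (simp add: numeral_2_eq_2)
  then obtain e1 where e1: "Cm_C4 (Suc 0) T e1"
    "\<And>t. t \<in> {0..T} \<Longrightarrow> ((\<lambda>r. C4_norm (\<lambda>x. (eta r x - eta t x) / (r - t) - e1 t x)) \<longlongrightarrow> 0) (at t within {0..T})"
    unfolding Cm_C4.simps(2)[of "Suc 0"] by blast
  then obtain e2 where e2: "Cm_C4 0 T e2"
    "\<And>t. t \<in> {0..T} \<Longrightarrow> ((\<lambda>r. C4_norm (\<lambda>x. (e1 r x - e1 t x) / (r - t) - e2 t x)) \<longlongrightarrow> 0) (at t within {0..T})"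
    unfolding Cm_C4.simps(2)[of 0] by blast
  define E where "E i = (if i = 0 then eta else if i = 1 then e1 else e2)" for i :: nat
  have C: "Cm_C4 (2 - i) T (E i)" if "i \<le> 2" for i
    using that assms e1(1) e2(1) by (cases "i = 0"; cases "i = 1") (auto simp: E_def)
  have L: "((\<lambda>r. C4_norm (\<lambda>x. (E i r x - E i t x) / (r - t) - E (Suc i) t x)) \<longlongrightarrow> 0) (at t within {0..T})"
    if "i < 2" "t \<in> {0..T}" for i t
    using that e1(2) e2(2) by (cases "i = 0") (auto simp: E_def)
  show ?thesis
  proof (rule that[of "\<lambda>i j t. (deriv ^^ j) (E i t)"])
    fix i j t x assume "i \<le> (2::nat)" "j < (4::nat)" "t \<in> {0..T}"
    then show "((deriv ^^ j) (E i t) has_real_derivative (deriv ^^ Suc j) (E i t) x) (at x)"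
      using C4_torus_deriv Cm_C4_torus[OF C] by blast
  next
    fix i j t x assume i: "i < (2::nat)" and j: "j \<le> (4::nat)" and t: "t \<in> {0<..<T}"
    have "((\<lambda>r. (deriv ^^ j) (E i r) x) has_real_derivative (deriv ^^ j) (E (Suc i) t) x) (at t within {0..T})"
      using i t by (intro Cm_C4_has_deriv[OF C _ L _ j] Cm_C4_torus[OF C[of i]]) auto
    moreover have "at t within {0..T} = at t" using t by (intro at_within_Icc_at) auto
    ultimately show "((\<lambda>r. (deriv ^^ j) (E i r) x) has_real_derivative (deriv ^^ j) (E (Suc i) t) x) (at t)" by simp
  next
    fix i j assume "i \<le> (2::nat)" "j \<le> (4::nat)"
    then show "tame T (\<lambda>t. (deriv ^^ j) (E i t))" using Cm_C4_tame C by blast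
  qed (simp_all add: E_def)
qed

lemma deriv_cong_open:
  fixes f g :: "real \<Rightarrow> real"
  assumes "open S" "t \<in> S" "\<And>r. r \<in> S \<Longrightarrow> f r = g r"
  shows "deriv f t = deriv g t"
  using assms by (intro deriv_cong_ev) (auto simp: eventually_nhds)

text \<open>\<open>dt\<close> differentiates on the whole line, where \<eta> is arbitrary off [0,T];
  at interior times only nearby values matter. For the second time derivative the first ones must
  agree on a neighbourhood.\<close>

lemma jets_dt_dx:
  assumes "\<And>j t x. N 0 j t x = (deriv ^^ j) (eta t) x"
    and "\<And>i j t x. N i j t x = (deriv ^^ j) (N i 0 t) x"
    and d: "\<And>i j t x. i < (2::nat) \<Longrightarrow> j \<le> (4::nat) \<Longrightarrow> t \<in> {0<..<T} \<Longrightarrow> ((\<lambda>r. N i j r x) has_real_derivative N (Suc i) j t x) (at t)"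
    and t: "t \<in> {0<..<T}"
  shows "dx j eta t x = N 0 j t x" "dt 1 eta t x = N 1 0 t x" "dt 1 (dx 1 eta) t x = N 1 1 t x"
    "dt 2 eta t x = N 2 0 t x" "dx 2 (dt 1 eta) t x = N 1 2 t x" "eta t x = N 0 0 t x"
proof -
  show "dx j eta t x = N 0 j t x" by (simp add: dx_def assms(1))
  show e: "eta t x = N 0 0 t x" by (simp add: assms(1))
  have dt1: "dt 1 eta t x = N 1 0 t x" if "t \<in> {0<..<T}" for t x
    using d[of 0 0 t x] that by (auto simp: dt_def assms(1) intro!: DERIV_imp_deriv)
  then show "dt 1 eta t x = N 1 0 t x" using t .
  show "dt 1 (dx 1 eta) t x = N 1 1 t x"
    using d[of 0 1 t x] t by (auto simp: dt_def dx_def assms(1) intro!: DERIV_imp_deriv)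
  have "dt 2 eta t x = deriv (\<lambda>r. dt 1 eta r x) t" by (simp add: dt_def numeral_2_eq_2)
  also have "\<dots> = deriv (\<lambda>r. N 1 0 r x) t"
    using dt1 t by (intro deriv_cong_open[of "{0<..<T}"]) auto
  also have "\<dots> = N 2 0 t x" using d[of 1 0 t x] t by (auto simp: numeral_2_eq_2 intro!: DERIV_imp_deriv)
  finally show "dt 2 eta t x = N 2 0 t x" .
  have "dt 1 eta t = N 1 0 t" using dt1 t by auto
  then show "dx 2 (dt 1 eta) t x = N 1 2 t x" by (simp only: dx_def assms(2)[of 1 2 t x])
qed

section \<open>The Carleman weights\<close>

lemma tame_space:
  assumes "continuous_on UNIV f" "\<And>x. f (x + 2 * pi) = f x" "\<And>x. \<bar>f x\<bar> \<le> B"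
  shows "tame T (\<lambda>t x. f x)"
proof -
  have "continuous_on ({0<..<T} \<times> UNIV) (\<lambda>z :: real \<times> real. f (snd z))"
    by (rule continuous_on_compose2[OF assms(1)]) (auto intro: continuous_intros)
  moreover have "\<exists>C m. \<forall>t\<in>{0<..<T}. \<forall>x. \<bar>f x\<bar> \<le> C * (1 + 1 / ell T t) ^ m"
    by (intro exI[of _ B] exI[of _ "0::nat"]) (simp add: assms(3))
  ultimately show ?thesis using assms(2) unfolding tame_def by blast
qed

lemma tame_time:
  assumes "continuous_on {0<..<T} f" "\<And>t. t \<in> {0<..<T} \<Longrightarrow> \<bar>f t\<bar> \<le> C * (1 + 1 / ell T t) ^ m"
  shows "tame T (\<lambda>t x. f t)"
proof -
  have "continuous_on ({0<..<T} \<times> UNIV) (\<lambda>z :: real \<times> real. f (fst z))"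
    by (rule continuous_on_compose2[OF assms(1)]) (auto intro: continuous_intros)
  moreover have "\<exists>C m. \<forall>t\<in>{0<..<T}. \<forall>x::real. \<bar>f t\<bar> \<le> C * (1 + 1 / ell T t) ^ m"
    using assms(2) by blast
  ultimately show ?thesis unfolding tame_def by blast
qed

lemma ell_le: "t \<in> {0<..<T} \<Longrightarrow> ell T t \<le> T^2 / 4"
proof -
  have "T^2 / 4 - ell T t = (T / 2 - t)^2" unfolding ell_def by (simp add: field_simps power2_eq_square)
  then show "ell T t \<le> T^2 / 4" using zero_le_power2[of "T / 2 - t"] by linarith
qed

locale beam_weight =
  fixes psi p q r v :: "real \<Rightarrow> real" and M0 k Psi mu lam T s :: real
  assumes psi_deriv: "\<And>x. (psi has_real_derivative p x) (at x)" "\<And>x. (p has_real_derivative q x) (at x)"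
      "\<And>x. (q has_real_derivative r x) (at x)" "\<And>x. (r has_real_derivative v x) (at x)"
    and v_cont: "continuous_on UNIV v"
    and psi_periodic: "\<And>x. psi (x + 2 * pi) = psi x" "\<And>x. p (x + 2 * pi) = p x" "\<And>x. q (x + 2 * pi) = q x"
      "\<And>x. r (x + 2 * pi) = r x" "\<And>x. v (x + 2 * pi) = v x"
    and psi_bound: "\<And>x. \<bar>p x\<bar> \<le> M0" "\<And>x. \<bar>q x\<bar> \<le> M0" "\<And>x. \<bar>r x\<bar> \<le> M0" "\<And>x. \<bar>v x\<bar> \<le> M0" "1 \<le> M0"
    and psi_pos: "\<And>x. 0 < psi x" and psi_le: "\<And>x. psi x \<le> Psi"
    and k: "2 \<le> k" and mu: "1 \<le> mu" and lam: "mu \<le> lam" and T_pos: "0 < T" and s_pos: "0 < s"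
begin

text \<open>
  \<open>wa, wb, wb1, wb2, wh, wth, wd\<close> are the quantities \<open>a, b, b1, b2, h, th, d\<close> of the conjugated operator for the exponent
  \<open>kap\<close>, and \<open>we = \<kappa>\<^sub>t\<^sub>t / \<kappa>\<close>.  The parameter \<open>eps = 1 / sig\<close> measures the lower order terms.
\<close>

definition sig where "sig t x = s * xi0 k Psi psi T lam mu t x"
definition kap where "kap t x = s * phi0 k Psi psi T lam mu t x"
definition rho where "rho t x = mu * sig t x"
definition eps where "eps t x = 1 / sig t x"
definition wa where "wa t x = mu * p x * sig t x"
definition wb where "wb t x = (mu^2 * p x^2 + mu * q x) * sig t x"
definition wb1 where "wb1 t x = (mu^3 * p x^3 + 3 * mu^2 * p x * q x + mu * r x) * sig t x"
definition wb2 where "wb2 t x = (mu^4 * p x^4 + 6 * mu^3 * p x^2 * q x + mu^2 * (3 * q x^2 + 4 * p x * r x) + mu * v x) * sig t x"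
definition wh where "wh t = - (k / 2) * (T - 2 * t) / ell T t"
definition we where "we t = (k / 2) * (2 * ell T t + (T - 2 * t)^2) / (ell T t)^2 + (wh t)^2"
definition wth where "wth t x = wh t * kap t x"
definition wd where "wd t x = we t * kap t x"
definition E where "E x = exp (mu * psi x + 8 * lam * Psi)"

lemma Psi_pos: "0 < Psi" using psi_pos[of 0] psi_le[of 0] by simp

lemma lam_Psi: "0 < lam * Psi" "0 < Psi * lam" using Psi_pos mu lam by simp_all

text \<open>\<mu> \<psi> lies between 0 and \<lambda> \<Psi>, so the exponent of \<open>E\<close> is
  between 8 and 9 times \<lambda> \<Psi>. The gap up to 10 makes \<phi> strictly negative.\<close>

lemma E_bounds: "exp (8 * lam * Psi) \<le> E x" "E x \<le> exp (9 * lam * Psi)" "0 < E x" "1 \<le> E x"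
    "E x \<le> exp (10 * lam * Psi)"
proof -
  have "mu * psi x \<le> lam * Psi" using mu lam psi_pos[of x] psi_le[of x] by (intro mult_mono) auto
  moreover have "0 \<le> mu * psi x" using mu psi_pos[of x] by simp
  ultimately show "exp (8 * lam * Psi) \<le> E x" "E x \<le> exp (9 * lam * Psi)" "0 < E x" "1 \<le> E x"
    "E x \<le> exp (10 * lam * Psi)"
    using lam_Psi unfolding E_def by (auto simp: algebra_simps)
qed

lemma sig_eq: "sig t x = s * E x * (1 / ell T t powr (k / 2))"
  and kap_eq: "kap t x = s * (E x - exp (10 * lam * Psi)) * (1 / ell T t powr (k / 2))"
  unfolding sig_def kap_def xi0_def phi0_def E_def by simp_all

lemma sig_pos: "t \<in> {0<..<T} \<Longrightarrow> 0 < sig t x"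
  using s_pos E_bounds(3)[of x] ell_pos[of t T] unfolding sig_eq by simp

lemma E_deriv: "(E has_real_derivative mu * p x * E x) (at x)"
  unfolding E_def by (auto intro!: derivative_eq_intros psi_deriv)

lemma sig_dx: "(sig t has_real_derivative wa t x) (at x)"
  unfolding sig_eq[abs_def] wa_def sig_eq
  by (rule DERIV_cong, (rule derivative_eq_intros E_deriv refl)+) (simp add: algebra_simps)

text \<open>\<open>kap\<close> and \<open>sig\<close> differ by a function of t alone, hence have
  the same x-derivative.\<close>

lemma kap_dx: "(kap t has_real_derivative wa t x) (at x)"
  unfolding kap_eq[abs_def] wa_def sig_eq
  by (rule DERIV_cong, (rule derivative_eq_intros E_deriv refl)+) (simp add: algebra_simps)

lemma wa_dx: "(wa t has_real_derivative wb t x) (at x)"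
  unfolding wa_def[abs_def]
  by (rule DERIV_cong, (rule derivative_eq_intros sig_dx psi_deriv refl)+)
    (simp add: wb_def wa_def algebra_simps power2_eq_square)

lemma wb_dx: "(wb t has_real_derivative wb1 t x) (at x)"
  unfolding wb_def[abs_def]
  by (rule DERIV_cong, (rule derivative_eq_intros sig_dx psi_deriv refl)+)
    (simp add: wb1_def wa_def algebra_simps eval_nat_numeral)

lemma wb1_dx: "(wb1 t has_real_derivative wb2 t x) (at x)"
  unfolding wb1_def[abs_def]
  by (rule DERIV_cong, (rule derivative_eq_intros sig_dx psi_deriv refl)+)
    (simp add: wb2_def wa_def algebra_simps eval_nat_numeral)

lemma wth_dx: "(wth t has_real_derivative wh t * wa t x) (at x)"
  unfolding wth_def[abs_def]
  by (rule DERIV_cong, (rule derivative_eq_intros kap_dx refl)+) simp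

lemma wd_dx: "(wd t has_real_derivative we t * wa t x) (at x)"
  unfolding wd_def[abs_def]
  by (rule DERIV_cong, (rule derivative_eq_intros kap_dx refl)+) simp

lemma ell_deriv: "(ell T has_real_derivative T - 2 * t) (at t)"
  unfolding ell_def[abs_def] by (auto intro!: derivative_eq_intros)

lemma time_weight_deriv:
  assumes "t \<in> {0<..<T}"
  shows "((\<lambda>t. 1 / ell T t powr (k / 2)) has_real_derivative wh t * (1 / ell T t powr (k / 2))) (at t)"
proof -
  have l: "0 < ell T t" by (rule ell_pos[OF assms])
  have "((\<lambda>t. ell T t powr (- (k / 2))) has_real_derivative - (k / 2) * ell T t powr (- (k / 2) - 1) * (T - 2 * t)) (at t)"
    using DERIV_fun_powr[OF ell_deriv l, of "- (k / 2)"] by simp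
  also have "- (k / 2) * ell T t powr (- (k / 2) - 1) * (T - 2 * t) = wh t * (1 / ell T t powr (k / 2))"
    using l unfolding wh_def by (simp add: powr_diff powr_minus_divide)
  finally show ?thesis by (simp add: powr_minus_divide)
qed

lemma sig_dt: "t \<in> {0<..<T} \<Longrightarrow> ((\<lambda>t. sig t x) has_real_derivative wh t * sig t x) (at t)"
  unfolding sig_eq by (rule DERIV_cong, rule DERIV_cmult, rule time_weight_deriv) auto

lemma kap_dt: "t \<in> {0<..<T} \<Longrightarrow> ((\<lambda>t. kap t x) has_real_derivative wth t x) (at t)"
  unfolding wth_def kap_eq by (rule DERIV_cong, rule DERIV_cmult, rule time_weight_deriv) auto

lemma wa_dt: "t \<in> {0<..<T} \<Longrightarrow> ((\<lambda>t. wa t x) has_real_derivative wh t * wa t x) (at t)"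
  unfolding wa_def by (rule DERIV_cong, rule DERIV_cmult, rule sig_dt) auto
lemma wb_dt: "t \<in> {0<..<T} \<Longrightarrow> ((\<lambda>t. wb t x) has_real_derivative wh t * wb t x) (at t)"
  unfolding wb_def by (rule DERIV_cong, rule DERIV_cmult, rule sig_dt) auto
lemma wb1_dt: "t \<in> {0<..<T} \<Longrightarrow> ((\<lambda>t. wb1 t x) has_real_derivative wh t * wb1 t x) (at t)"
  unfolding wb1_def by (rule DERIV_cong, rule DERIV_cmult, rule sig_dt) auto

lemma wh_dt:
  assumes "t \<in> {0<..<T}"
  shows "(wh has_real_derivative we t - (wh t)^2) (at t)"
proof -
  have l: "ell T t \<noteq> 0" using ell_pos[OF assms] by simp
  have "(wh has_real_derivative (- (k / 2) * (-2) * ell T t - (- (k / 2) * (T - 2 * t)) * (T - 2 * t)) / (ell T t * ell T t)) (at t)"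
    unfolding wh_def[abs_def]
    by (rule DERIV_cong, (rule derivative_eq_intros ell_deriv l refl)+) simp
  also have "(- (k / 2) * (-2) * ell T t - (- (k / 2) * (T - 2 * t)) * (T - 2 * t)) / (ell T t * ell T t) = we t - (wh t)^2"
    unfolding we_def by (simp add: field_simps power2_eq_square)
  finally show ?thesis .
qed

lemma wth_dt: "t \<in> {0<..<T} \<Longrightarrow> ((\<lambda>t. wth t x) has_real_derivative wd t x) (at t)"
  unfolding wth_def wd_def
  by (rule DERIV_cong, (rule derivative_eq_intros wh_dt kap_dt refl | assumption)+)
    (simp add: wth_def algebra_simps power2_eq_square)

text \<open>The numerator is s times the gap between exp (10 \<lambda> \<Psi>) and the largest
  possible \<open>E x\<close>; the denominator comes from trading
  \<open>ell T t powr (k / 2)\<close> for a single \<open>ell T t\<close>.\<close>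

definition decay where "decay = s * (exp (10 * lam * Psi) - exp (9 * lam * Psi)) / T powr (k - 2)"

text \<open>Both use that \<ell> is at most T^2; in the first, \<open>k / 2 - 1\<close> is
  nonnegative because \<open>k\<close> is at least 2. Keeping one factor \<ell> there matches the
  size T / \<ell> of \<open>wh\<close>.\<close>

lemma powr_ell_bounds:
  assumes t: "t \<in> {0<..<T}"
  shows "ell T t powr (k / 2) \<le> ell T t * T powr (k - 2)" "ell T t powr (k / 2) \<le> T powr k"
proof -
  have l: "0 < ell T t" "ell T t \<le> T^2" using ell_pos[OF t] ell_le[OF t] zero_le_power2[of T] by linarith+
  have "ell T t powr (k / 2) = ell T t powr (1 + (k / 2 - 1))" by simp
  also have "\<dots> = ell T t * ell T t powr (k / 2 - 1)" using l unfolding powr_add by simp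
  also have "\<dots> \<le> ell T t * (T^2) powr (k / 2 - 1)"
    using l k by (intro mult_left_mono powr_mono2) auto
  also have "(T^2) powr (k / 2 - 1) = T powr (k - 2)"
    using T_pos by (simp add: powr_powr algebra_simps flip: powr_numeral)
  finally show "ell T t powr (k / 2) \<le> ell T t * T powr (k - 2)" .
  have "ell T t powr (k / 2) \<le> (T^2) powr (k / 2)" using l k by (intro powr_mono2) auto
  also have "\<dots> = T powr k" using T_pos by (simp add: powr_powr flip: powr_numeral)
  finally show "ell T t powr (k / 2) \<le> T powr k" .
qed

lemma kap_decay:
  assumes t: "t \<in> {0<..<T}"
  shows "kap t x \<le> - decay / ell T t"
proof -
  have l: "0 < ell T t" by (rule ell_pos[OF t])
  have "1 / (ell T t * T powr (k - 2)) \<le> 1 / ell T t powr (k / 2)"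
    using powr_ell_bounds[OF t] l by (intro frac_le) auto
  moreover have "exp (10 * lam * Psi) - exp (9 * lam * Psi) \<le> exp (10 * lam * Psi) - E x" "0 \<le> exp (10 * lam * Psi) - exp (9 * lam * Psi)"
    using E_bounds[of x] lam_Psi by auto
  ultimately have "(exp (10 * lam * Psi) - exp (9 * lam * Psi)) * (1 / (ell T t * T powr (k - 2)))
     \<le> (exp (10 * lam * Psi) - E x) * (1 / ell T t powr (k / 2))"
    using l E_bounds(5)[of x] by (intro mult_mono) (auto simp: T_pos)
  then have "s * ((exp (10 * lam * Psi) - exp (9 * lam * Psi)) * (1 / (ell T t * T powr (k - 2))))
     \<le> s * ((exp (10 * lam * Psi) - E x) * (1 / ell T t powr (k / 2)))"
    using s_pos by (intro mult_left_mono) auto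
  moreover have "s * ((exp (10 * lam * Psi) - exp (9 * lam * Psi)) * (1 / (ell T t * T powr (k - 2)))) = decay / ell T t"
    unfolding decay_def by (simp add: mult.commute)
  moreover have "s * ((exp (10 * lam * Psi) - E x) * (1 / ell T t powr (k / 2))) = - kap t x"
    unfolding kap_eq by (simp add: algebra_simps diff_divide_distrib)
  ultimately show ?thesis by simp
qed

lemma decay_pos: "0 < decay"
proof -
  have "9 * lam * Psi < 10 * lam * Psi" using lam_Psi by (simp add: mult.assoc)
  then show ?thesis using s_pos T_pos unfolding decay_def by (intro divide_pos_pos mult_pos_pos) auto
qed

lemma tame_p [intro]: "tame T (\<lambda>t. p)" "tame T (\<lambda>t. q)" "tame T (\<lambda>t. r)" "tame T (\<lambda>t. v)"
  using psi_deriv v_cont psi_periodic psi_bound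
  by (auto intro!: tame_space DERIV_isCont continuous_at_imp_continuous_on)

lemma tame_E: "tame T (\<lambda>t. E)"
proof (rule tame_space)
  show "continuous_on UNIV E" by (auto intro!: DERIV_isCont E_deriv continuous_at_imp_continuous_on)
  show "E (x + 2 * pi) = E x" for x unfolding E_def psi_periodic ..
  show "\<bar>E x\<bar> \<le> exp (9 * lam * Psi)" for x using E_bounds[of x] by simp
qed

lemma continuous_ell: "continuous_on S (ell T)"
  unfolding ell_def[abs_def] by (intro continuous_intros)

lemma tame_time_weight: "tame T (\<lambda>t x. 1 / ell T t powr (k / 2))"
proof (rule tame_time)
  have "\<And>t. t \<in> {0<..<T} \<Longrightarrow> 0 < ell T t" by (rule ell_pos)
  then show "continuous_on {0<..<T} (\<lambda>t. 1 / ell T t powr (k / 2))"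
    by (intro continuous_intros continuous_ell) (force simp: less_le)+
  fix t assume t: "t \<in> {0<..<T}"
  have l: "0 < ell T t" by (rule ell_pos[OF t])
  have "1 / ell T t powr (k / 2) = (1 / ell T t) powr (k / 2)" using l by (simp add: powr_divide)
  also have "\<dots> \<le> (1 + 1 / ell T t) powr (k / 2)" using l k by (intro powr_mono2) auto
  also have "\<dots> \<le> (1 + 1 / ell T t) powr real (nat \<lceil>k / 2\<rceil>)"
  proof (rule powr_mono)
    show "1 \<le> 1 + 1 / ell T t" using l by simp
  qed linarith
  also have "\<dots> = (1 + 1 / ell T t) ^ nat \<lceil>k / 2\<rceil>" using l by (intro powr_realpow) (simp add: add_pos_pos)
  finally show "\<bar>1 / ell T t powr (k / 2)\<bar> \<le> 1 * (1 + 1 / ell T t) ^ nat \<lceil>k / 2\<rceil>" by simp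
qed

lemma tame_inverse_ell: "tame T (\<lambda>t x. 1 / ell T t)"
proof (rule tame_time)
  have "\<And>t. t \<in> {0<..<T} \<Longrightarrow> 0 < ell T t" by (rule ell_pos)
  then show "continuous_on {0<..<T} (\<lambda>t. 1 / ell T t)"
    by (intro continuous_intros continuous_ell) (force simp: less_le)+
  show "\<bar>1 / ell T t\<bar> \<le> 1 * (1 + 1 / ell T t) ^ 1" if "t \<in> {0<..<T}" for t using ell_pos[OF that] by simp
qed

lemma tame_t: "tame T (\<lambda>t x. t)"
  by (rule tame_time[of _ _ T 0]) (auto intro: continuous_intros)

lemma tame_sig [intro]: "tame T sig" and tame_kap [intro]: "tame T kap"
  unfolding sig_eq[abs_def] kap_eq[abs_def]
  by (intro tame_mult tame_diff tame_const tame_E tame_time_weight)+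

lemma tame_rho [intro]: "tame T rho"
  unfolding rho_def[abs_def] by (intro tame_mult tame_const tame_sig)

lemma tame_wa [intro]: "tame T wa" "tame T wb" "tame T wb1" "tame T wb2"
  unfolding wa_def[abs_def] wb_def[abs_def] wb1_def[abs_def] wb2_def[abs_def]
  by (intro tame_mult tame_add tame_power tame_const tame_sig tame_p)+

lemma tame_wh [intro]: "tame T (\<lambda>t x. wh t)" and tame_we [intro]: "tame T (\<lambda>t x. we t)"
proof -
  have "tame T (\<lambda>t x. - (k / 2) * (T - 2 * t) * (1 / ell T t))"
    by (intro tame_mult tame_diff tame_const tame_t tame_inverse_ell)
  then show h: "tame T (\<lambda>t x. wh t)" unfolding wh_def[abs_def] by simp
  have "tame T (\<lambda>t x. (k / 2) * (2 * (1 / ell T t) + ((T - 2 * t) * (1 / ell T t))^2) + wh t^2)"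
    by (intro tame_mult tame_diff tame_add tame_power tame_const tame_t tame_inverse_ell h)
  then show "tame T (\<lambda>t x. we t)"
  proof (rule tame_cong)
    fix t :: real and x :: real assume "t \<in> {0<..<T}"
    then have "ell T t \<noteq> 0" using ell_pos[of t T] by simp
    then have "(2 * ell T t + (T - 2 * t)^2) / (ell T t)^2 = 2 * (1 / ell T t) + ((T - 2 * t) * (1 / ell T t))^2"
      by (simp add: add_divide_distrib power_mult_distrib power_divide power2_eq_square)
    then show "we t = (k / 2) * (2 * (1 / ell T t) + ((T - 2 * t) * (1 / ell T t))^2) + wh t^2"
      unfolding we_def by (metis times_divide_eq_right)
  qed
qed

lemma tame_wth [intro]: "tame T wth" "tame T wd"
  unfolding wth_def[abs_def] wd_def[abs_def] by (intro tame_mult tame_wh tame_we tame_kap)+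

sublocale weighted_strip T kap wa wth decay
proof
  show "continuous_on ({0<..<T} \<times> UNIV) (\<lambda>z. kap (fst z) (snd z))" using tame_kap unfolding tame_def by blast
  show "kap t (x + 2 * pi) = kap t x" for t x unfolding kap_eq E_def psi_periodic ..
qed (use T_pos decay_pos kap_decay kap_dx kap_dt in auto)

text \<open>The two powers of T have different tasks. T^k makes \<open>sig\<close> at least
  \<open>1 / del\<close>. T^(k-1) bounds T / \<ell>, the size of \<open>wh\<close>, by
  \<open>del * sig t x / (1 + al)\<close> with exp (8 \<lambda> \<Psi>) to spare; the spare factor
  absorbs the exp (2 \<lambda> \<Psi>) by which \<phi> may exceed \<xi>. In the constant, 15 is the
  sum 1 + 6 + 7 + 1 of the coefficients in \<open>wb2\<close>, and \<open>k^2\<close> comes from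
  \<open>we\<close>.\<close>

lemma weight_admissible:
  assumes del: "0 < del" "del \<le> 1" and al: "0 \<le> al" and t: "t \<in> {0<..<T}"
    and s: "s \<ge> 1 / del * (1 + al) * (T powr k + T powr (k - 1))"
  shows "admissible (15 * M0^4 + k^2) (rho t x) (eps t x) del al (wa t x) (wb t x) (wb1 t x) (wb2 t x) (wh t) (wth t x) (wd t x)"
    "1 \<le> sig t x" "mu \<le> rho t x"
proof -
  define Mk where "Mk = 15 * M0^4 + k^2"
  have l: "0 < ell T t" by (rule ell_pos[OF t])
  have sg: "0 < sig t x" by (rule sig_pos[OF t])
  have q0: "0 < 1 / del * (1 + al)" using del al by simp
  have s1: "1 / del * (1 + al) * T powr k \<le> s" "1 / del * (1 + al) * T powr (k - 1) \<le> s"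
  proof -
    have "1 / del * (1 + al) * T powr k \<le> 1 / del * (1 + al) * (T powr k + T powr (k - 1))"
      "1 / del * (1 + al) * T powr (k - 1) \<le> 1 / del * (1 + al) * (T powr k + T powr (k - 1))"
      using q0 by (intro mult_left_mono; simp)+
    then show "1 / del * (1 + al) * T powr k \<le> s" "1 / del * (1 + al) * T powr (k - 1) \<le> s"
      using s by linarith+
  qed
  have sigE: "s * (1 / ell T t powr (k / 2)) \<le> sig t x" "s * exp (8 * lam * Psi) * (1 / ell T t powr (k / 2)) \<le> sig t x"
  proof -
    have "s * 1 \<le> s * E x" "s * exp (8 * lam * Psi) \<le> s * E x"
      using E_bounds[of x] s_pos by (intro mult_left_mono; simp)+
    then have "s * 1 * (1 / ell T t powr (k / 2)) \<le> sig t x" "s * exp (8 * lam * Psi) * (1 / ell T t powr (k / 2)) \<le> sig t x"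
      unfolding sig_eq by (intro mult_right_mono; simp)+
    then show "s * (1 / ell T t powr (k / 2)) \<le> sig t x" "s * exp (8 * lam * Psi) * (1 / ell T t powr (k / 2)) \<le> sig t x"
      by simp_all
  qed
  have "1 / del * 1 \<le> 1 / del * (1 + al)" using del al by (intro mult_left_mono) auto
  also have "\<dots> = (1 / del * (1 + al) * T powr k) * (1 / T powr k)" using T_pos by simp
  also have "\<dots> \<le> s * (1 / ell T t powr (k / 2))"
    using s1 s_pos powr_ell_bounds(2)[OF t] l by (intro mult_mono frac_le) (auto simp: T_pos)
  also note sigE(1)
  finally have sd: "1 / del \<le> sig t x" by simp
  moreover have "1 \<le> 1 / del" using del by simp
  ultimately show sig1: "1 \<le> sig t x" by linarith
  have eps: "0 < eps t x" "eps t x \<le> del"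
    using sg sd del unfolding eps_def by (auto simp: field_simps)
  show rmu: "mu \<le> rho t x" unfolding rho_def using mult_left_mono[OF sig1, of mu] mu by simp
  have rho0: "0 < rho t x" using rmu mu by linarith
  have er: "eps t x * rho t x = mu" unfolding eps_def rho_def using sg by simp
  have e2: "eps t x * rho t x^2 = mu * rho t x" and e3: "eps t x^2 * rho t x^3 = mu^2 * rho t x"
    and e4: "eps t x^3 * rho t x^4 = mu^3 * rho t x"
  proof -
    have "e * c^2 = (e * c) * c" "e^2 * c^3 = (e * c)^2 * c" "e^3 * c^4 = (e * c)^3 * c" for e c :: real
      by (simp_all add: eval_nat_numeral)
    note this[of "eps t x" "rho t x", unfolded er]
    then show "eps t x * rho t x^2 = mu * rho t x" "eps t x^2 * rho t x^3 = mu^2 * rho t x" "eps t x^3 * rho t x^4 = mu^3 * rho t x"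
      by blast+
  qed
  define z where "z = T / ell T t"
  have z0: "0 < z" unfolding z_def using l T_pos by simp
  have z: "z * exp (8 * lam * Psi) \<le> del * sig t x / (1 + al)"
  proof -
    have "(1 / del * (1 + al)) * (z * exp (8 * lam * Psi))
      = (1 / del * (1 + al) * T powr (k - 1)) * exp (8 * lam * Psi) * (1 / (ell T t * T powr (k - 2)))"
    proof -
      have "T powr (k - 1) = T * T powr (k - 2)" using T_pos powr_add[of T 1 "k - 2"] by simp
      then show ?thesis using T_pos l unfolding z_def by simp
    qed
    also have "\<dots> \<le> s * exp (8 * lam * Psi) * (1 / ell T t powr (k / 2))"
      using s1 s_pos powr_ell_bounds(1)[OF t] l by (intro mult_mono frac_le) (auto simp: T_pos)
    also note sigE(2)
    finally have "(1 / del * (1 + al)) * (z * exp (8 * lam * Psi)) \<le> sig t x" .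
    then show ?thesis using del al by (simp add: field_simps)
  qed
  have kp: "\<bar>kap t x\<bar> \<le> sig t x * exp (2 * lam * Psi)"
  proof -
    have "\<bar>kap t x\<bar> = s * (exp (10 * lam * Psi) - E x) * (1 / ell T t powr (k / 2))"
    proof -
      have "E x \<le> exp (10 * lam * Psi)" by (rule E_bounds)
      then have "kap t x \<le> 0" unfolding kap_eq using s_pos by (intro mult_nonpos_nonneg mult_nonneg_nonpos) auto
      then show ?thesis unfolding kap_eq by (simp add: algebra_simps diff_divide_distrib)
    qed
    also have "\<dots> \<le> s * (E x * exp (2 * lam * Psi)) * (1 / ell T t powr (k / 2))"
    proof -
      have "exp (10 * lam * Psi) = exp (8 * lam * Psi) * exp (2 * lam * Psi)" by (simp flip: exp_add)
      also have "\<dots> \<le> E x * exp (2 * lam * Psi)" using E_bounds[of x] by simp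
      finally have "exp (10 * lam * Psi) - E x \<le> E x * exp (2 * lam * Psi)" using E_bounds[of x] by simp
      then show ?thesis using s_pos by (intro mult_right_mono mult_left_mono) auto
    qed
    finally show ?thesis unfolding sig_eq by (simp add: ac_simps)
  qed
  define w where "w = lam * Psi"
  have w: "0 < w" using lam_Psi(1) unfolding w_def .
  note z' = z[unfolded mult.assoc, folded w_def] and kp' = kp[unfolded mult.assoc, folded w_def]
  have ex: "1 \<le> exp (8 * w)" "1 \<le> exp (2 * w)" using w by auto
  have ex2: "exp (2 * w) \<le> exp (8 * w)" using w by simp
  have ex3: "exp (2 * w) \<le> exp (8 * w)^2"
  proof -
    have "exp (8 * w)^2 = exp (16 * w)" by (simp add: power2_eq_square flip: exp_add)
    then show ?thesis using w by simp
  qed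
  define y where "y = del * sig t x / (1 + al)"
  have y0: "0 \<le> y" unfolding y_def using del al sg by simp
  have zy: "z \<le> y" "z * exp (2 * w) \<le> y" "z^2 * exp (2 * w) \<le> y^2"
  proof -
    have z8: "z * exp (8 * w) \<le> y" using z' unfolding y_def by simp
    have "z * 1 \<le> z * exp (8 * w)" "z * exp (2 * w) \<le> z * exp (8 * w)"
      by (rule mult_left_mono[OF ex(1) less_imp_le[OF z0]], rule mult_left_mono[OF ex2 less_imp_le[OF z0]])
    then show "z \<le> y" "z * exp (2 * w) \<le> y" using z8 by linarith+
    have "z^2 * exp (2 * w) \<le> z^2 * exp (8 * w)^2" using ex3 by (intro mult_left_mono) auto
    also have "\<dots> \<le> y^2" using power_mono[OF z8, of 2] z0 by (simp add: power_mult_distrib)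
    finally show "z^2 * exp (2 * w) \<le> y^2" .
  qed
  have Tt: "\<bar>T - 2 * t\<bar> \<le> T" using t by auto
  have h: "\<bar>wh t\<bar> \<le> k / 2 * z"
  proof -
    have "\<bar>wh t\<bar> = k / 2 * (\<bar>T - 2 * t\<bar> / ell T t)" unfolding wh_def using l k by (simp add: abs_mult)
    also have "\<dots> \<le> k / 2 * (T / ell T t)" using l k Tt by (intro mult_left_mono divide_right_mono) auto
    finally show ?thesis unfolding z_def .
  qed
  have e: "\<bar>we t\<bar> \<le> k^2 * z^2"
  proof -
    have "(T - 2 * t)^2 \<le> T^2" using power_mono[OF Tt, of 2] by simp
    then have "2 * ell T t + (T - 2 * t)^2 \<le> 2 * T^2" using ell_le[OF t] zero_le_power2[of T] by linarith
    then have "(k / 2) * (2 * ell T t + (T - 2 * t)^2) / (ell T t)^2 \<le> (k / 2) * (2 * T^2) / (ell T t)^2"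
      using k by (intro divide_right_mono mult_left_mono) auto
    also have "\<dots> = k * z^2" unfolding z_def by (simp add: power_divide)
    also have "\<dots> \<le> (k^2 / 2) * z^2" using k by (intro mult_right_mono) (auto simp: power2_eq_square)
    finally have 1: "(k / 2) * (2 * ell T t + (T - 2 * t)^2) / (ell T t)^2 \<le> (k^2 / 2) * z^2" .
    have "(wh t)^2 \<le> (k / 2 * z)^2" using power_mono[OF h, of 2] by simp
    also have "\<dots> = (k^2 / 4) * z^2" by (simp add: power_mult_distrib power_divide)
    finally have 2: "(wh t)^2 \<le> (k^2 / 4) * z^2" .
    have "0 \<le> we t" unfolding we_def using l k by (intro add_nonneg_nonneg divide_nonneg_nonneg mult_nonneg_nonneg) auto
    moreover have "we t \<le> (k^2 / 2) * z^2 + (k^2 / 4) * z^2" unfolding we_def by (rule add_mono[OF 1 2])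
    moreover have "0 \<le> k^2 * z^2" by simp
    ultimately show ?thesis by (simp add: algebra_simps)
  qed
  have M4: "1 \<le> M0^4" "M0 \<le> M0^4" "M0^2 \<le> M0^4" "M0^3 \<le> M0^4"
    using psi_bound(5) power_increasing[of 1 4 M0] power_increasing[of 2 4 M0] power_increasing[of 3 4 M0] power_increasing[of 0 4 M0] by auto
  have mup: "mu \<le> mu^2" "mu \<le> mu^3" "mu^2 \<le> mu^3" "mu \<le> mu^4" "mu^2 \<le> mu^4" "mu^3 \<le> mu^4" "1 \<le> mu^2" "1 \<le> mu^4"
    using mu power_increasing[of 1 2 mu] power_increasing[of 1 3 mu] power_increasing[of 2 3 mu] power_increasing[of 1 4 mu]
     power_increasing[of 2 4 mu] power_increasing[of 3 4 mu] power_increasing[of 0 2 mu] power_increasing[of 0 4 mu] by auto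
  have Mk: "15 * M0^4 \<le> Mk" "k^2 \<le> Mk" "k \<le> Mk" "0 \<le> Mk" "M0 \<le> Mk"
  proof -
    have "k * 1 \<le> k * k" using k by (intro mult_left_mono) auto
    then have "k \<le> k^2" by (simp add: power2_eq_square)
    then show "15 * M0^4 \<le> Mk" "k^2 \<le> Mk" "k \<le> Mk" "0 \<le> Mk" "M0 \<le> Mk" unfolding Mk_def using M4 psi_bound(5) k by auto
  qed
  have mab: "\<bar>m * c\<bar> \<le> m' * C" if "0 \<le> m" "m \<le> m'" "\<bar>c\<bar> \<le> C" for m m' c C :: real
    using that by (simp add: abs_mult mult_mono)
  have ba: "\<bar>wa t x\<bar> \<le> Mk * rho t x"
  proof -
    have "\<bar>wa t x\<bar> = \<bar>p x\<bar> * rho t x" unfolding wa_def rho_def using mu sg by (simp add: abs_mult)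
    also have "\<dots> \<le> Mk * rho t x" using psi_bound(1)[of x] Mk rho0 by (intro mult_right_mono) auto
    finally show ?thesis .
  qed
  have bb: "\<bar>wb t x\<bar> \<le> Mk * (eps t x * rho t x^2)"
  proof -
    have "\<bar>mu^2 * p x^2 + mu * q x\<bar> \<le> mu^2 * M0^2 + mu^2 * M0"
      using mu mup psi_bound by (intro bound_add mab bound_power) auto
    also have "\<dots> = mu^2 * (M0^2 + M0)" by (simp add: algebra_simps)
    also have "\<dots> \<le> mu^2 * Mk" using M4 Mk by (intro mult_left_mono) auto
    finally have "\<bar>wb t x\<bar> \<le> mu^2 * Mk * sig t x" unfolding wb_def abs_mult using sg by (intro mult_mono) auto
    also have "\<dots> = Mk * (mu * rho t x)" unfolding rho_def by (simp add: power2_eq_square)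
    finally show ?thesis unfolding e2 .
  qed
  have bb1: "\<bar>wb1 t x\<bar> \<le> Mk * (eps t x^2 * rho t x^3)"
  proof -
    have "\<bar>mu^3 * p x^3 + mu^2 * (3 * p x * q x) + mu * r x\<bar> \<le> mu^3 * M0^3 + mu^3 * (3 * M0 * M0) + mu^3 * M0"
      using mu mup psi_bound by (intro bound_add mab bound_power bound_mult bound_numeral) auto
    also have "\<dots> = mu^3 * (M0^3 + 3 * M0^2 + M0)" by (simp add: algebra_simps power2_eq_square)
    also have "\<dots> \<le> mu^3 * Mk" using M4 Mk mu by (intro mult_left_mono) auto
    finally have "\<bar>wb1 t x\<bar> \<le> mu^3 * Mk * sig t x" unfolding wb1_def abs_mult using sg by (intro mult_mono) (auto simp: ac_simps)
    also have "\<dots> = Mk * (mu^2 * rho t x)" unfolding rho_def by (simp add: eval_nat_numeral)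
    finally show ?thesis unfolding e3 .
  qed
  have bb2: "\<bar>wb2 t x\<bar> \<le> Mk * (eps t x^3 * rho t x^4)"
  proof -
    have "\<bar>mu^4 * p x^4 + mu^3 * (6 * p x^2 * q x) + mu^2 * (3 * q x^2 + 4 * p x * r x) + mu * v x\<bar>
      \<le> mu^4 * M0^4 + mu^4 * (6 * M0^2 * M0) + mu^4 * (3 * M0^2 + 4 * M0 * M0) + mu^4 * M0"
    proof (intro bound_add)
      have m0: "0 \<le> mu" "0 \<le> mu^2" "0 \<le> mu^3" "0 \<le> mu^4" using mu by auto
      show "\<bar>mu^4 * p x^4\<bar> \<le> mu^4 * M0^4" by (rule mab[OF m0(4) order_refl]) (intro bound_power psi_bound)
      show "\<bar>mu^3 * (6 * p x^2 * q x)\<bar> \<le> mu^4 * (6 * M0^2 * M0)"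
        by (rule mab[OF m0(3) mup(6)]) (intro bound_power bound_mult bound_numeral psi_bound)
      show "\<bar>mu^2 * (3 * q x^2 + 4 * p x * r x)\<bar> \<le> mu^4 * (3 * M0^2 + 4 * M0 * M0)"
        by (rule mab[OF m0(2) mup(5)]) (intro bound_add bound_power bound_mult bound_numeral psi_bound)
      show "\<bar>mu * v x\<bar> \<le> mu^4 * M0" by (rule mab[OF m0(1) mup(4) psi_bound(4)])
    qed
    also have "\<dots> = mu^4 * (M0^4 + 6 * M0^3 + 7 * M0^2 + M0)" by (simp add: algebra_simps eval_nat_numeral)
    also have "\<dots> \<le> mu^4 * Mk" using M4 Mk mu by (intro mult_left_mono) auto
    finally have "\<bar>wb2 t x\<bar> \<le> mu^4 * Mk * sig t x" unfolding wb2_def abs_mult using sg by (intro mult_mono) (auto simp: ac_simps)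
    also have "\<dots> = Mk * (mu^3 * rho t x)" unfolding rho_def by (simp add: eval_nat_numeral)
    finally show ?thesis unfolding e4 .
  qed
  have yr: "y \<le> eps t x * del * rho t x^2 / (1 + al)" "y * sig t x \<le> del * rho t x^2 / (1 + al)"
    "y^2 * sig t x \<le> eps t x * del * rho t x^4 / (1 + al)^2"
  proof -
    have 1: "eps t x * rho t x^2 = mu^2 * sig t x" unfolding e2 by (simp add: rho_def power2_eq_square)
    have "y * 1 \<le> y * mu^2" using mup y0 by (intro mult_left_mono) auto
    also have "\<dots> = eps t x * del * rho t x^2 / (1 + al)" using 1 unfolding y_def by (simp add: algebra_simps)
    finally show "y \<le> eps t x * del * rho t x^2 / (1 + al)" by simp
    have "y * sig t x * 1 \<le> y * sig t x * mu^2" using mup y0 sg by (intro mult_left_mono) auto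
    also have "\<dots> = del * rho t x^2 / (1 + al)" unfolding y_def rho_def by (simp add: algebra_simps power2_eq_square)
    finally show "y * sig t x \<le> del * rho t x^2 / (1 + al)" by simp
    have 2: "eps t x * rho t x^4 = mu^4 * sig t x^3"
    proof -
      have "e * c^4 = (e * c^2) * c^2" for e c :: real by (simp add: eval_nat_numeral)
      then have "eps t x * rho t x^4 = (mu^2 * sig t x) * rho t x^2" unfolding 1[symmetric] .
      also have "\<dots> = mu^4 * sig t x^3" by (simp add: rho_def eval_nat_numeral)
      finally show ?thesis .
    qed
    have "y^2 * sig t x = del * (del * (sig t x^3 / (1 + al)^2))" unfolding y_def by (simp add: power_divide eval_nat_numeral)
    also have "\<dots> \<le> 1 * (del * (sig t x^3 / (1 + al)^2))" using del sg by (intro mult_right_mono) auto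
    also have "\<dots> \<le> mu^4 * (del * (sig t x^3 / (1 + al)^2))" using mup del sg by (intro mult_right_mono) auto
    also have "\<dots> = eps t x * del * rho t x^4 / (1 + al)^2" using 2 by (simp add: algebra_simps)
    finally show "y^2 * sig t x \<le> eps t x * del * rho t x^4 / (1 + al)^2" .
  qed
  have bh: "\<bar>wh t\<bar> \<le> Mk * (eps t x * del * rho t x^2 / (1 + al))"
  proof -
    have "\<bar>wh t\<bar> \<le> k / 2 * z" by (rule h)
    also have "\<dots> \<le> Mk * (eps t x * del * rho t x^2 / (1 + al))"
      using zy(1) yr(1) z0 Mk k by (intro mult_mono) auto
    finally show ?thesis .
  qed
  have bth: "\<bar>wth t x\<bar> \<le> Mk * (del * rho t x^2 / (1 + al))"
  proof -
    have "\<bar>wth t x\<bar> \<le> (k / 2 * z) * (sig t x * exp (2 * w))" unfolding wth_def by (intro bound_mult h kp')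
    also have "\<dots> = k / 2 * ((z * exp (2 * w)) * sig t x)" by simp
    also have "\<dots> \<le> k / 2 * (y * sig t x)" using zy(2) sg k by (intro mult_left_mono mult_right_mono) auto
    also have "\<dots> \<le> Mk * (del * rho t x^2 / (1 + al))" using yr(2) y0 sg Mk k by (intro mult_mono) auto
    finally show ?thesis .
  qed
  have bd: "\<bar>wd t x\<bar> \<le> Mk * (eps t x * del * rho t x^4 / (1 + al)^2)"
  proof -
    have "\<bar>wd t x\<bar> \<le> (k^2 * z^2) * (sig t x * exp (2 * w))" unfolding wd_def by (intro bound_mult e kp')
    also have "\<dots> = k^2 * ((z^2 * exp (2 * w)) * sig t x)" by simp
    also have "\<dots> \<le> k^2 * (y^2 * sig t x)" using zy(3) sg k by (intro mult_left_mono mult_right_mono) auto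
    also have "\<dots> \<le> Mk * (eps t x * del * rho t x^4 / (1 + al)^2)" using yr(3) sg Mk k by (intro mult_mono) auto
    finally show ?thesis .
  qed
  show "admissible (15 * M0^4 + k^2) (rho t x) (eps t x) del al (wa t x) (wb t x) (wb1 t x) (wb2 t x) (wh t) (wth t x) (wd t x)"
    unfolding admissible_def Mk_def[symmetric] using rho0 eps del al ba bb bb1 bb2 bh bth bd by blast
qed

end

section \<open>The spatial weight function\<close>

text \<open>At the kink the difference quotient is bounded by the power \<open>n - 1\<close> of the
  increment, which tends to zero since \<open>n\<close> is at least 2.\<close>

lemma pos_part_power_deriv:
  fixes y :: real
  assumes "2 \<le> n"
  shows "((\<lambda>y. max 0 y ^ n) has_real_derivative real n * max 0 y ^ (n - 1)) (at y)"
proof (cases y "0 :: real" rule: linorder_cases)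
  case less
  have "((\<lambda>y. 0) has_real_derivative 0) (at y)" by simp
  moreover have "\<forall>\<^sub>F z in nhds y. 0 = max 0 z ^ n"
    using eventually_nhds_in_open[of "{..<0}" y] less assms by (auto elim!: eventually_mono)
  ultimately have "((\<lambda>y. max 0 y ^ n) has_real_derivative 0) (at y)"
    using DERIV_cong_ev[OF refl, of "\<lambda>z. 0" "\<lambda>z. max 0 z ^ n" y 0 0] by simp
  then show ?thesis using less assms by (simp add: power_0_left)
next
  case greater
  have "((\<lambda>y. y ^ n) has_real_derivative real n * y ^ (n - 1)) (at y)" using DERIV_pow[of n y] by simp
  moreover have "\<forall>\<^sub>F z in nhds y. z ^ n = max 0 z ^ n"
    using eventually_nhds_in_open[of "{0<..}" y] greater by (auto elim!: eventually_mono)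
  ultimately have "((\<lambda>y. max 0 y ^ n) has_real_derivative real n * y ^ (n - 1)) (at y)"
    using DERIV_cong_ev[OF refl, of "\<lambda>z. z ^ n" "\<lambda>z. max 0 z ^ n" y "real n * y ^ (n - 1)" "real n * y ^ (n - 1)"] by simp
  then show ?thesis using greater by simp
next
  case equal
  have b: "norm ((max 0 (0 + z) ^ n - max 0 0 ^ n) / z) \<le> \<bar>z\<bar> ^ (n - 1)" for z :: real
  proof -
    have n: "n = Suc (n - 1)" using assms by simp
    have "\<bar>max 0 z ^ n / z\<bar> = max 0 z ^ n / \<bar>z\<bar>" by (simp add: abs_divide)
    also have "\<dots> \<le> \<bar>z\<bar> ^ n / \<bar>z\<bar>" by (intro divide_right_mono power_mono) auto
    also have "\<dots> \<le> \<bar>z\<bar> ^ (n - 1)" by (subst n) (simp add: divide_simps)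
    finally show ?thesis using assms by (simp add: power_0_left)
  qed
  have "\<forall>\<^sub>F z in at 0. norm ((max 0 (0 + z) ^ n - max 0 0 ^ n) / z) \<le> \<bar>z\<bar> ^ (n - 1)" using b by (intro always_eventually allI)
  moreover have "((\<lambda>z :: real. \<bar>z\<bar> ^ (n - 1)) \<longlongrightarrow> 0) (at 0)"
    using tendsto_power[OF tendsto_rabs[OF tendsto_ident_at], of "n - 1" "0 :: real" UNIV] assms by (simp add: power_0_left)
  ultimately have "((\<lambda>z. (max 0 (0 + z) ^ n - max 0 0 ^ n) / z) \<longlongrightarrow> (0 :: real)) (at 0)"
    by (rule Lim_null_comparison)
  then show ?thesis using assms unfolding equal DERIV_def by (simp add: power_0_left)
qed

text \<open>For continuous \<open>f\<close> the set where the essential bound holds is closed and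
  has full measure in the open cell, so it contains the cell and its closure; periodicity does the
  rest.\<close>

lemma Linf_norm_ge:
  fixes f :: "real \<Rightarrow> real"
  assumes cont: "continuous_on UNIV f" and per: "\<And>x. f (x + 2 * pi) = f x"
  shows "\<bar>f x\<bar> \<le> Linf_norm {0..<2 * pi} f"
proof -
  let ?S = "{0..<2 * pi}" and ?f = "\<lambda>x. ereal \<bar>f x\<bar>"
  let ?M = "restrict_space lborel ?S"
  define e where "e = esssup ?M ?f"
  obtain B where B: "\<And>x. \<bar>f x\<bar> \<le> B" using periodic_continuous_bounded[OF per cont] by blast
  have f: "f \<in> borel_measurable borel" by (rule borel_measurable_continuous_onI[OF cont])
  then have m: "?f \<in> borel_measurable ?M" by (intro measurable_restrict_space1) simp
  have "e \<le> ereal B" unfolding e_def by (rule esssup_I[OF m]) (simp add: B)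
  moreover have ae: "AE x in ?M. ?f x \<le> e" unfolding e_def by (rule esssup_AE)
  have ae': "AE x in lborel. x \<in> ?S \<longrightarrow> ?f x \<le> e"
    using ae by (subst (asm) AE_restrict_space_iff) auto
  \<comment> \<open>\<open>real_of_ereal\<close> is faithful on finite values only. The value
    -\<infinity> is ruled out because the cell has positive measure, +\<infinity> by
    boundedness.\<close>
  have e0: "e \<noteq> -\<infinity>"
  proof
    assume "e = -\<infinity>"
    then have "AE x in lborel. x \<notin> ?S" using ae' by simp
    then have "emeasure lborel ?S = 0"
      by (subst (asm) AE_iff_measurable[of ?S]) auto
    then show False by simp
  qed
  ultimately obtain c where c: "e = ereal c" by (cases e) auto
  have cl: "closed {x. \<bar>f x\<bar> \<le> c}" by (intro closed_Collect_le continuous_intros cont)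
  have "AE x\<in>{0<..<2 * pi} in lebesgue. x \<in> {x. \<bar>f x\<bar> \<le> c}"
  proof -
    have "AE x in lborel. x \<in> {0<..<2 * pi} \<longrightarrow> x \<in> {x. \<bar>f x\<bar> \<le> c}"
      using ae' by eventually_elim (simp add: c)
    then show ?thesis by (rule AE_completion)
  qed
  then have open_le: "\<bar>f y\<bar> \<le> c" if "y \<in> {0<..<2 * pi}" for y
    using mem_closed_if_AE_lebesgue_open[OF _ cl _ that] by simp
  have "closure {0<..<2 * pi} \<subseteq> {x. \<bar>f x\<bar> \<le> c}"
    by (rule closure_minimal[OF _ cl]) (use open_le in blast)
  then have le: "\<bar>f y\<bar> \<le> c" if "y \<in> {0..2 * pi}" for y
    using that by (simp add: closure_greaterThanLessThan subset_iff)
  obtain y where "y \<in> {0..<2 * pi}" "f x = f y" using periodic_representative[of f x] per by blast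
  then show ?thesis using le[of y] unfolding Linf_norm_def e_def[symmetric] c by simp
qed

text \<open>A negative essential supremum would bound an absolute value almost everywhere on a set
  of positive measure. An infinite one is sent to 0 by \<open>real_of_ereal\<close>.\<close>

lemma Linf_norm_nonneg:
  fixes f :: "'a::euclidean_space \<Rightarrow> real"
  assumes "emeasure lborel S \<noteq> 0" "S \<in> sets borel"
  shows "0 \<le> Linf_norm S f"
proof -
  let ?M = "restrict_space lborel S"
  have "\<not> esssup ?M (\<lambda>x. ereal \<bar>f x\<bar>) < 0"
  proof
    assume *: "esssup ?M (\<lambda>x. ereal \<bar>f x\<bar>) < 0"
    have "AE x in ?M. ereal \<bar>f x\<bar> \<le> esssup ?M (\<lambda>x. ereal \<bar>f x\<bar>)" by (rule esssup_AE)
    then have "AE x in ?M. False"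
    proof eventually_elim
      case (elim x)
      then have "ereal \<bar>f x\<bar> < 0" using * by (rule le_less_trans)
      then show False by simp
    qed
    then have "emeasure ?M (space ?M) = 0" by (subst (asm) AE_iff_measurable[of "space ?M"]) auto
    then show False using assms by (simp add: space_restrict_space emeasure_restrict_space)
  qed
  then show ?thesis unfolding Linf_norm_def by (simp add: real_of_ereal_pos not_less)
qed

lemma Psi_const_ge:
  assumes "continuous_on UNIV psiI" "\<And>x. psiI (x + 2 * pi) = psiI x"
  shows "psiI x \<le> Psi_const psiO psiI"
proof -
  have "emeasure lborel (({0..<2 * pi} :: real set) \<times> ({0<..<1} :: real set)) \<noteq> 0"
  proof -
    have "emeasure (lborel \<Otimes>\<^sub>M lborel) (({0..<2 * pi} :: real set) \<times> ({0<..<1} :: real set))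
      = emeasure lborel ({0..<2 * pi} :: real set) * emeasure lborel ({0<..<1} :: real set)"
      by (rule lborel.emeasure_pair_measure_Times) auto
    then show ?thesis unfolding lborel_prod by simp
  qed
  then have "0 \<le> Linf_norm ({0..<2 * pi} \<times> {0<..<1}) psiO"
    by (intro Linf_norm_nonneg borel_Times) auto
  moreover have "\<bar>psiI x\<bar> \<le> Linf_norm {0..<2 * pi} psiI" by (rule Linf_norm_ge[OF assms])
  ultimately show ?thesis unfolding Psi_const_def by linarith
qed

lemma weight_fun_torus_smooth:
  assumes psi: "weight_fun_torus J0 psi"
  shows "i < 4 \<Longrightarrow> ((deriv ^^ i) psi has_real_derivative (deriv ^^ Suc i) psi x) (at x)"
    "i \<le> 4 \<Longrightarrow> continuous_on UNIV ((deriv ^^ i) psi)"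
    "(deriv ^^ i) psi (x + 2 * pi) = (deriv ^^ i) psi x"
    "0 < psi x"
proof -
  have per: "psi (x + 2 * pi) = psi x" for x using psi unfolding weight_fun_torus_def periodic_fun_simple_def by blast
  have C4: "Ck_on 4 UNIV psi" using psi unfolding weight_fun_torus_def smooth_on_def by blast
  show "(deriv ^^ i) psi (x + 2 * pi) = (deriv ^^ i) psi x" by (rule deriv_funpow_periodic[of psi "2 * pi"]) (rule per)
  show "((deriv ^^ i) psi has_real_derivative (deriv ^^ Suc i) psi x) (at x)" if "i < 4"
    by (rule Ck_on_has_deriv[OF C4 that])
  show "continuous_on UNIV ((deriv ^^ i) psi)" if "i \<le> 4" by (rule Ck_on_continuous[OF C4 that])
  show "0 < psi x" using psi unfolding weight_fun_torus_def by blast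
qed

lemma weight_fun_torus_bounded:
  assumes psi: "weight_fun_torus J0 psi"
  shows "\<exists>M0\<ge>1. \<forall>i\<le>4. \<forall>x. \<bar>(deriv ^^ i) psi x\<bar> \<le> M0"
proof -
  have "\<exists>B. \<forall>x. \<bar>(deriv ^^ i) psi x\<bar> \<le> B" if "i \<le> 4" for i
    using periodic_continuous_bounded[of "(deriv ^^ i) psi"] weight_fun_torus_smooth(2,3)[OF psi] that by blast
  then obtain B where B: "\<And>i x. i \<le> 4 \<Longrightarrow> \<bar>(deriv ^^ i) psi x\<bar> \<le> B i" by metis
  define M0 where "M0 = 1 + (\<Sum>i\<le>4. B i)"
  have B0: "0 \<le> B i" if "i \<le> 4" for i using order_trans[OF abs_ge_zero B[OF that, of 0]] .
  have "\<bar>(deriv ^^ i) psi x\<bar> \<le> M0" if i: "i \<le> 4" for i x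
  proof -
    have "B i \<le> (\<Sum>i\<le>4. B i)" using i B0 by (intro member_le_sum) auto
    then show ?thesis using B[OF i, of x] unfolding M0_def by linarith
  qed
  moreover have "0 \<le> (\<Sum>i\<le>4. B i)" using B0 by (intro sum_nonneg) auto
  then have "1 \<le> M0" unfolding M0_def by simp
  ultimately show ?thesis by blast
qed

text \<open>One closed period minus the open set \<open>J\<close> is compact and free of critical
  points, so the squared derivative attains a positive minimum there. This minimum sets the level of
  the cutoff.\<close>

lemma weight_fun_torus_noncritical:
  assumes psi: "weight_fun_torus J0 psi" and J: "open_in_torus J" and J0: "closure J0 \<subseteq> J"
  shows "\<exists>gam>0. \<forall>x. x \<notin> J \<longrightarrow> gam \<le> (deriv psi x)^2"
proof -
  have crit: "x \<in> J" if "deriv psi x = 0" for x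
    using psi J0 that closure_subset[of J0] unfolding weight_fun_torus_def by auto
  have perJ: "(x + 2 * pi \<in> J) = (x \<in> J)" for x using J unfolding open_in_torus_def periodic_fun_simple_def by blast
  have cont: "continuous_on UNIV (deriv psi)" and per: "deriv psi (x + 2 * pi) = deriv psi x" for x
    using weight_fun_torus_smooth(2,3)[OF psi, of 1] by simp_all
  have "\<exists>gam>0. \<forall>x\<in>{0..2 * pi} - J. gam \<le> (deriv psi x)^2"
  proof (cases "{0..2 * pi} - J = {}")
    case False
    have "compact ({0..2 * pi} - J)" using J unfolding open_in_torus_def by (intro compact_diff) auto
    moreover have "continuous_on ({0..2 * pi} - J) (\<lambda>x. (deriv psi x)^2)"
      by (intro continuous_intros continuous_on_subset[OF cont]) auto
    ultimately obtain y where y: "y \<in> {0..2 * pi} - J" "\<And>x. x \<in> {0..2 * pi} - J \<Longrightarrow> (deriv psi y)^2 \<le> (deriv psi x)^2"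
      using continuous_attains_inf[of "{0..2 * pi} - J" "\<lambda>x. (deriv psi x)^2"] False by blast
    then have "deriv psi y \<noteq> 0" using crit[of y] by blast
    then have "0 < (deriv psi y)^2" by simp
    then show ?thesis using y(2) by blast
  next
    case True
    show ?thesis unfolding True by (rule exI[of _ 1]) simp
  qed
  then obtain gam where gam: "0 < gam" "\<And>x. x \<in> {0..2 * pi} - J \<Longrightarrow> gam \<le> (deriv psi x)^2" by blast
  have "gam \<le> (deriv psi x)^2" if "x \<notin> J" for x
  proof -
    \<comment> \<open>Applied to a pair, so that one representative serves both the membership in
      \<open>J\<close> and the value of the derivative.\<close>
    obtain y where y: "y \<in> {0..<2 * pi}" "(x \<in> J, deriv psi x) = (y \<in> J, deriv psi y)"
      by (rule periodic_representative[of "\<lambda>x. (x \<in> J, deriv psi x)" x]) (use perJ per in auto)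
    then show ?thesis using gam(2)[of y] that by auto
  qed
  then show ?thesis using gam(1) by blast
qed

section \<open>The Carleman estimate\<close>

lemma (in weighted_strip) wint_localised:
  assumes f: "tame T f" and g: "tame T (\<lambda>t. g)" and nn: "\<And>t x. t \<in> {0<..<T} \<Longrightarrow> 0 \<le> f t x"
    and B: "\<And>x. g x \<le> B" "0 \<le> B" "\<And>x. x \<notin> J \<Longrightarrow> g x \<le> 0" and J: "J \<in> sets borel"
  shows "wint (\<lambda>t x. g x * f t x) \<le> B * integral_cyl T J (\<lambda>t x. exp (2 * kap t x) * f t x)"
proof -
  let ?C = "{0<..<T} \<times> (J \<inter> {0..<2 * pi})"
  let ?h = "\<lambda>(t, x). exp (2 * kap t x) * f t x" and ?l = "\<lambda>(t, x). exp (2 * kap t x) * (g x * f t x)"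
  have 1: "integrable lborel (\<lambda>z. indicator cell z *\<^sub>R ?l z)"
    using wint_integrable[OF tame_mult[OF g f]] unfolding set_integrable_def .
  have 2: "integrable lborel (\<lambda>z. indicator ?C z *\<^sub>R ?h z)"
    using integrable_indicator[OF f J] unfolding set_integrable_def .
  have "wint (\<lambda>t x. g x * f t x) = (\<integral>z. indicator cell z *\<^sub>R ?l z \<partial>lborel)"
    unfolding wint_def integral_cyl_def set_lebesgue_integral_def by simp
  also have "\<dots> \<le> (\<integral>z. B * (indicator ?C z *\<^sub>R ?h z) \<partial>lborel)"
  proof (rule integral_mono[OF 1])
    show "integrable lborel (\<lambda>z. B * (indicator ?C z *\<^sub>R ?h z))" using 2 by simp
    fix z :: "real \<times> real"
    obtain t x where z: "z = (t, x)" by fastforce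
    show "indicator cell z *\<^sub>R ?l z \<le> B * (indicator ?C z *\<^sub>R ?h z)"
    proof (cases "z \<in> cell")
      case True
      then have t: "t \<in> {0<..<T}" unfolding z by auto
      have e: "0 \<le> exp (2 * kap t x) * f t x" using nn[OF t] by simp
      show ?thesis
      proof (cases "x \<in> J")
        case True
        then have "z \<in> ?C" using \<open>z \<in> cell\<close> unfolding z by auto
        moreover have "g x * (exp (2 * kap t x) * f t x) \<le> B * (exp (2 * kap t x) * f t x)"
          by (rule mult_right_mono[OF B(1) e])
        ultimately show ?thesis using \<open>z \<in> cell\<close> unfolding z by (simp add: mult.left_commute)
      next
        case False
        then have "z \<notin> ?C" unfolding z by auto
        moreover have "g x * (exp (2 * kap t x) * f t x) \<le> 0"
          by (rule mult_nonpos_nonneg[OF B(3)[OF False] e])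
        ultimately show ?thesis using \<open>z \<in> cell\<close> unfolding z by (simp add: mult.left_commute)
      qed
    next
      case False
      then have "z \<notin> ?C" by auto
      then show ?thesis using False by simp
    qed
  qed
  also have "\<dots> = B * integral_cyl T J (\<lambda>t x. exp (2 * kap t x) * f t x)"
    unfolding integral_cyl_def set_lebesgue_integral_def by simp
  finally show ?thesis .
qed

text \<open>\<open>s_ge\<close> is the condition on s with 1 / \<open>del\<close> as threshold.
  \<open>mu_gam\<close> lets the square of \<open>mu * p x\<close> dominate \<open>mu * q x\<close>
  wherever the square of \<open>p x\<close> is at least \<open>gam / 2\<close>.\<close>

locale beam_carleman = beam_weight +
  fixes N :: "nat \<Rightarrow> nat \<Rightarrow> real \<Rightarrow> real \<Rightarrow> real" and al del gam :: real
  assumes N_dx: "\<And>i j t x. i \<le> 2 \<Longrightarrow> j < 4 \<Longrightarrow> t \<in> {0<..<T} \<Longrightarrow> (N i j t has_real_derivative N i (Suc j) t x) (at x)"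
    and N_dt: "\<And>i j t x. i < 2 \<Longrightarrow> j \<le> 4 \<Longrightarrow> t \<in> {0<..<T} \<Longrightarrow> ((\<lambda>r. N i j r x) has_real_derivative N (Suc i) j t x) (at t)"
    and N_tame: "\<And>i j. i \<le> 2 \<Longrightarrow> j \<le> 4 \<Longrightarrow> tame T (N i j)"
    and al: "0 \<le> al" and del: "0 < del" "del \<le> 1"
    and s_ge: "s \<ge> 1 / del * (1 + al) * (T powr k + T powr (k - 1))"
    and gam: "0 < gam" and mu_gam: "4 * M0 / gam \<le> mu"
begin

lemma N_x:
  assumes t: "t \<in> {0<..<T}"
  shows "(N 0 0 t has_real_derivative N 0 1 t x) (at x)" "(N 0 1 t has_real_derivative N 0 2 t x) (at x)"
    "(N 0 2 t has_real_derivative N 0 3 t x) (at x)" "(N 0 3 t has_real_derivative N 0 4 t x) (at x)"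
    "(N 1 0 t has_real_derivative N 1 1 t x) (at x)" "(N 1 1 t has_real_derivative N 1 2 t x) (at x)"
    "(N 1 2 t has_real_derivative N 1 3 t x) (at x)"
    "(N 2 0 t has_real_derivative N 2 1 t x) (at x)"
proof -
  have e: "Suc 0 = 1" "Suc 1 = 2" "Suc 2 = 3" "Suc 3 = 4" by simp_all
  have n: "0 \<le> (2::nat)" "1 \<le> (2::nat)" "2 \<le> (2::nat)" "0 < (4::nat)" "1 < (4::nat)" "2 < (4::nat)" "3 < (4::nat)" by simp_all
  show "(N 0 0 t has_real_derivative N 0 1 t x) (at x)" by (rule N_dx[OF n(1) n(4) t, unfolded e])
  show "(N 0 1 t has_real_derivative N 0 2 t x) (at x)" by (rule N_dx[OF n(1) n(5) t, unfolded e])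
  show "(N 0 2 t has_real_derivative N 0 3 t x) (at x)" by (rule N_dx[OF n(1) n(6) t, unfolded e])
  show "(N 0 3 t has_real_derivative N 0 4 t x) (at x)" by (rule N_dx[OF n(1) n(7) t, unfolded e])
  show "(N 1 0 t has_real_derivative N 1 1 t x) (at x)" by (rule N_dx[OF n(2) n(4) t, unfolded e])
  show "(N 1 1 t has_real_derivative N 1 2 t x) (at x)" by (rule N_dx[OF n(2) n(5) t, unfolded e])
  show "(N 1 2 t has_real_derivative N 1 3 t x) (at x)" by (rule N_dx[OF n(2) n(6) t, unfolded e])
  show "(N 2 0 t has_real_derivative N 2 1 t x) (at x)" by (rule N_dx[OF n(3) n(4) t, unfolded e])
qed

lemma N_t:
  assumes t: "t \<in> {0<..<T}" and j: "j \<le> 4"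
  shows "((\<lambda>r. N 0 j r x) has_real_derivative N 1 j t x) (at t)" "((\<lambda>r. N 1 j r x) has_real_derivative N 2 j t x) (at t)"
  using N_dt[OF _ j t, of 0 x] N_dt[OF _ j t, of 1 x] by (simp_all add: eval_nat_numeral)

lemmas dx_rules = wa_dx wb_dx wb1_dx wth_dx wd_dx sig_dx N_x
lemmas dt_rules = wa_dt wb_dt wb1_dt wth_dt wh_dt sig_dt N_t

end

section \<open>Differentiation rules for the conjugated jets\<close>

lemma conj0_dx:
  "(u0 has_real_derivative u1) (at x) \<Longrightarrow> (u0 has_real_derivative conj1 a (u0 x) u1 - a * u0 x) (at x)" for u0 :: "real \<Rightarrow> real"
  unfolding conj1_def by simp

lemma conj1_dx:
  fixes a u0 u1 :: "real \<Rightarrow> real"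
  assumes "(a has_real_derivative b) (at x)" "(u0 has_real_derivative u1 x) (at x)" "(u1 has_real_derivative u2) (at x)"
  shows "((\<lambda>x. conj1 (a x) (u0 x) (u1 x)) has_real_derivative conj2 (a x) b (u0 x) (u1 x) u2 - a x * conj1 (a x) (u0 x) (u1 x)) (at x)"
  unfolding conj1_def conj2_def
  by (rule DERIV_cong, (rule derivative_eq_intros assms refl)+) (simp add: algebra_simps power2_eq_square)

lemma conj2_dx:
  fixes a b u0 u1 u2 :: "real \<Rightarrow> real"
  assumes "(a has_real_derivative b x) (at x)" "(b has_real_derivative b1) (at x)"
    "(u0 has_real_derivative u1 x) (at x)" "(u1 has_real_derivative u2 x) (at x)" "(u2 has_real_derivative u3) (at x)"
  shows "((\<lambda>x. conj2 (a x) (b x) (u0 x) (u1 x) (u2 x)) has_real_derivative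
    conj3 (a x) (b x) b1 (u0 x) (u1 x) (u2 x) u3 - a x * conj2 (a x) (b x) (u0 x) (u1 x) (u2 x)) (at x)"
  unfolding conj2_def conj3_def
  by (rule DERIV_cong, (rule derivative_eq_intros assms refl)+) (simp add: algebra_simps eval_nat_numeral)

lemma conj3_dx:
  fixes a b b1 u0 u1 u2 u3 :: "real \<Rightarrow> real"
  assumes "(a has_real_derivative b x) (at x)" "(b has_real_derivative b1 x) (at x)" "(b1 has_real_derivative b2) (at x)"
    "(u0 has_real_derivative u1 x) (at x)" "(u1 has_real_derivative u2 x) (at x)" "(u2 has_real_derivative u3 x) (at x)"
    "(u3 has_real_derivative u4) (at x)"
  shows "((\<lambda>x. conj3 (a x) (b x) (b1 x) (u0 x) (u1 x) (u2 x) (u3 x)) has_real_derivative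
    conj4 (a x) (b x) (b1 x) b2 (u0 x) (u1 x) (u2 x) (u3 x) u4 - a x * conj3 (a x) (b x) (b1 x) (u0 x) (u1 x) (u2 x) (u3 x)) (at x)"
  unfolding conj3_def conj4_def
  by (rule DERIV_cong, (rule derivative_eq_intros assms refl)+) (simp add: algebra_simps eval_nat_numeral)

context beam_carleman begin

text \<open>
  \<open>V0, \<dots>, V3\<close> and \<open>U0, U1\<close> are the \<open>x\<close>-jets of \<open>e\<^sup>-\<^sup>\<kappa> \<partial>\<^sub>t (e\<^sup>\<kappa> \<eta>)\<close> and \<open>e\<^sup>-\<^sup>\<kappa> \<partial>\<^sub>t\<^sup>2 (e\<^sup>\<kappa> \<eta>)\<close> before the spatial
  conjugation.
\<close>

definition V0 where "V0 t x = N 1 0 t x + wth t x * N 0 0 t x"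
definition V1 where "V1 t x = N 1 1 t x + wth t x * N 0 1 t x + wh t * wa t x * N 0 0 t x"
definition V2 where "V2 t x = N 1 2 t x + wth t x * N 0 2 t x + 2 * wh t * wa t x * N 0 1 t x + wh t * wb t x * N 0 0 t x"
definition V3 where "V3 t x = N 1 3 t x + wth t x * N 0 3 t x + 3 * wh t * wa t x * N 0 2 t x + 3 * wh t * wb t x * N 0 1 t x + wh t * wb1 t x * N 0 0 t x"
definition U0 where "U0 t x = N 2 0 t x + 2 * wth t x * N 1 0 t x + (wd t x + wth t x^2) * N 0 0 t x"
definition U1 where "U1 t x = N 2 1 t x + 2 * wth t x * N 1 1 t x + 2 * wh t * wa t x * N 1 0 t x
   + (wd t x + wth t x^2) * N 0 1 t x + (we t * wa t x + 2 * wth t x * wh t * wa t x) * N 0 0 t x"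
definition W01 where "W01 t x = conj1 (wa t x) (N 0 0 t x) (N 0 1 t x)"
definition W02 where "W02 t x = conj2 (wa t x) (wb t x) (N 0 0 t x) (N 0 1 t x) (N 0 2 t x)"
definition W03 where "W03 t x = conj3 (wa t x) (wb t x) (wb1 t x) (N 0 0 t x) (N 0 1 t x) (N 0 2 t x) (N 0 3 t x)"
definition W04 where "W04 t x = conj4 (wa t x) (wb t x) (wb1 t x) (wb2 t x) (N 0 0 t x) (N 0 1 t x) (N 0 2 t x) (N 0 3 t x) (N 0 4 t x)"
definition W11 where "W11 t x = conj1 (wa t x) (V0 t x) (V1 t x)"
definition W12 where "W12 t x = conj2 (wa t x) (wb t x) (V0 t x) (V1 t x) (V2 t x)"
definition W13 where "W13 t x = conj3 (wa t x) (wb t x) (wb1 t x) (V0 t x) (V1 t x) (V2 t x) (V3 t x)"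
definition W21 where "W21 t x = conj1 (wa t x) (U0 t x) (U1 t x)"

lemma V_dx:
  assumes "t \<in> {0<..<T}"
  shows "(V0 t has_real_derivative V1 t x) (at x)" "(V1 t has_real_derivative V2 t x) (at x)"
    "(V2 t has_real_derivative V3 t x) (at x)" "(U0 t has_real_derivative U1 t x) (at x)"
  unfolding V0_def[abs_def] V1_def[abs_def] V2_def[abs_def] V3_def U0_def[abs_def] U1_def
  by (rule DERIV_cong, (rule derivative_eq_intros dx_rules assms refl)+, simp add: algebra_simps power2_eq_square)+

lemma W_dx:
  assumes "t \<in> {0<..<T}"
  shows "(N 0 0 t has_real_derivative W01 t x - wa t x * N 0 0 t x) (at x)"
    "(W01 t has_real_derivative W02 t x - wa t x * W01 t x) (at x)"
    "(W02 t has_real_derivative W03 t x - wa t x * W02 t x) (at x)"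
    "(W03 t has_real_derivative W04 t x - wa t x * W03 t x) (at x)"
    "(V0 t has_real_derivative W11 t x - wa t x * V0 t x) (at x)"
    "(W11 t has_real_derivative W12 t x - wa t x * W11 t x) (at x)"
    "(W12 t has_real_derivative W13 t x - wa t x * W12 t x) (at x)"
    "(U0 t has_real_derivative W21 t x - wa t x * U0 t x) (at x)"
  unfolding W01_def[abs_def] W02_def[abs_def] W03_def[abs_def] W04_def W11_def[abs_def] W12_def[abs_def] W13_def W21_def
  by (rule conj0_dx conj1_dx conj2_dx conj3_dx V_dx dx_rules assms)+

text \<open>Conjugation treats t and x alike, and the t-derivative of \<open>wa\<close> equals the
  x-derivative of \<open>wth\<close>; so the mixed jets follow the same rule in t as in x.\<close>

lemma W_dt:
  assumes "t \<in> {0<..<T}"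
  shows "((\<lambda>t. N 0 0 t x) has_real_derivative V0 t x - wth t x * N 0 0 t x) (at t)"
    "((\<lambda>t. W01 t x) has_real_derivative W11 t x - wth t x * W01 t x) (at t)"
    "((\<lambda>t. W02 t x) has_real_derivative W12 t x - wth t x * W02 t x) (at t)"
    "((\<lambda>t. W03 t x) has_real_derivative W13 t x - wth t x * W03 t x) (at t)"
    "((\<lambda>t. V0 t x) has_real_derivative U0 t x - wth t x * V0 t x) (at t)"
    "((\<lambda>t. W11 t x) has_real_derivative W21 t x - wth t x * W11 t x) (at t)"
  unfolding W01_def W02_def W03_def W11_def W12_def W13_def W21_def conj1_def conj2_def conj3_def
     V0_def V1_def V2_def V3_def U0_def U1_def
  by (rule DERIV_cong, (rule derivative_eq_intros dt_rules assms refl | (simp; fail))+, simp add: algebra_simps eval_nat_numeral)+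

lemma tame_N [intro]:
  "tame T (N 0 0)" "tame T (N 0 1)" "tame T (N 0 2)" "tame T (N 0 3)" "tame T (N 0 4)"
  "tame T (N 1 0)" "tame T (N 1 1)" "tame T (N 1 2)" "tame T (N 1 3)" "tame T (N 2 0)" "tame T (N 2 1)"
  by (rule N_tame; simp)+

lemma tame_V [intro]: "tame T V0" "tame T V1" "tame T V2" "tame T V3" "tame T U0" "tame T U1"
  unfolding V0_def[abs_def] V1_def[abs_def] V2_def[abs_def] V3_def[abs_def] U0_def[abs_def] U1_def[abs_def]
  by (intro tame_add tame_mult tame_power tame_const tame_N tame_wth tame_wh tame_wa tame_we)+

lemma tame_W [intro]: "tame T W01" "tame T W02" "tame T W03" "tame T W04" "tame T W11" "tame T W12" "tame T W13" "tame T W21"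
  unfolding W01_def[abs_def] W02_def[abs_def] W03_def[abs_def] W04_def[abs_def] W11_def[abs_def] W12_def[abs_def] W13_def[abs_def] W21_def[abs_def]
    conj1_def conj2_def conj3_def conj4_def
  by (intro tame_add tame_mult tame_power tame_const tame_N tame_V tame_wa)+

definition Xdiv where "Xdiv t x =
   symm_part al (wa t x) (wth t x) (N 0 0 t x) (W02 t x) (W04 t x) (W11 t x) (U0 t x)
     * anti_part al (wa t x) (wb t x) (wth t x) (N 0 0 t x) (W01 t x) (W02 t x) (W03 t x) (V0 t x) (W12 t x)
   - comm_main al (wa t x) (wb t x) (N 0 0 t x) (W01 t x) (W02 t x) (W03 t x) (V0 t x) (W11 t x)
   - comm_err al (wa t x) (wb t x) (wb1 t x) (wh t) (wth t x) (wd t x) (N 0 0 t x) (W01 t x) (W02 t x) (W03 t x) (V0 t x) (W11 t x)"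

definition Tdiv where "Tdiv t x = flux_t_deriv al (wa t x) (wb t x) (wh t) (wth t x) (wd t x)
   (N 0 0 t x) (W01 t x) (W02 t x) (W03 t x) (V0 t x) (W11 t x) (W12 t x) (W13 t x) (U0 t x) (W21 t x)"

lemma tame_Xdiv: "tame T Xdiv"
  unfolding Xdiv_def[abs_def] symm_part_def anti_part_def comm_main_def comm_err_def
  by (intro tame_add tame_diff tame_uminus tame_mult tame_power tame_const tame_N tame_V tame_W tame_wth tame_wh tame_wa)

lemma tame_Tdiv: "tame T Tdiv"
  unfolding Tdiv_def[abs_def] flux_t_deriv_def
  by (intro tame_add tame_diff tame_uminus tame_mult tame_power tame_const tame_N tame_V tame_W tame_wth tame_wh tame_wa)

text \<open>\<open>Xdiv\<close> minus \<open>Tdiv\<close> is an x-divergence by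
  \<open>flux_x_deriv\<close>, and \<open>Tdiv\<close> a t-divergence by
  \<open>flux_t_has_deriv\<close>.\<close>

lemma wint_Xdiv: "wint Xdiv = 0"
proof -
  let ?F = "\<lambda>t x. flux_x al (wa t x) (wb t x) (wth t x) (N 0 0 t x) (W01 t x) (W02 t x) (W03 t x) (V0 t x) (W11 t x) (W12 t x) (U0 t x)"
  let ?G = "\<lambda>t x. flux_t al (wa t x) (wb t x) (wth t x) (N 0 0 t x) (W01 t x) (W02 t x) (W03 t x) (V0 t x) (W11 t x)"
  have F: "tame T ?F" unfolding flux_x_def
    by (intro tame_add tame_diff tame_uminus tame_mult tame_power tame_const tame_N tame_V tame_W tame_wth tame_wh tame_wa)
  have G: "tame T ?G" unfolding flux_t_def
    by (intro tame_add tame_diff tame_uminus tame_mult tame_power tame_const tame_N tame_V tame_W tame_wth tame_wh tame_wa)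
  have D: "tame T (\<lambda>t x. Xdiv t x - Tdiv t x)" by (intro tame_diff tame_Xdiv tame_Tdiv)
  have 1: "wint (\<lambda>t x. Xdiv t x - Tdiv t x) = 0"
  proof (rule wint_dx[OF F D])
    fix t x assume t: "t \<in> {0<..<T}"
    show "(?F t has_real_derivative Xdiv t x - Tdiv t x - 2 * wa t x * ?F t x) (at x)"
      unfolding Xdiv_def Tdiv_def
      by (rule flux_x_deriv[where h = "wh t" and d = "wd t x"]) (rule W_dx[OF t] dx_rules)+
  qed
  have 2: "wint Tdiv = 0"
  proof (rule wint_dt[OF G tame_Tdiv])
    fix t x assume t: "t \<in> {0<..<T}"
    show "((\<lambda>r. ?G r x) has_real_derivative Tdiv t x - 2 * wth t x * ?G t x) (at t)"
      unfolding Tdiv_def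
      by (rule flux_t_has_deriv) (rule W_dt[OF t] dt_rules[OF t] | (simp; fail))+
  qed
  show ?thesis using wint_add[OF D tame_Tdiv] 1 2 by simp
qed

end

context beam_carleman begin

definition MA where "MA = 15 * M0^4 + k^2"
text \<open>One constant for all multipliers. \<open>5 * MA\<close> bounds the time derivatives;
  \<open>14 * M0\<close> and \<open>16 * M0^2 / gam\<close> bound the factors \<open>vf\<close> of
  the local lemmas, the latter as 4 times the \<open>4 * M0^2 / gam\<close> of
  \<open>gamma_bound\<close>. The summand 4 makes \<open>MM^6\<close> large enough for
  \<open>weighted_estimate\<close>.\<close>

definition MM where "MM = 5 * MA + 14 * M0 + 16 * M0^2 / gam + 4"
text \<open>
  A cutoff that vanishes off the control region and is at least \<open>1\<close> where \<open>p\<close> is too small for the commutator to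
  be coercive; its powers are continuously differentiable.
\<close>

definition G where "G x = max 0 (2 / gam * (gam - p x^2))"
definition Pf where "Pf t x = N 2 0 t x - al * N 1 2 t x + N 0 4 t x"
definition Xf where "Xf t x = eps t x * xenergy (rho t x) (N 0 0 t x) (N 0 1 t x) (N 0 2 t x) (N 0 3 t x)"
definition T0f where "T0f t x = eps t x * (rho t x^2 * N 1 0 t x)^2"
definition T1f where "T1f t x = eps t x * (rho t x * N 1 1 t x)^2"
text \<open>Orders zero and one carry \<open>G x^2\<close>, the other local terms
  \<open>G x^4\<close>: differentiating the cutoff costs a power of it, and what remains must still
  be bounded by the cutoff of the next lower order.\<close>

definition L0f where "L0f t x = eps t x * (G x^2 * (rho t x^4 * N 0 0 t x)^2)"
definition M1f where "M1f t x = eps t x * (G x^2 * (rho t x^3 * N 0 1 t x)^2)"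
definition M2f where "M2f t x = eps t x * (G x^4 * (rho t x^2 * N 0 2 t x)^2)"
definition Lsf where "Lsf t x = eps t x * (G x^4 * ((rho t x * N 0 3 t x)^2 + (1 + al)^2 * ((rho t x^2 * N 1 0 t x)^2 + (rho t x * N 1 1 t x)^2)))"
definition Jf where "Jf t x = eps t x * ((rho t x^4 * N 0 0 t x)^2 + (rho t x * N 0 3 t x)^2 + (1 + al^2) * ((rho t x^2 * N 1 0 t x)^2 + (rho t x * N 1 1 t x)^2))"

lemma adm:
  assumes "t \<in> {0<..<T}"
  shows "admissible MA (rho t x) (eps t x) del al (wa t x) (wb t x) (wb1 t x) (wb2 t x) (wh t) (wth t x) (wd t x)"
    and sig1: "1 \<le> sig t x" and mu_rho: "mu \<le> rho t x"
  using weight_admissible[OF del al assms s_ge, of x] unfolding MA_def .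

lemma MA: "1 \<le> MA" and M0_MM: "14 * M0 \<le> MM" and MM: "4 \<le> MM" "1 \<le> MM" "5 * MA \<le> MM" "10 * M0 + 16 * M0^2 / gam \<le> MM"
proof -
  have "1 \<le> M0^4" by (rule one_le_power[OF psi_bound(5)])
  then show MA: "1 \<le> MA" unfolding MA_def using zero_le_power2[of k] by linarith
  have "0 \<le> 16 * M0^2 / gam" using gam by simp
  then show "14 * M0 \<le> MM" "4 \<le> MM" "1 \<le> MM" "5 * MA \<le> MM" "10 * M0 + 16 * M0^2 / gam \<le> MM"
    using MA psi_bound(5) unfolding MM_def by linarith+
qed

lemma pos:
  assumes "t \<in> {0<..<T}"
  shows "0 < eps t x" "eps t x \<le> 1" "1 \<le> rho t x" "0 < rho t x" "eps t x * rho t x = mu"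
proof -
  note 1 = sig1[OF assms, of x] mu_rho[OF assms, of x]
  show "0 < eps t x" "eps t x \<le> 1" unfolding eps_def using 1 by auto
  show "1 \<le> rho t x" "0 < rho t x" using 1 mu by linarith+
  show "eps t x * rho t x = mu" unfolding eps_def rho_def using 1 by simp
qed

lemma wa_eq: "wa t x = p x * rho t x" unfolding wa_def rho_def by simp

lemma rho_dx: "(rho t has_real_derivative mu * (p x * rho t x)) (at x)"
  unfolding rho_def[abs_def] by (rule DERIV_cong[OF DERIV_cmult[OF sig_dx]]) (simp add: wa_eq rho_def)

lemma rho_dt: "t \<in> {0<..<T} \<Longrightarrow> ((\<lambda>t. rho t x) has_real_derivative wh t * rho t x) (at t)"
  unfolding rho_def by (rule DERIV_cong[OF DERIV_cmult[OF sig_dt]]) simp_all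

text \<open>Both \<open>1 / (1 + al)\<close> and \<open>al / (1 + al)\<close> are at most 1, so the
  bounds in \<open>admissible\<close> tolerate an extra factor \<open>al\<close>.\<close>

lemma time_bounds:
  assumes t: "t \<in> {0<..<T}"
  shows "\<bar>wh t\<bar> \<le> MA * rho t x^2" "\<bar>wth t x\<bar> \<le> MA * rho t x^2"
    "al * \<bar>wh t\<bar> \<le> MA * rho t x^2" "al * \<bar>wth t x\<bar> \<le> MA * rho t x^2"
proof -
  note p = pos[OF t, of x]
  have h: "\<bar>wh t\<bar> \<le> MA * (eps t x * del * rho t x^2 / (1 + al))" and th: "\<bar>wth t x\<bar> \<le> MA * (del * rho t x^2 / (1 + al))"
    using adm[OF t, of x] unfolding admissible_def by blast+
  define z where "z = MA * (rho t x^2 / (1 + al))"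
  have z0: "0 \<le> z" unfolding z_def using MA al by simp
  have zz: "z \<le> MA * rho t x^2" "al * z \<le> MA * rho t x^2"
  proof -
    have 1: "rho t x^2 / (1 + al) \<le> rho t x^2" "al * (rho t x^2 / (1 + al)) \<le> rho t x^2"
      using al by (auto simp: field_simps)
    have "0 \<le> MA" using MA by simp
    note 1[THEN mult_left_mono, OF this]
    then have "MA * (rho t x^2 / (1 + al)) \<le> MA * rho t x^2" "MA * (al * (rho t x^2 / (1 + al))) \<le> MA * rho t x^2"
      by blast+
    then show "z \<le> MA * rho t x^2" "al * z \<le> MA * rho t x^2" unfolding z_def by (auto simp: ac_simps)
  qed
  have "\<bar>wth t x\<bar> \<le> del * z" using th unfolding z_def by (simp add: ac_simps)
  also have "\<dots> \<le> 1 * z" using del z0 by (intro mult_right_mono) auto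
  finally have th': "\<bar>wth t x\<bar> \<le> z" by simp
  have "\<bar>wh t\<bar> \<le> (eps t x * del) * z" using h unfolding z_def by (simp add: ac_simps)
  also have "\<dots> \<le> 1 * z" using del z0 p by (intro mult_right_mono mult_le_one) auto
  finally have h': "\<bar>wh t\<bar> \<le> z" by simp
  show "\<bar>wh t\<bar> \<le> MA * rho t x^2" "\<bar>wth t x\<bar> \<le> MA * rho t x^2" using h' th' zz by linarith+
  show "al * \<bar>wh t\<bar> \<le> MA * rho t x^2" "al * \<bar>wth t x\<bar> \<le> MA * rho t x^2"
    using mult_left_mono[OF h' al] mult_left_mono[OF th' al] zz(2) by linarith+
qed

lemma G_bounds: "0 \<le> G x" "G x \<le> 2" "G x \<le> MM"
proof -
  show "0 \<le> G x" unfolding G_def by simp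
  have "2 / gam * (gam - p x^2) \<le> 2 / gam * gam" using gam by (intro mult_left_mono) auto
  then show "G x \<le> 2" unfolding G_def using gam by simp
  then show "G x \<le> MM" using MM by linarith
qed

lemma G_zero: "gam \<le> p x^2 \<Longrightarrow> G x = 0"
proof -
  assume "gam \<le> p x^2"
  then have "2 / gam * (gam - p x^2) \<le> 0" using gam by (intro mult_nonneg_nonpos) auto
  then show ?thesis unfolding G_def by simp
qed

lemma G_one: "p x^2 \<le> gam / 2 \<Longrightarrow> 1 \<le> G x"
proof -
  assume "p x^2 \<le> gam / 2"
  then have "2 / gam * (gam / 2) \<le> 2 / gam * (gam - p x^2)" using gam by (intro mult_left_mono) auto
  then show ?thesis unfolding G_def using gam by simp
qed

lemma G_power_dx:
  assumes "2 \<le> n"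
  shows "((\<lambda>x. G x^n) has_real_derivative real n * G x^(n - 1) * (2 / gam * (- 2 * p x * q x))) (at x)"
proof -
  have "((\<lambda>x. 2 / gam * (gam - p x^2)) has_real_derivative 2 / gam * (- 2 * p x * q x)) (at x)"
    by (rule DERIV_cong, (rule derivative_eq_intros psi_deriv refl)+) simp
  from DERIV_chain2[OF pos_part_power_deriv[OF assms] this] show ?thesis unfolding G_def .
qed

lemma tame_G [intro]: "tame T (\<lambda>t. G)"
proof (rule tame_space)
  have "continuous_on UNIV p" using psi_deriv(2) by (auto intro!: DERIV_isCont continuous_at_imp_continuous_on)
  then show "continuous_on UNIV G" unfolding G_def[abs_def] by (intro continuous_intros)
  show "G (x + 2 * pi) = G x" for x unfolding G_def psi_periodic ..
  show "\<bar>G x\<bar> \<le> 2" for x using G_bounds[of x] by simp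
qed

lemma tame_eps [intro]: "tame T eps"
proof -
  have c: "continuous_on ({0<..<T} \<times> UNIV) (\<lambda>z. sig (fst z) (snd z))" and per: "\<And>t x. t \<in> {0<..<T} \<Longrightarrow> sig t (x + 2 * pi) = sig t x"
    using tame_sig unfolding tame_def by blast+
  have "continuous_on ({0<..<T} \<times> UNIV) (\<lambda>z. 1 / sig (fst z) (snd z))"
    by (intro continuous_intros c) (use sig_pos in \<open>force simp: less_le\<close>)
  moreover have "\<exists>C m. \<forall>t\<in>{0<..<T}. \<forall>x. \<bar>eps t x\<bar> \<le> C * (1 + 1 / ell T t) ^ m"
    using pos by (intro exI[of _ 1] exI[of _ "0::nat"]) (auto simp: abs_of_pos)
  ultimately show ?thesis using per unfolding tame_def eps_def by simp
qed

lemmas tame_basic = tame_add tame_diff tame_uminus tame_mult tame_power tame_const tame_N tame_wth tame_wh tame_wa tame_p tame_rho tame_eps tame_G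

lemma tame_energies [simp]:
  "tame T Xf" "tame T T0f" "tame T T1f" "tame T L0f" "tame T M1f" "tame T M2f" "tame T Lsf" "tame T Jf" "tame T (\<lambda>t x. Pf t x^2)"
  unfolding Xf_def[abs_def] T0f_def[abs_def] T1f_def[abs_def] L0f_def[abs_def] M1f_def[abs_def] M2f_def[abs_def] Lsf_def[abs_def] Jf_def[abs_def]
    Pf_def[abs_def] xenergy_def
  by (intro tame_basic)+

lemma energies_nonneg:
  assumes t: "t \<in> {0<..<T}"
  shows "0 \<le> Xf t x" "0 \<le> T0f t x" "0 \<le> T1f t x" "0 \<le> L0f t x" "0 \<le> M1f t x" "0 \<le> M2f t x" "0 \<le> Lsf t x" "0 \<le> Jf t x"
  unfolding Xf_def T0f_def T1f_def L0f_def M1f_def M2f_def Lsf_def Jf_def xenergy_def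
  using pos(1)[OF t, of x] by simp_all

lemma wint_energies_nonneg:
  "0 \<le> wint Xf" "0 \<le> wint T0f" "0 \<le> wint T1f" "0 \<le> wint L0f" "0 \<le> wint M1f" "0 \<le> wint M2f" "0 \<le> wint Lsf"
  "0 \<le> wint (\<lambda>t x. Pf t x^2)"
  by (rule wint_nonneg; simp add: energies_nonneg)+

lemma wint_divergence:
  assumes "tame T F" "tame T H" "tame T A" "tame T B"
    and "\<And>t x. t \<in> {0<..<T} \<Longrightarrow> (F t has_real_derivative A t x - 2 * (p x * rho t x) * F t x) (at x)"
    and "\<And>t x. t \<in> {0<..<T} \<Longrightarrow> ((\<lambda>r. H r x) has_real_derivative B t x - 2 * wth t x * H t x) (at t)"
  shows "wint (\<lambda>t x. A t x + B t x) = 0"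
  using wint_dx[OF assms(1,3)] wint_dt[OF assms(2,4)] assms(5,6) wint_add[OF assms(3,4)] unfolding wa_eq by simp

lemma wint_x_divergence:
  assumes "tame T F" "tame T A"
    and "\<And>t x. t \<in> {0<..<T} \<Longrightarrow> (F t has_real_derivative A t x - 2 * (p x * rho t x) * F t x) (at x)"
  shows "wint A = 0"
  using wint_dx[OF assms(1,2)] assms(3) unfolding wa_eq by simp

text \<open>\<open>G x^4\<close> plays the role of \<open>chi\<close>. Where it is below 1,
  \<open>p x^2\<close> exceeds \<open>gam / 2\<close>, and \<open>mu_gam\<close> makes
  \<open>mu^2 * p x^2 + mu * q x\<close> at least \<open>mu^2 * (gam / 4)\<close>; hence
  \<open>min 1 (gam / 4)\<close>. The factor 4 arises from \<open>G x^4\<close> being at most 4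
  times \<open>G x^2\<close>, as \<open>G\<close> is at most 2.\<close>

lemma energy_carleman:
  assumes pc: "pointwise_carleman MA (min 1 (gam / 4)) c K" and K: "0 \<le> K"
  shows "c * (wint Xf + al^2 * wint T1f) \<le> wint (\<lambda>t x. Pf t x^2)
    + K * (al^2 * wint T0f + (4 * (wint L0f + wint M1f) + wint M2f + wint Lsf) + del * (wint Xf + (1 + al)^2 * (wint T0f + wint T1f)))"
proof -
  have pw: "c * (Xf t x + al^2 * T1f t x) + Xdiv t x \<le> Pf t x^2
    + K * (al^2 * T0f t x + (4 * (L0f t x + M1f t x) + M2f t x + Lsf t x) + del * (Xf t x + (1 + al)^2 * (T0f t x + T1f t x)))"
    if t: "t \<in> {0<..<T}" for t x
  proof -
    define xe where "xe = xenergy (rho t x) (N 0 0 t x) (N 0 1 t x) (N 0 2 t x) (N 0 3 t x)"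
    define te where "te = tenergy (rho t x) (N 1 0 t x) (N 1 1 t x)"
    have er: "eps t x * rho t x^2 = mu^2 * sig t x"
      using pos(5)[OF t, of x] unfolding rho_def by (simp add: power2_eq_square eps_def)
    have reg: "1 \<le> G x^4 \<or> min 1 (gam / 4) * rho t x^2 \<le> wa t x^2 \<and> min 1 (gam / 4) * (eps t x * rho t x^2) \<le> wb t x"
    proof (cases "p x^2 \<le> gam / 2")
      case True
      then show ?thesis using one_le_power[OF G_one[OF True], of 4] by blast
    next
      case False
      then have p2: "gam / 2 \<le> p x^2" by simp
      have m: "min 1 (gam / 4) \<le> gam / 4" by simp
      have "min 1 (gam / 4) * rho t x^2 \<le> p x^2 * rho t x^2" using p2 m gam by (intro mult_right_mono) auto
      then have 1: "min 1 (gam / 4) * rho t x^2 \<le> wa t x^2" unfolding wa_eq by (simp add: power_mult_distrib)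
      have "M0 \<le> mu * (gam / 4)" using mu_gam gam by (simp add: field_simps)
      then have "- q x \<le> mu * (gam / 4)" using psi_bound(2)[of x] by linarith
      then have "mu * - q x \<le> mu * (mu * (gam / 4))" using mu by (intro mult_left_mono) auto
      moreover have "mu^2 * (gam / 2) \<le> mu^2 * p x^2" using p2 by (intro mult_left_mono) auto
      ultimately have "mu^2 * (gam / 4) \<le> mu^2 * p x^2 + mu * q x" by (simp add: power2_eq_square)
      then have "mu^2 * (gam / 4) * sig t x \<le> wb t x" unfolding wb_def using sig1[OF t, of x] by (intro mult_right_mono) auto
      then have "gam / 4 * (mu^2 * sig t x) \<le> wb t x" by (simp only: ac_simps)
      moreover have "min 1 (gam / 4) * (mu^2 * sig t x) \<le> gam / 4 * (mu^2 * sig t x)" using m sig1[OF t, of x] by (intro mult_right_mono) auto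
      ultimately have "min 1 (gam / 4) * (eps t x * rho t x^2) \<le> wb t x" unfolding er by linarith
      then show ?thesis using 1 by blast
    qed
    have main: "c * (eps t x * (xe + al^2 * (rho t x * N 1 1 t x)^2))
        \<le> Pf t x^2 - Xdiv t x + K * (eps t x * (al^2 * (rho t x^2 * N 1 0 t x)^2 + (G x^4 + del) * (xe + (1 + al)^2 * te)))"
      unfolding xe_def te_def Xdiv_def Pf_def
      by (rule pc[unfolded pointwise_carleman_def, rule_format, OF adm(1)[OF t, of x] _ reg V0_def
        W11_def[unfolded V1_def] W12_def[unfolded V1_def V2_def] U0_def W01_def W02_def W03_def W04_def refl refl]) simp
    have loc: "eps t x * (G x^4 * (xe + (1 + al)^2 * te)) \<le> 4 * (L0f t x + M1f t x) + M2f t x + Lsf t x"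
    proof -
      have "G x^4 \<le> 4 * G x^2"
      proof -
        have "G x^2 \<le> 4" using power_mono[OF G_bounds(2,1), of x 2] by simp
        then have "G x^2 * G x^2 \<le> 4 * G x^2" by (intro mult_right_mono) auto
        then show ?thesis by (simp add: eval_nat_numeral mult.assoc)
      qed
      then have "G x^4 * ((rho t x^4 * N 0 0 t x)^2 + (rho t x^3 * N 0 1 t x)^2) \<le> 4 * G x^2 * ((rho t x^4 * N 0 0 t x)^2 + (rho t x^3 * N 0 1 t x)^2)"
        by (intro mult_right_mono) auto
      then have "eps t x * (G x^4 * ((rho t x^4 * N 0 0 t x)^2 + (rho t x^3 * N 0 1 t x)^2)) \<le> eps t x * (4 * G x^2 * ((rho t x^4 * N 0 0 t x)^2 + (rho t x^3 * N 0 1 t x)^2))"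
        using pos(1)[OF t, of x] by (intro mult_left_mono) auto
      then show ?thesis unfolding L0f_def M1f_def M2f_def Lsf_def xe_def te_def xenergy_def tenergy_def
        by (simp add: algebra_simps)
    qed
    have "eps t x * (al^2 * (rho t x^2 * N 1 0 t x)^2 + (G x^4 + del) * (xe + (1 + al)^2 * te))
      = al^2 * T0f t x + eps t x * (G x^4 * (xe + (1 + al)^2 * te)) + del * (Xf t x + (1 + al)^2 * (T0f t x + T1f t x))"
      unfolding T0f_def T1f_def Xf_def xe_def[symmetric] te_def tenergy_def by (simp add: algebra_simps)
    also have "\<dots> \<le> al^2 * T0f t x + (4 * (L0f t x + M1f t x) + M2f t x + Lsf t x) + del * (Xf t x + (1 + al)^2 * (T0f t x + T1f t x))"
      using loc by simp
    finally have "K * (eps t x * (al^2 * (rho t x^2 * N 1 0 t x)^2 + (G x^4 + del) * (xe + (1 + al)^2 * te)))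
      \<le> K * (al^2 * T0f t x + (4 * (L0f t x + M1f t x) + M2f t x + Lsf t x) + del * (Xf t x + (1 + al)^2 * (T0f t x + T1f t x)))"
      using K by (intro mult_left_mono)
    moreover have "c * (Xf t x + al^2 * T1f t x) = c * (eps t x * (xe + al^2 * (rho t x * N 1 1 t x)^2))"
      unfolding T1f_def Xf_def xe_def[symmetric] by (simp add: algebra_simps)
    ultimately show ?thesis using main by linarith
  qed
  have "wint (\<lambda>t x. c * (Xf t x + al^2 * T1f t x) + Xdiv t x) \<le> wint (\<lambda>t x. Pf t x^2
    + K * (al^2 * T0f t x + (4 * (L0f t x + M1f t x) + M2f t x + Lsf t x) + del * (Xf t x + (1 + al)^2 * (T0f t x + T1f t x))))"
    by (rule wint_mono) (intro tame_add tame_mult tame_const tame_energies tame_Xdiv pw | assumption)+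
  then show ?thesis
    by (simp add: wint_add wint_cmult tame_add tame_mult tame_const tame_Xdiv wint_Xdiv)
qed

text \<open>The multiplier is \<open>\<mu> \<rho>\<^sup>3 \<eta>\<close>.\<close>

lemma energy_eta_t:
  "wint T0f \<le> wint (\<lambda>t x. Pf t x^2) + (4 + 5 * MM^2) * (wint Xf + al^2 * wint T1f)"
proof -
  define f where "f t x = mu * rho t x^3" for t x
  define u where "u t x = 3 * (mu * p x) + 2 * (p x * rho t x)" for t x
  define ut where "ut t x = 3 * wh t + 2 * wth t x" for t x
  define A where "A t x = f t x * u t x * N 0 0 t x * N 0 3 t x + f t x * N 0 1 t x * N 0 3 t x + f t x * N 0 0 t x * N 0 4 t x
     - al * (f t x * u t x * N 0 0 t x * N 1 1 t x + f t x * N 0 1 t x * N 1 1 t x + f t x * N 0 0 t x * N 1 2 t x)" for t x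
  define B where "B t x = f t x * ut t x * N 0 0 t x * N 1 0 t x + f t x * N 1 0 t x^2 + f t x * N 0 0 t x * N 2 0 t x" for t x
  have tm: "tame T A" "tame T B"
    unfolding A_def[abs_def] B_def[abs_def] f_def u_def ut_def by (intro tame_basic)+
  have Y0: "wint (\<lambda>t x. A t x + B t x) = 0"
  proof (rule wint_divergence[OF _ _ tm])
    show "tame T (\<lambda>t x. f t x * N 0 0 t x * N 0 3 t x - al * (f t x * N 0 0 t x * N 1 1 t x))" "tame T (\<lambda>t x. f t x * N 0 0 t x * N 1 0 t x)"
      unfolding f_def by (intro tame_basic)+
    fix t x assume t: "t \<in> {0<..<T}"
    show "((\<lambda>x. f t x * N 0 0 t x * N 0 3 t x - al * (f t x * N 0 0 t x * N 1 1 t x)) has_real_derivative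
      A t x - 2 * (p x * rho t x) * (f t x * N 0 0 t x * N 0 3 t x - al * (f t x * N 0 0 t x * N 1 1 t x))) (at x)"
      unfolding f_def A_def u_def
      by (rule DERIV_cong, (rule derivative_eq_intros rho_dx N_x t refl)+) (simp add: algebra_simps eval_nat_numeral)
    show "((\<lambda>t. f t x * N 0 0 t x * N 1 0 t x) has_real_derivative B t x - 2 * wth t x * (f t x * N 0 0 t x * N 1 0 t x)) (at t)"
      unfolding f_def B_def ut_def
      by (rule DERIV_cong, (rule derivative_eq_intros rho_dt[OF t] N_t[OF t] refl | (simp; fail))+) (simp add: algebra_simps eval_nat_numeral)
  qed
  have pw: "T0f t x \<le> 2 * (A t x + B t x) + Pf t x^2 + (4 + 5 * MM^2) * (Xf t x + al^2 * T1f t x)" if t: "t \<in> {0<..<T}" for t x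
  proof -
    note ps = pos[OF t, of x] and tb = time_bounds[OF t, of x]
    have u: "\<bar>u t x\<bar> \<le> MM * rho t x"
    proof -
      have "\<bar>u t x\<bar> \<le> 3 * (rho t x * M0) + 2 * (M0 * rho t x)"
        unfolding u_def using ps mu mu_rho[OF t, of x] psi_bound(1)[of x] by (intro bound_add bound_mult bound_numeral) auto
      also have "\<dots> = 5 * M0 * rho t x" by simp
      also have "\<dots> \<le> MM * rho t x" using ps M0_MM psi_bound(5) by (intro mult_right_mono) auto
      finally show ?thesis .
    qed
    have ut: "\<bar>ut t x\<bar> \<le> MM * rho t x^2"
    proof -
      have "\<bar>ut t x\<bar> \<le> 3 * (MA * rho t x^2) + 2 * (MA * rho t x^2)" unfolding ut_def by (intro bound_add bound_mult bound_numeral tb)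
      also have "\<dots> = 5 * MA * rho t x^2" by simp
      also have "\<dots> \<le> MM * rho t x^2" using MM by (intro mult_right_mono) auto
      finally show ?thesis .
    qed
    have f: "f t x = eps t x * rho t x^4"
    proof -
      have "eps t x * rho t x^4 = (eps t x * rho t x) * rho t x^3" by (simp add: eval_nat_numeral)
      then show ?thesis unfolding ps(5) f_def ..
    qed
    have "eps t x * (rho t x^2 * N 1 0 t x)^2 \<le> 2 * (A t x + B t x) + Pf t x^2 + (4 + 5 * MM^2) * (eps t x * (xenergy (rho t x) (N 0 0 t x) (N 0 1 t x) (N 0 2 t x) (N 0 3 t x) + al^2 * (rho t x * N 1 1 t x)^2))"
      by (rule eta_t_pointwise[OF ps(4,1,2) u ut f]) (simp add: A_def B_def Pf_def algebra_simps power2_eq_square)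
    then show ?thesis unfolding T0f_def Xf_def T1f_def by (simp add: algebra_simps)
  qed
  have "wint T0f \<le> wint (\<lambda>t x. 2 * (A t x + B t x) + Pf t x^2 + (4 + 5 * MM^2) * (Xf t x + al^2 * T1f t x))"
    by (rule wint_mono) (intro tame_add tame_mult tame_const tame_energies tm pw | assumption)+
  also have "\<dots> = 2 * wint (\<lambda>t x. A t x + B t x) + wint (\<lambda>t x. Pf t x^2) + (4 + 5 * MM^2) * (wint Xf + al^2 * wint T1f)"
    by (simp add: wint_add wint_cmult tame_add tame_mult tame_const tm)
  finally show ?thesis unfolding Y0 by simp
qed

text \<open>The multiplier is \<open>- \<mu> \<rho> \<partial>\<^sub>x\<^sup>2 \<eta>\<close>.\<close>

lemma energy_eta_tx:
  "wint T1f \<le> wint (\<lambda>t x. Pf t x^2) + 6 * MM^2 * (wint Xf + wint T0f)"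
proof -
  define f where "f t x = mu * rho t x" for t x
  define u where "u t x = mu * p x + 2 * (p x * rho t x)" for t x
  define ut where "ut t x = wh t + 2 * wth t x" for t x
  define A where "A t x = f t x * u t x * N 1 0 t x * N 1 1 t x + f t x * N 1 1 t x^2 + f t x * N 1 0 t x * N 1 2 t x
     - (f t x * u t x * N 0 2 t x * N 0 3 t x + f t x * N 0 3 t x^2 + f t x * N 0 2 t x * N 0 4 t x)" for t x
  define B where "B t x = al * (1/2) * (f t x * ut t x * N 0 2 t x^2) + al * (f t x * N 0 2 t x * N 1 2 t x)
     - (f t x * ut t x * N 0 2 t x * N 1 0 t x + f t x * N 1 2 t x * N 1 0 t x + f t x * N 0 2 t x * N 2 0 t x)" for t x
  have tm: "tame T A" "tame T B"
    unfolding A_def[abs_def] B_def[abs_def] f_def u_def ut_def by (intro tame_basic)+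
  have Y0: "wint (\<lambda>t x. A t x + B t x) = 0"
  proof (rule wint_divergence[OF _ _ tm])
    show "tame T (\<lambda>t x. f t x * N 1 0 t x * N 1 1 t x - f t x * N 0 2 t x * N 0 3 t x)"
      "tame T (\<lambda>t x. al * (1/2) * (f t x * N 0 2 t x^2) - f t x * N 0 2 t x * N 1 0 t x)"
      unfolding f_def by (intro tame_basic)+
    fix t x assume t: "t \<in> {0<..<T}"
    show "((\<lambda>x. f t x * N 1 0 t x * N 1 1 t x - f t x * N 0 2 t x * N 0 3 t x) has_real_derivative
      A t x - 2 * (p x * rho t x) * (f t x * N 1 0 t x * N 1 1 t x - f t x * N 0 2 t x * N 0 3 t x)) (at x)"
      unfolding f_def A_def u_def
      by (rule DERIV_cong, (rule derivative_eq_intros rho_dx N_x t refl)+) (simp add: algebra_simps eval_nat_numeral)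
    show "((\<lambda>t. al * (1/2) * (f t x * N 0 2 t x^2) - f t x * N 0 2 t x * N 1 0 t x) has_real_derivative
      B t x - 2 * wth t x * (al * (1/2) * (f t x * N 0 2 t x^2) - f t x * N 0 2 t x * N 1 0 t x)) (at t)"
      unfolding f_def B_def ut_def
      by (rule DERIV_cong, (rule derivative_eq_intros rho_dt[OF t] N_t[OF t] refl | (simp; fail))+) (simp add: field_simps eval_nat_numeral)
  qed
  have pw: "T1f t x \<le> 2 * (A t x + B t x) + Pf t x^2 + 6 * MM^2 * (Xf t x + T0f t x)" if t: "t \<in> {0<..<T}" for t x
  proof -
    note ps = pos[OF t, of x] and tb = time_bounds[OF t, of x]
    have u: "\<bar>u t x\<bar> \<le> MM * rho t x"
    proof -
      have "\<bar>u t x\<bar> \<le> rho t x * M0 + 2 * (M0 * rho t x)"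
        unfolding u_def using ps mu mu_rho[OF t, of x] psi_bound(1)[of x] by (intro bound_add bound_mult bound_numeral) auto
      also have "\<dots> = 3 * M0 * rho t x" by simp
      also have "\<dots> \<le> MM * rho t x" using ps M0_MM psi_bound(5) by (intro mult_right_mono) auto
      finally show ?thesis .
    qed
    have le: "3 * (MA * rho t x^2) \<le> MM * rho t x^2"
      using MM MA mult_right_mono[of "3 * MA" MM "rho t x^2"] by simp
    have ut: "\<bar>ut t x\<bar> \<le> MM * rho t x^2" "\<bar>al * ut t x\<bar> \<le> MM * rho t x^2"
    proof -
      have "\<bar>ut t x\<bar> \<le> MA * rho t x^2 + 2 * (MA * rho t x^2)" unfolding ut_def by (intro bound_add bound_mult bound_numeral tb)
      then show "\<bar>ut t x\<bar> \<le> MM * rho t x^2" using le by simp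
      have "al * ut t x = al * wh t + 2 * (al * wth t x)" unfolding ut_def by (simp add: algebra_simps)
      moreover have "\<bar>al * wh t + 2 * (al * wth t x)\<bar> \<le> MA * rho t x^2 + 2 * (MA * rho t x^2)"
      proof -
        have "\<bar>al * wh t\<bar> \<le> MA * rho t x^2" "\<bar>al * wth t x\<bar> \<le> MA * rho t x^2" using tb(3,4) al by (simp_all add: abs_mult)
        then show ?thesis by linarith
      qed
      ultimately show "\<bar>al * ut t x\<bar> \<le> MM * rho t x^2" using le by simp
    qed
    have f: "f t x = eps t x * rho t x^2"
    proof -
      have "eps t x * rho t x^2 = (eps t x * rho t x) * rho t x" by (simp add: eval_nat_numeral)
      then show ?thesis unfolding ps(5) f_def ..
    qed
    have "eps t x * (rho t x * N 1 1 t x)^2 \<le> 2 * (A t x + B t x) + Pf t x^2 + 6 * MM^2 * (eps t x * (xenergy (rho t x) (N 0 0 t x) (N 0 1 t x) (N 0 2 t x) (N 0 3 t x) + (rho t x^2 * N 1 0 t x)^2))"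
      by (rule eta_tx_pointwise[OF ps(4,1,2) u ut MM(2) f]) (simp add: A_def B_def Pf_def algebra_simps power2_eq_square)
    then show ?thesis unfolding T0f_def Xf_def T1f_def by (simp add: algebra_simps)
  qed
  have "wint T1f \<le> wint (\<lambda>t x. 2 * (A t x + B t x) + Pf t x^2 + 6 * MM^2 * (Xf t x + T0f t x))"
    by (rule wint_mono) (intro tame_add tame_mult tame_const tame_energies tm pw | assumption)+
  also have "\<dots> = 2 * wint (\<lambda>t x. A t x + B t x) + wint (\<lambda>t x. Pf t x^2) + 6 * MM^2 * (wint Xf + wint T0f)"
    by (simp add: wint_add wint_cmult tame_add tame_mult tame_const tm)
  finally show ?thesis unfolding Y0 by simp
qed

end

section \<open>Interpolation of the local terms and absorption\<close>

context beam_carleman begin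

lemma gamma_bound:
  assumes "\<bar>x\<bar> \<le> M0" "\<bar>y\<bar> \<le> M0"
  shows "\<bar>2 / gam * (- 2 * x * y)\<bar> \<le> 4 * M0^2 / gam"
proof -
  have "\<bar>2 / gam * (- 2 * x * y)\<bar> = (\<bar>x\<bar> * \<bar>y\<bar>) * (4 / gam)" using gam by (simp add: abs_mult abs_divide)
  also have "\<dots> \<le> (M0 * M0) * (4 / gam)" using assms gam by (intro mult_right_mono mult_mono) auto
  finally show ?thesis by (simp add: power2_eq_square ac_simps)
qed

text \<open>The multiplier vanishes off the control region, so integrating by parts there trades one derivative for a power of \<open>rho\<close>.\<close>

lemma energy_local_xx:
  assumes kp: "0 < kp"
  shows "wint M2f \<le> kp * wint Xf + MM^6 / kp * wint M1f"
proof -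
  define f where "f t x = mu * rho t x^3 * G x^4" for t x
  \<comment> \<open>The x-derivative of \<open>f\<close> with the weight e^(2 \<kappa>), divided by
    that weight only: a logarithmic derivative would be singular where \<open>G\<close>
    vanishes.\<close>
  define vf where "vf t x = mu * (3 * rho t x^2 * (mu * (p x * rho t x)) * G x^4 + rho t x^3 * (4 * G x^3 * (2 / gam * (- 2 * p x * q x))))
      + 2 * (p x * rho t x) * f t x" for t x
  define A where "A t x = vf t x * N 0 1 t x * N 0 2 t x + f t x * N 0 2 t x^2 + f t x * N 0 1 t x * N 0 3 t x" for t x
  have tm: "tame T A" unfolding A_def[abs_def] vf_def f_def by (intro tame_basic)
  have Y0: "wint A = 0"
  proof (rule wint_x_divergence[OF _ tm])
    show "tame T (\<lambda>t x. f t x * N 0 1 t x * N 0 2 t x)" unfolding f_def by (intro tame_basic)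
    fix t x assume t: "t \<in> {0<..<T}"
    show "((\<lambda>x. f t x * N 0 1 t x * N 0 2 t x) has_real_derivative A t x - 2 * (p x * rho t x) * (f t x * N 0 1 t x * N 0 2 t x)) (at x)"
      unfolding f_def A_def vf_def
      by (rule DERIV_cong, (rule derivative_eq_intros G_power_dx rho_dx N_x t refl | (simp; fail))+) (simp add: algebra_simps eval_nat_numeral)
  qed
  have pw: "M2f t x \<le> A t x + (kp * Xf t x + MM^6 / kp * M1f t x)" if t: "t \<in> {0<..<T}" for t x
  proof -
    note ps = pos[OF t, of x] and pb = psi_bound(1,2)[of x]
    have f: "f t x = eps t x * rho t x^4 * G x^4"
    proof -
      have "eps t x * rho t x^4 * G x^4 = (eps t x * rho t x) * rho t x^3 * G x^4" by (simp add: eval_nat_numeral)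
      then show ?thesis unfolding ps(5) f_def ..
    qed
    have vf: "\<bar>vf t x\<bar> \<le> MM * (eps t x * rho t x^5 * G x^3)"
    proof -
      have "vf t x = mu * rho t x^3 * G x^3 * (3 * mu * p x * G x + 4 * (2 / gam * (- 2 * p x * q x)) + 2 * (p x * rho t x * G x))"
        unfolding vf_def f_def by (simp add: algebra_simps eval_nat_numeral)
      moreover have "\<bar>3 * mu * p x * G x + 4 * (2 / gam * (- 2 * p x * q x)) + 2 * (p x * rho t x * G x)\<bar> \<le> MM * rho t x"
      proof -
        have "\<bar>3 * mu * p x * G x + 4 * (2 / gam * (- 2 * p x * q x)) + 2 * (p x * rho t x * G x)\<bar>
          \<le> 3 * rho t x * M0 * 2 + 4 * (4 * M0^2 / gam) + 2 * (M0 * rho t x * 2)"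
          using ps mu mu_rho[OF t, of x] G_bounds[of x] by (intro bound_add bound_mult bound_numeral pb gamma_bound) auto
        also have "\<dots> = 10 * M0 * rho t x + 16 * M0^2 / gam * 1" by simp
        also have "\<dots> \<le> 10 * M0 * rho t x + 16 * M0^2 / gam * rho t x"
          using ps gam by (intro add_left_mono mult_left_mono) auto
        also have "\<dots> = (10 * M0 + 16 * M0^2 / gam) * rho t x" by (simp add: distrib_right)
        also have "\<dots> \<le> MM * rho t x" using ps MM(4) by (intro mult_right_mono) auto
        finally show ?thesis .
      qed
      then have "(mu * rho t x^3 * G x^3) * \<bar>3 * mu * p x * G x + 4 * (2 / gam * (- 2 * p x * q x)) + 2 * (p x * rho t x * G x)\<bar>
          \<le> (mu * rho t x^3 * G x^3) * (MM * rho t x)"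
        using mu ps G_bounds[of x] by (intro mult_left_mono) auto
      moreover have "\<bar>mu * rho t x^3 * G x^3\<bar> = mu * rho t x^3 * G x^3" using mu ps G_bounds[of x] by simp
      ultimately have "\<bar>vf t x\<bar> \<le> (mu * rho t x^3 * G x^3) * (MM * rho t x)" by (simp only: abs_mult[of "mu * rho t x^3 * G x^3"])
      also have "\<dots> = MM * ((eps t x * rho t x) * rho t x^4 * G x^3)" unfolding ps(5) by (simp add: eval_nat_numeral)
      also have "\<dots> = MM * (eps t x * rho t x^5 * G x^3)" by (simp add: eval_nat_numeral)
      finally show ?thesis .
    qed
    have "eps t x * (G x^4 * (rho t x^2 * N 0 2 t x)^2) \<le> A t x + kp * (eps t x * xenergy (rho t x) (N 0 0 t x) (N 0 1 t x) (N 0 2 t x) (N 0 3 t x))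
        + MM^6 / kp * (eps t x * (G x^2 * (rho t x^3 * N 0 1 t x)^2))"
      by (rule local_xx_pointwise[OF ps(4,1) G_bounds(1,3) MM(2) kp vf f]) (rule A_def)
    then show ?thesis unfolding M2f_def Xf_def M1f_def by simp
  qed
  have "wint M2f \<le> wint (\<lambda>t x. A t x + (kp * Xf t x + MM^6 / kp * M1f t x))"
    by (rule wint_mono) (intro tame_add tame_mult tame_const tame_energies tm pw | assumption)+
  also have "\<dots> = wint A + (kp * wint Xf + MM^6 / kp * wint M1f)"
    by (simp only: wint_add wint_cmult tame_add tame_mult tame_const tm tame_energies)
  finally show ?thesis unfolding Y0 by simp
qed

text \<open>The same interpolation one order lower. It ends in \<open>L0f\<close>, whose counterpart
  on \<open>J\<close> is among the observed terms.\<close>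

lemma energy_local_x:
  assumes kp: "0 < kp"
  shows "wint M1f \<le> kp * wint Xf + MM^6 / kp * wint L0f"
proof -
  define f where "f t x = mu * rho t x^5 * G x^2" for t x
  define vf where "vf t x = mu * (5 * rho t x^4 * (mu * (p x * rho t x)) * G x^2 + rho t x^5 * (2 * G x * (2 / gam * (- 2 * p x * q x))))
      + 2 * (p x * rho t x) * f t x" for t x
  define A where "A t x = vf t x * N 0 0 t x * N 0 1 t x + f t x * N 0 1 t x^2 + f t x * N 0 0 t x * N 0 2 t x" for t x
  have tm: "tame T A" unfolding A_def[abs_def] vf_def f_def by (intro tame_basic)
  have Y0: "wint A = 0"
  proof (rule wint_x_divergence[OF _ tm])
    show "tame T (\<lambda>t x. f t x * N 0 0 t x * N 0 1 t x)" unfolding f_def by (intro tame_basic)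
    fix t x assume t: "t \<in> {0<..<T}"
    show "((\<lambda>x. f t x * N 0 0 t x * N 0 1 t x) has_real_derivative A t x - 2 * (p x * rho t x) * (f t x * N 0 0 t x * N 0 1 t x)) (at x)"
      unfolding f_def A_def vf_def
      by (rule DERIV_cong, (rule derivative_eq_intros G_power_dx rho_dx N_x t refl | (simp; fail))+) (simp add: algebra_simps eval_nat_numeral)
  qed
  have pw: "M1f t x \<le> A t x + (kp * Xf t x + MM^6 / kp * L0f t x)" if t: "t \<in> {0<..<T}" for t x
  proof -
    note ps = pos[OF t, of x] and pb = psi_bound(1,2)[of x]
    have f: "f t x = eps t x * rho t x^6 * G x^2"
    proof -
      have "eps t x * rho t x^6 * G x^2 = (eps t x * rho t x) * rho t x^5 * G x^2" by (simp add: eval_nat_numeral)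
      then show ?thesis unfolding ps(5) f_def ..
    qed
    have vf: "\<bar>vf t x\<bar> \<le> MM * (eps t x * rho t x^7 * G x)"
    proof -
      have "vf t x = mu * rho t x^5 * G x * (5 * mu * p x * G x + 2 * (2 / gam * (- 2 * p x * q x)) + 2 * (p x * rho t x * G x))"
        unfolding vf_def f_def by (simp add: algebra_simps eval_nat_numeral)
      moreover have "\<bar>5 * mu * p x * G x + 2 * (2 / gam * (- 2 * p x * q x)) + 2 * (p x * rho t x * G x)\<bar> \<le> MM * rho t x"
      proof -
        have "\<bar>5 * mu * p x * G x + 2 * (2 / gam * (- 2 * p x * q x)) + 2 * (p x * rho t x * G x)\<bar>
          \<le> 5 * rho t x * M0 * 2 + 2 * (4 * M0^2 / gam) + 2 * (M0 * rho t x * 2)"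
          using ps mu mu_rho[OF t, of x] G_bounds[of x] by (intro bound_add bound_mult bound_numeral pb gamma_bound) auto
        also have "\<dots> = 14 * M0 * rho t x + 8 * M0^2 / gam * 1" by simp
        also have "\<dots> \<le> 14 * M0 * rho t x + 8 * M0^2 / gam * rho t x"
          using ps gam by (intro add_left_mono mult_left_mono) auto
        also have "\<dots> = (14 * M0 + 8 * M0^2 / gam) * rho t x" by (simp add: distrib_right)
        also have "\<dots> \<le> MM * rho t x"
        proof (rule mult_right_mono)
          have "8 * M0^2 / gam \<le> 16 * M0^2 / gam" using gam by (intro divide_right_mono) auto
          then show "14 * M0 + 8 * M0^2 / gam \<le> MM" using MA unfolding MM_def by linarith
        qed (use ps in simp)
        finally show ?thesis .
      qed
      then have "(mu * rho t x^5 * G x) * \<bar>5 * mu * p x * G x + 2 * (2 / gam * (- 2 * p x * q x)) + 2 * (p x * rho t x * G x)\<bar>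
          \<le> (mu * rho t x^5 * G x) * (MM * rho t x)"
        using mu ps G_bounds[of x] by (intro mult_left_mono) auto
      moreover have "\<bar>mu * rho t x^5 * G x\<bar> = mu * rho t x^5 * G x" using mu ps G_bounds[of x] by simp
      ultimately have "\<bar>vf t x\<bar> \<le> (mu * rho t x^5 * G x) * (MM * rho t x)" by (simp only: abs_mult[of "mu * rho t x^5 * G x"])
      also have "\<dots> = MM * ((eps t x * rho t x) * rho t x^6 * G x)" unfolding ps(5) by (simp add: eval_nat_numeral)
      also have "\<dots> = MM * (eps t x * rho t x^7 * G x)" by (simp add: eval_nat_numeral)
      finally show ?thesis .
    qed
    have "eps t x * (G x^2 * (rho t x^3 * N 0 1 t x)^2) \<le> A t x + kp * (eps t x * xenergy (rho t x) (N 0 0 t x) (N 0 1 t x) (N 0 2 t x) (N 0 3 t x))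
        + MM^6 / kp * (eps t x * (G x^2 * (rho t x^4 * N 0 0 t x)^2))"
      by (rule local_x_pointwise[OF ps(4,1) G_bounds(1,3) MM(2) kp vf f]) (rule A_def)
    then show ?thesis unfolding M1f_def Xf_def L0f_def by simp
  qed
  have "wint M1f \<le> wint (\<lambda>t x. A t x + (kp * Xf t x + MM^6 / kp * L0f t x))"
    by (rule wint_mono) (intro tame_add tame_mult tame_const tame_energies tm pw | assumption)+
  also have "\<dots> = wint A + (kp * wint Xf + MM^6 / kp * wint L0f)"
    by (simp only: wint_add wint_cmult tame_add tame_mult tame_const tm tame_energies)
  finally show ?thesis unfolding Y0 by simp
qed

text \<open>Off \<open>J\<close> the cutoff vanishes, by the choice of \<open>gam\<close>. The
  constant is 8 times the bound 4 of \<open>G x^2\<close>; the 8 combines the 4 from lowering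
  \<open>G x^4\<close> to \<open>G x^2\<close> with the 2 from comparing \<open>(1 + al)^2\<close>
  with \<open>1 + al^2\<close>.\<close>

lemma energy_local:
  assumes off: "\<And>x. x \<notin> J \<Longrightarrow> gam \<le> p x^2" and J: "J \<in> sets borel"
  shows "wint L0f + wint Lsf \<le> 32 * integral_cyl T J (\<lambda>t x. exp (2 * kap t x) * Jf t x)"
proof -
  have G2: "G x^2 \<le> 4" for x using power_mono[OF G_bounds(2,1), of x 2] by simp
  have "L0f t x + Lsf t x \<le> 8 * G x^2 * Jf t x" if t: "t \<in> {0<..<T}" for t x
  proof -
    define a b c where "a = (rho t x^4 * N 0 0 t x)^2" and "b = (rho t x * N 0 3 t x)^2"
      and "c = (rho t x^2 * N 1 0 t x)^2 + (rho t x * N 1 1 t x)^2"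
    have nn: "0 \<le> a" "0 \<le> b" "0 \<le> c" unfolding a_def b_def c_def by auto
    have "(1 + al)^2 \<le> 2 * (1 + al^2)" using sum_squares_bound[of 1 al] by (simp add: power2_sum)
    then have "(1 + al)^2 * c \<le> 2 * (1 + al^2) * c" using nn by (intro mult_right_mono)
    then have "b + (1 + al)^2 * c \<le> 2 * (b + (1 + al^2) * c)" using nn by (simp add: algebra_simps)
    moreover have "G x^4 \<le> 4 * G x^2"
      using mult_right_mono[OF G2, of "G x^2" x] by (simp add: eval_nat_numeral mult.assoc)
    ultimately have "G x^4 * (b + (1 + al)^2 * c) \<le> 4 * G x^2 * (2 * (b + (1 + al^2) * c))"
      using nn by (intro mult_mono) auto
    moreover have "G x^2 * a \<le> 8 * G x^2 * a" using nn by (intro mult_right_mono) auto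
    ultimately have "G x^2 * a + G x^4 * (b + (1 + al)^2 * c) \<le> 8 * G x^2 * (a + b + (1 + al^2) * c)"
      by (simp add: algebra_simps)
    then have "eps t x * (G x^2 * a + G x^4 * (b + (1 + al)^2 * c)) \<le> eps t x * (8 * G x^2 * (a + b + (1 + al^2) * c))"
      using pos(1)[OF t, of x] by (intro mult_left_mono) auto
    then show ?thesis unfolding L0f_def Lsf_def Jf_def a_def[symmetric] b_def[symmetric] c_def[symmetric]
      by (simp add: algebra_simps)
  qed
  then have "wint (\<lambda>t x. L0f t x + Lsf t x) \<le> wint (\<lambda>t x. 8 * G x^2 * Jf t x)"
    by (intro wint_mono tame_add tame_mult tame_power tame_const tame_energies tame_G)
  also have "\<dots> \<le> 32 * integral_cyl T J (\<lambda>t x. exp (2 * kap t x) * Jf t x)"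
  proof (rule wint_localised)
    show "tame T (\<lambda>t x. 8 * G x^2)" by (intro tame_mult tame_power tame_const tame_G)
    show "8 * G x^2 \<le> 32" for x using G2[of x] by simp
    show "8 * G x^2 \<le> 0" if "x \<notin> J" for x using G_zero[OF off[OF that]] by simp
  qed (use energies_nonneg J in auto)
  finally show ?thesis by (simp add: wint_add)
qed

text \<open>The five integrated inequalities enter the absorption with the common constant
  \<open>K'\<close>. \<open>MM^6\<close> serves as interpolation constant and, being at least 4,
  also as factor of the local terms in \<open>energy_carleman\<close>.\<close>

lemma weighted_estimate:
  assumes pc: "pointwise_carleman MA (min 1 (gam / 4)) c K" and K: "0 \<le> K"
    and off: "\<And>x. x \<notin> J \<Longrightarrow> gam \<le> p x^2" and J: "J \<in> sets borel"
    and K': "K' = K + 4 + 6 * MM^2" and D: "0 < D"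
    and absorb: "absorbing c K' (MM^6) del D"
  shows "wint (\<lambda>t x. Xf t x + (1 + al^2) * (T0f t x + T1f t x))
    \<le> 32 * D * (integral_cyl T J (\<lambda>t x. exp (2 * kap t x) * Jf t x) + al^2 * wint T0f + wint (\<lambda>t x. Pf t x^2))"
proof -
  note nn = wint_energies_nonneg
  have M6: "4 \<le> MM^6" using MM(1,2) power_increasing[of 1 6 MM] by simp
  have K'K: "K \<le> K'" "4 + 5 * MM^2 \<le> K'" "6 * MM^2 \<le> K'" unfolding K' using K zero_le_power2[of MM] by linarith+
  have "wint Xf + (1 + al^2) * (wint T0f + wint T1f) \<le> D * (wint (\<lambda>t x. Pf t x^2) + al^2 * wint T0f + wint L0f + wint Lsf)"
  proof (rule absorb[unfolded absorbing_def, rule_format, OF nn(1-4,7,8) al _ _ _ energy_local_xx energy_local_x])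
    let ?R = "\<lambda>C. al^2 * wint T0f + (C * (wint L0f + wint M1f) + wint M2f + wint Lsf) + del * (wint Xf + (1 + al)^2 * (wint T0f + wint T1f))"
    have "4 * (wint L0f + wint M1f) \<le> MM^6 * (wint L0f + wint M1f)" using nn M6 by (intro mult_right_mono) auto
    then have R: "?R 4 \<le> ?R (MM^6)" by simp
    have "0 \<le> ?R 4" using nn del by (intro add_nonneg_nonneg mult_nonneg_nonneg) auto
    then have "K * ?R 4 \<le> K' * ?R (MM^6)" using R K K'K by (intro mult_mono) auto
    then show "c * (wint Xf + al^2 * wint T1f) \<le> wint (\<lambda>t x. Pf t x^2) + K' * ?R (MM^6)"
      using energy_carleman[OF pc K] by linarith
    have "(4 + 5 * MM^2) * (wint Xf + al^2 * wint T1f) \<le> K' * (wint Xf + al^2 * wint T1f)"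
      using nn K'K by (intro mult_right_mono) auto
    then show "wint T0f \<le> wint (\<lambda>t x. Pf t x^2) + K' * (wint Xf + al^2 * wint T1f)" using energy_eta_t by linarith
    have "6 * MM^2 * (wint Xf + wint T0f) \<le> K' * (wint Xf + wint T0f)" using nn K'K by (intro mult_right_mono) auto
    then show "wint T1f \<le> wint (\<lambda>t x. Pf t x^2) + K' * (wint Xf + wint T0f)" using energy_eta_tx by linarith
  qed
  also have "\<dots> \<le> D * (32 * (integral_cyl T J (\<lambda>t x. exp (2 * kap t x) * Jf t x) + al^2 * wint T0f + wint (\<lambda>t x. Pf t x^2)))"
  proof (rule mult_left_mono)
    have "0 \<le> al^2 * wint T0f" using nn by simp
    then show "wint (\<lambda>t x. Pf t x^2) + al^2 * wint T0f + wint L0f + wint Lsf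
      \<le> 32 * (integral_cyl T J (\<lambda>t x. exp (2 * kap t x) * Jf t x) + al^2 * wint T0f + wint (\<lambda>t x. Pf t x^2))"
      using energy_local[OF off J] nn(8) unfolding distrib_left by linarith
  qed (use D in simp)
  finally show ?thesis
    by (simp only: wint_add wint_cmult tame_add tame_mult tame_const tame_energies mult.assoc mult.left_commute[of D])
qed

end

section \<open>Return to the integrals of the theorem\<close>

lemma integral_cyl_cong:
  assumes "\<And>t x. t \<in> {0<..<T} \<Longrightarrow> f t x = g t x"
  shows "integral_cyl T A f = integral_cyl T A g"
  unfolding integral_cyl_def set_lebesgue_integral_def
  by (rule Bochner_Integration.integral_cong) (auto simp: indicator_def assms)

context beam_carleman begin

text \<open>Since \<open>rho\<close> is s \<mu> \<xi> and \<open>eps\<close> is 1 / (s \<xi>), the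
  product \<open>eps * rho^(2 * j)\<close> has exponent 2j on \<mu> and 2j - 1 on s \<xi>; this is
  the pattern 8 and 7, 6 and 5, and so on.\<close>

lemma integrand_powers:
  assumes t: "t \<in> {0<..<T}"
  shows "eps t x * (rho t x^4 * y)^2 = s^7 * mu^8 * (xi0 k Psi psi T lam mu t x)^7 * \<bar>y\<bar>^2"
    "eps t x * (rho t x^3 * y)^2 = s^5 * mu^6 * (xi0 k Psi psi T lam mu t x)^5 * \<bar>y\<bar>^2"
    "eps t x * (rho t x^2 * y)^2 = s^3 * mu^4 * (xi0 k Psi psi T lam mu t x)^3 * \<bar>y\<bar>^2"
    "eps t x * (rho t x * y)^2 = s * mu^2 * xi0 k Psi psi T lam mu t x * \<bar>y\<bar>^2"
proof -
  have "0 < xi0 k Psi psi T lam mu t x" using sig_pos[OF t, of x] s_pos unfolding sig_def by (simp add: zero_less_mult_iff)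
  then show "eps t x * (rho t x^4 * y)^2 = s^7 * mu^8 * (xi0 k Psi psi T lam mu t x)^7 * \<bar>y\<bar>^2"
    "eps t x * (rho t x^3 * y)^2 = s^5 * mu^6 * (xi0 k Psi psi T lam mu t x)^5 * \<bar>y\<bar>^2"
    "eps t x * (rho t x^2 * y)^2 = s^3 * mu^4 * (xi0 k Psi psi T lam mu t x)^3 * \<bar>y\<bar>^2"
    "eps t x * (rho t x * y)^2 = s * mu^2 * xi0 k Psi psi T lam mu t x * \<bar>y\<bar>^2"
    using s_pos unfolding rho_def eps_def sig_def by (simp_all add: field_simps eval_nat_numeral)
qed

end

theorem theorem1p9:
  fixes omega omega0 :: "(real \<times> real) set" and J J0 :: "real set"
    and psiO :: "real \<times> real \<Rightarrow> real" and psiI :: "real \<Rightarrow> real" and k Psi :: real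
  assumes omega: "open_in_Omega omega" "omega \<noteq> {}"
    and omega0: "open_in_Omega omega0" "omega0 \<noteq> {}" "closure omega0 \<subseteq> omega"
    and J: "open_in_torus J" "J \<noteq> {}"
    and J0: "open_in_torus J0" "J0 \<noteq> {}" "closure J0 \<subseteq> J"
    and psiO: "weight_fun_Omega omega0 psiO"
    and psiI: "weight_fun_torus J0 psiI"
    and Psi: "Psi = Psi_const psiO psiI"
    and k: "k \<ge> 2"
  shows "\<exists>c0 mu0 s0 :: real. c0 > 0 \<and> mu0 \<ge> 1 \<and> s0 \<ge> 1 \<and>
    (\<forall>mu lam alpha T s :: real. \<forall>eta :: real \<Rightarrow> real \<Rightarrow> real.
      mu \<ge> mu0 \<longrightarrow> lam \<ge> mu \<longrightarrow> alpha \<ge> 0 \<longrightarrow> T > 0 \<longrightarrow>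
      s \<ge> s0 * (1 + alpha) * (T powr k + T powr (k - 1)) \<longrightarrow>
      Cm_C4 2 T eta \<longrightarrow>
      (let phi = phi0 k Psi psiI T lam mu; xi = xi0 k Psi psiI T lam mu in
        integral_cyl T UNIV (\<lambda>t x. exp (2 * s * phi t x) *
          (s^7 * mu^8 * (xi t x)^7 * \<bar>eta t x\<bar>^2
           + s^5 * mu^6 * (xi t x)^5 * \<bar>dx 1 eta t x\<bar>^2
           + s^3 * mu^4 * (xi t x)^3 * \<bar>dx 2 eta t x\<bar>^2
           + (1 + alpha^2) * s^3 * mu^4 * (xi t x)^3 * \<bar>dt 1 eta t x\<bar>^2
           + s * mu^2 * xi t x * \<bar>dx 3 eta t x\<bar>^2
           + (1 + alpha^2) * s * mu^2 * xi t x * \<bar>dt 1 (dx 1 eta) t x\<bar>^2))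
        \<le> c0 *
          (integral_cyl T J (\<lambda>t x. exp (2 * s * phi t x) *
             (s^7 * mu^8 * (xi t x)^7 * \<bar>eta t x\<bar>^2
              + (1 + alpha^2) * s^3 * mu^4 * (xi t x)^3 * \<bar>dt 1 eta t x\<bar>^2
              + s * mu^2 * xi t x * \<bar>dx 3 eta t x\<bar>^2
              + (1 + alpha^2) * s * mu^2 * xi t x * \<bar>dt 1 (dx 1 eta) t x\<bar>^2))
           + alpha^2 * s^3 * mu^4 * integral_cyl T UNIV (\<lambda>t x.
               (xi t x)^3 * exp (2 * s * phi t x) * \<bar>dt 1 eta t x\<bar>^2)
           + integral_cyl T UNIV (\<lambda>t x. exp (2 * s * phi t x) *
               \<bar>dt 2 eta t x - alpha * dx 2 (dt 1 eta) t x + dx 4 eta t x\<bar>^2))))"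
proof -
  note smooth = weight_fun_torus_smooth[OF psiI]
  obtain M0 where M0: "1 \<le> M0" "\<And>i x. i \<le> 4 \<Longrightarrow> \<bar>(deriv ^^ i) psiI x\<bar> \<le> M0"
    using weight_fun_torus_bounded[OF psiI] by blast
  obtain gam where gam0: "0 < gam" "\<And>x. x \<notin> J \<Longrightarrow> gam \<le> (deriv psiI x)^2"
    using weight_fun_torus_noncritical[OF psiI J(1) J0(3)] by blast
  have psi_le: "psiI x \<le> Psi" for x
    unfolding Psi using Psi_const_ge[of psiI x psiO] smooth(2)[of 0] smooth(3)[of 0] by simp
  have JB: "J \<in> sets borel" using J(1) unfolding open_in_torus_def by (intro borel_open) simp
  \<comment> \<open>\<open>A\<close> and \<open>B\<close> are \<open>MA\<close> and
    \<open>MM\<close> written outside the locale, so that \<open>del\<close> and \<open>D\<close>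
    are fixed before \<mu>, \<lambda>, \<alpha>, T and \<eta> are introduced.\<close>
  define A where "A = 15 * M0^4 + k^2"
  define B where "B = 5 * A + 14 * M0 + 16 * M0^2 / gam + 4"
  have "0 \<le> A" "0 \<le> 16 * M0^2 / gam" unfolding A_def using gam0(1) by simp_all
  then have B: "1 \<le> B" unfolding B_def using M0(1) by linarith
  have g: "0 < min 1 (gam / 4)" "min 1 (gam / 4) \<le> 1" using gam0(1) by auto
  obtain c K where cK: "0 < c" "0 \<le> K" "pointwise_carleman A (min 1 (gam / 4)) c K"
    by (rule pointwise_carleman_exists[OF g])
  have K': "1 \<le> K + 4 + 6 * B^2" using cK(2) zero_le_power2[of B] by linarith
  obtain del D where del: "0 < del" "del \<le> 1" and D: "0 < D" and absorb: "absorbing c (K + 4 + 6 * B^2) (B^6) del D"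
    by (rule absorbing_exists[OF cK(1) K' one_le_power[OF B]])
  show ?thesis
  proof (intro exI conjI allI impI)
    \<comment> \<open>The witnesses are forced by the locale assumptions: the threshold for \<mu> is
      \<open>mu_gam\<close> together with \<mu> at least 1, and the one for s is
      \<open>s_ge\<close>.\<close>
    show "0 < 32 * D" using D by simp
    show "1 \<le> max 1 (4 * M0 / gam)" by simp
    show "1 \<le> 1 / del" using del by simp
    fix mu lam al T s :: real and eta
    assume mu: "max 1 (4 * M0 / gam) \<le> mu" and lam: "mu \<le> lam" and al: "0 \<le> al" and T: "0 < T"
      and s: "1 / del * (1 + al) * (T powr k + T powr (k - 1)) \<le> s" and eta: "Cm_C4 2 T eta"
    have "0 < 1 / del * (1 + al) * (T powr k + T powr (k - 1))" using del al T by (intro mult_pos_pos) (auto intro: add_pos_pos)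
    then have s0: "0 < s" using s by linarith
    obtain N where N0: "\<And>j t x. N 0 j t x = (deriv ^^ j) (eta t) x" and Nj: "\<And>i j t x. N i j t x = (deriv ^^ j) (N i 0 t) x"
      and Nx: "\<And>i j t x. i \<le> 2 \<Longrightarrow> j < 4 \<Longrightarrow> t \<in> {0..T} \<Longrightarrow> (N i j t has_real_derivative N i (Suc j) t x) (at x)"
      and Nt: "\<And>i j t x. i < 2 \<Longrightarrow> j \<le> 4 \<Longrightarrow> t \<in> {0<..<T} \<Longrightarrow> ((\<lambda>r. N i j r x) has_real_derivative N (Suc i) j t x) (at t)"
      and Ntame: "\<And>i j. i \<le> 2 \<Longrightarrow> j \<le> 4 \<Longrightarrow> tame T (N i j)"
      by (rule Cm_C4_jets[OF eta]) blast
    have e: "(deriv ^^ 0) psiI = psiI" "(deriv ^^ 1) psiI = deriv psiI" "Suc 0 = 1" "Suc 1 = 2" "Suc 2 = 3" "Suc 3 = 4" by simp_all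
    interpret beam_carleman psiI "deriv psiI" "(deriv ^^ 2) psiI" "(deriv ^^ 3) psiI" "(deriv ^^ 4) psiI" M0 k Psi mu lam T s N al del gam
    proof
      show "(psiI has_real_derivative deriv psiI x) (at x)" for x using smooth(1)[of 0 x, unfolded e] by simp
      show "(deriv psiI has_real_derivative (deriv ^^ 2) psiI x) (at x)" for x using smooth(1)[of 1 x, unfolded e] by simp
      show "((deriv ^^ 2) psiI has_real_derivative (deriv ^^ 3) psiI x) (at x)" for x using smooth(1)[of 2 x, unfolded e] by simp
      show "((deriv ^^ 3) psiI has_real_derivative (deriv ^^ 4) psiI x) (at x)" for x using smooth(1)[of 3 x, unfolded e] by simp
      show "continuous_on UNIV ((deriv ^^ 4) psiI)" by (rule smooth(2)) simp
      show "psiI (x + 2 * pi) = psiI x" for x using smooth(3)[of 0 x] by simp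
      show "deriv psiI (x + 2 * pi) = deriv psiI x" for x using smooth(3)[of 1 x] by simp
      show "(deriv ^^ 2) psiI (x + 2 * pi) = (deriv ^^ 2) psiI x" "(deriv ^^ 3) psiI (x + 2 * pi) = (deriv ^^ 3) psiI x"
        "(deriv ^^ 4) psiI (x + 2 * pi) = (deriv ^^ 4) psiI x" for x by (rule smooth(3))+
      show "\<bar>deriv psiI x\<bar> \<le> M0" for x using M0(2)[of 1 x] by simp
      show "\<bar>(deriv ^^ 2) psiI x\<bar> \<le> M0" "\<bar>(deriv ^^ 3) psiI x\<bar> \<le> M0" "\<bar>(deriv ^^ 4) psiI x\<bar> \<le> M0" for x by (rule M0(2); simp)+
      show "1 \<le> M0" by (rule M0(1))
      show "0 < psiI x" for x by (rule smooth(4))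
      show "psiI x \<le> Psi" for x by (rule psi_le)
      show "2 \<le> k" "1 \<le> mu" "mu \<le> lam" "0 < T" "0 < s" using k mu lam T s0 by simp_all
      show "(N i j t has_real_derivative N i (Suc j) t x) (at x)" if "i \<le> 2" "j < 4" "t \<in> {0<..<T}" for i j t x
        using Nx[OF that(1,2)] that(3) by simp
      show "((\<lambda>r. N i j r x) has_real_derivative N (Suc i) j t x) (at t)" if "i < 2" "j \<le> 4" "t \<in> {0<..<T}" for i j t x
        by (rule Nt[OF that])
      show "tame T (N i j)" if "i \<le> 2" "j \<le> 4" for i j by (rule Ntame[OF that])
      show "0 \<le> al" "0 < del" "del \<le> 1" "0 < gam" by (rule al del gam0(1))+
      show "s \<ge> 1 / del * (1 + al) * (T powr k + T powr (k - 1))" by (rule s)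
      show "4 * M0 / gam \<le> mu" using mu by simp
    qed
    have A_eq: "MA = A" and B_eq: "MM = B"
      unfolding A_def B_def MM_def MA_def by simp_all
    note est = weighted_estimate[OF cK(3)[folded A_eq] cK(2) gam0(2) JB refl D absorb[folded B_eq]]
    have jets: "dx j eta t x = N 0 j t x" "dt 1 eta t x = N 1 0 t x" "dt 1 (dx 1 eta) t x = N 1 1 t x"
      "dt 2 eta t x = N 2 0 t x" "dx 2 (dt 1 eta) t x = N 1 2 t x" "eta t x = N 0 0 t x" if "t \<in> {0<..<T}" for j t x
      by (rule jets_dt_dx[of N eta T, OF N0 Nj _ that], rule Nt, assumption+)+
    show "let phi = phi0 k Psi psiI T lam mu; xi = xi0 k Psi psiI T lam mu in
        integral_cyl T UNIV (\<lambda>t x. exp (2 * s * phi t x) *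
          (s^7 * mu^8 * (xi t x)^7 * \<bar>eta t x\<bar>^2
           + s^5 * mu^6 * (xi t x)^5 * \<bar>dx 1 eta t x\<bar>^2
           + s^3 * mu^4 * (xi t x)^3 * \<bar>dx 2 eta t x\<bar>^2
           + (1 + al^2) * s^3 * mu^4 * (xi t x)^3 * \<bar>dt 1 eta t x\<bar>^2
           + s * mu^2 * xi t x * \<bar>dx 3 eta t x\<bar>^2
           + (1 + al^2) * s * mu^2 * xi t x * \<bar>dt 1 (dx 1 eta) t x\<bar>^2))
        \<le> 32 * D *
          (integral_cyl T J (\<lambda>t x. exp (2 * s * phi t x) *
             (s^7 * mu^8 * (xi t x)^7 * \<bar>eta t x\<bar>^2
              + (1 + al^2) * s^3 * mu^4 * (xi t x)^3 * \<bar>dt 1 eta t x\<bar>^2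
              + s * mu^2 * xi t x * \<bar>dx 3 eta t x\<bar>^2
              + (1 + al^2) * s * mu^2 * xi t x * \<bar>dt 1 (dx 1 eta) t x\<bar>^2))
           + al^2 * s^3 * mu^4 * integral_cyl T UNIV (\<lambda>t x.
               (xi t x)^3 * exp (2 * s * phi t x) * \<bar>dt 1 eta t x\<bar>^2)
           + integral_cyl T UNIV (\<lambda>t x. exp (2 * s * phi t x) *
               \<bar>dt 2 eta t x - al * dx 2 (dt 1 eta) t x + dx 4 eta t x\<bar>^2))"
    proof -
      define phi where "phi = phi0 k Psi psiI T lam mu"
      define xi where "xi = xi0 k Psi psiI T lam mu"
      have w: "exp (2 * s * phi t x) = exp (2 * kap t x)" for t x unfolding kap_def phi_def by (simp add: mult.assoc)
      note pw = integrand_powers[folded xi_def]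
      have 1: "integral_cyl T UNIV (\<lambda>t x. exp (2 * s * phi t x) *
          (s^7 * mu^8 * (xi t x)^7 * \<bar>eta t x\<bar>^2
           + s^5 * mu^6 * (xi t x)^5 * \<bar>dx 1 eta t x\<bar>^2
           + s^3 * mu^4 * (xi t x)^3 * \<bar>dx 2 eta t x\<bar>^2
           + (1 + al^2) * s^3 * mu^4 * (xi t x)^3 * \<bar>dt 1 eta t x\<bar>^2
           + s * mu^2 * xi t x * \<bar>dx 3 eta t x\<bar>^2
           + (1 + al^2) * s * mu^2 * xi t x * \<bar>dt 1 (dx 1 eta) t x\<bar>^2))
         = wint (\<lambda>t x. Xf t x + (1 + al^2) * (T0f t x + T1f t x))"
        unfolding wint_def
      proof (rule integral_cyl_cong)
        fix t x assume t: "t \<in> {0<..<T}"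
        show "exp (2 * s * phi t x) *
          (s^7 * mu^8 * (xi t x)^7 * \<bar>eta t x\<bar>^2
           + s^5 * mu^6 * (xi t x)^5 * \<bar>dx 1 eta t x\<bar>^2
           + s^3 * mu^4 * (xi t x)^3 * \<bar>dx 2 eta t x\<bar>^2
           + (1 + al^2) * s^3 * mu^4 * (xi t x)^3 * \<bar>dt 1 eta t x\<bar>^2
           + s * mu^2 * xi t x * \<bar>dx 3 eta t x\<bar>^2
           + (1 + al^2) * s * mu^2 * xi t x * \<bar>dt 1 (dx 1 eta) t x\<bar>^2)
          = exp (2 * kap t x) * (Xf t x + (1 + al^2) * (T0f t x + T1f t x))"
          unfolding w jets[OF t] Xf_def xenergy_def T0f_def T1f_def distrib_left[of "eps t x"] pw[OF t]
          by (simp only: mult.assoc distrib_left add_ac)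
      qed
      have 2: "integral_cyl T J (\<lambda>t x. exp (2 * s * phi t x) *
             (s^7 * mu^8 * (xi t x)^7 * \<bar>eta t x\<bar>^2
              + (1 + al^2) * s^3 * mu^4 * (xi t x)^3 * \<bar>dt 1 eta t x\<bar>^2
              + s * mu^2 * xi t x * \<bar>dx 3 eta t x\<bar>^2
              + (1 + al^2) * s * mu^2 * xi t x * \<bar>dt 1 (dx 1 eta) t x\<bar>^2))
         = integral_cyl T J (\<lambda>t x. exp (2 * kap t x) * Jf t x)"
      proof (rule integral_cyl_cong)
        fix t x assume t: "t \<in> {0<..<T}"
        show "exp (2 * s * phi t x) *
             (s^7 * mu^8 * (xi t x)^7 * \<bar>eta t x\<bar>^2
              + (1 + al^2) * s^3 * mu^4 * (xi t x)^3 * \<bar>dt 1 eta t x\<bar>^2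
              + s * mu^2 * xi t x * \<bar>dx 3 eta t x\<bar>^2
              + (1 + al^2) * s * mu^2 * xi t x * \<bar>dt 1 (dx 1 eta) t x\<bar>^2) = exp (2 * kap t x) * Jf t x"
          unfolding w jets[OF t] Jf_def distrib_left[of "eps t x"] mult.left_commute[of "eps t x" "1 + al^2"] pw[OF t]
          by (simp only: mult.assoc distrib_left add_ac)
      qed
      have 3: "al^2 * s^3 * mu^4 * integral_cyl T UNIV (\<lambda>t x. (xi t x)^3 * exp (2 * s * phi t x) * \<bar>dt 1 eta t x\<bar>^2) = al^2 * wint T0f"
      proof -
        have "wint T0f = wint (\<lambda>t x. s^3 * mu^4 * ((xi t x)^3 * \<bar>dt 1 eta t x\<bar>^2))"
          unfolding wint_def T0f_def by (rule integral_cyl_cong) (simp only: pw jets mult.assoc)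
        also have "\<dots> = s^3 * mu^4 * integral_cyl T UNIV (\<lambda>t x. (xi t x)^3 * exp (2 * s * phi t x) * \<bar>dt 1 eta t x\<bar>^2)"
          unfolding wint_cmult wint_def w by (simp only: mult.assoc mult.left_commute[of "exp _"])
        finally show ?thesis by (simp only: mult.assoc)
      qed
      have 4: "integral_cyl T UNIV (\<lambda>t x. exp (2 * s * phi t x) * \<bar>dt 2 eta t x - al * dx 2 (dt 1 eta) t x + dx 4 eta t x\<bar>^2)
        = wint (\<lambda>t x. Pf t x^2)"
        unfolding wint_def Pf_def by (rule integral_cyl_cong) (simp only: w jets power2_abs)
      show ?thesis unfolding Let_def phi_def[symmetric] xi_def[symmetric] 1 2 3 4 by (rule est)
    qed
  qed
qed

end
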